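(* There exists an absolute constant $c>0$ such that the following holds. Let $n,b\in\mathbb{N}$ and $\Delta\in\mathbb{R}^+$ satisfy $\Delta\ge\log n$. Then the $(1\,{:}\,b)$ Maker-Breaker $\mathcal{T}(n,\Delta)$-universality game is Maker's win on every $(n,d)$-expander with $d\ge c\,b\,\Delta\, n^{2/3}\log n$.
   Context: An $(a\,{:}\,b)$ Maker-Breaker game on a finite hypergraph $(X,\mathcal{F})$: Maker and Breaker alternately claim previously unclaimed elements of $X$, Maker first, Maker claiming $a$ and Breaker $b$ elements per turn, until all elements are claimed. Maker wins if he claims all elements of some $F\in\mathcal{F}$; otherwise Breaker wins. The game is Maker's win if Maker has a strategy winning against every Breaker strategy. The Maker-Breaker $\mathcal{T}(n,\Delta)$-universality game on a graph $G$ is the game on $(E(G),\mathcal{F})$ where $\mathcal{F}$ consists of all $F\subseteq E(G)$ such that $(V(G),F)$ contains a copy of every $n$-vertex tree of maximum degree at most $\Delta$ ($\mathcal{T}(n,\Delta)$ denotes this class of trees). For a graph $G$ and $X\subseteq V(G)$, $N_G(X)=\{y\in V(G)\setminus X:\exists x\in X,\{x,y\}\in E(G)\}$; $e_G(X,Y)$ counts ordered pairs $(x,y)\in X\times Y$ with $\{x,y\}\in E(G)$. With $m(n,d)=\lceil n/(2d)\rceil$, $G$ is an $(n,d)$-expander if $|V(G)|=n$, $|N_G(X)|\ge d|X|$ whenever $1\le|X|<m(n,d)$, and $e_G(X,Y)>0$ for all disjoint $X,Y$ with $|X|=|Y|=m(n,d)$. $\log$ is the natural logarithm.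
   Formalization: The formal statement adds d ≤ n (and reads n, b as positive); without it the claim fails, since K_3 is a (3,d)-expander for all large d, yet with b = 2, Δ = 2 Maker gets one edge and cannot build the 3-vertex path. *)

theory Defs
  imports Complex_Main
begin

section \<open>Finite simple graphs\<close>

type_synonym 'v graph = "'v set \<times> 'v set set"

abbreviation vset :: "'v graph \<Rightarrow> 'v set" where "vset \<equiv> fst"
abbreviation eset :: "'v graph \<Rightarrow> 'v set set" where "eset \<equiv> snd"

definition simple_graph :: "'v graph \<Rightarrow> bool" where
  "simple_graph G \<longleftrightarrow> finite (vset G) \<and> (\<forall>e\<in>eset G. e \<subseteq> vset G \<and> card e = 2)"

definition vdegree :: "'v graph \<Rightarrow> 'v \<Rightarrow> nat" where
  "vdegree G v = card {e \<in> eset G. v \<in> e}"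

definition max_degree :: "'v graph \<Rightarrow> nat" where
  "max_degree G = Max (vdegree G ` vset G)"

definition connected_graph :: "'v graph \<Rightarrow> bool" where
  "connected_graph G \<longleftrightarrow> vset G \<noteq> {} \<and>
     (\<forall>u\<in>vset G. \<forall>v\<in>vset G. (u, v) \<in> {(x, y). {x, y} \<in> eset G}\<^sup>*)"

definition graph_cycle :: "'v graph \<Rightarrow> 'v list \<Rightarrow> bool" where
  "graph_cycle G xs \<longleftrightarrow> 3 \<le> length xs \<and> distinct xs \<and>
     (\<forall>i<length xs. {xs ! i, xs ! (Suc i mod length xs)} \<in> eset G)"

definition is_tree :: "'v graph \<Rightarrow> bool" where
  "is_tree T \<longleftrightarrow> simple_graph T \<and> connected_graph T \<and> (\<nexists>xs. graph_cycle T xs)"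

text \<open>Up to isomorphism every finite graph has natural numbers as vertices, so nothing is lost
  by taking the trees on that vertex type.\<close>

definition bounded_degree_trees :: "nat \<Rightarrow> real \<Rightarrow> nat graph set" where
  "bounded_degree_trees n \<Delta> =
     {T. is_tree T \<and> card (vset T) = n \<and> real (max_degree T) \<le> \<Delta>}"

definition contains_copy :: "'v graph \<Rightarrow> 'w graph \<Rightarrow> bool" where
  "contains_copy G H \<longleftrightarrow>
     (\<exists>f. inj_on f (vset H) \<and> f ` vset H \<subseteq> vset G \<and> (\<forall>e\<in>eset H. f ` e \<in> eset G))"


section \<open>Expanders\<close>

definition nbhd :: "'v graph \<Rightarrow> 'v set \<Rightarrow> 'v set" where
  "nbhd G X = {y \<in> vset G - X. \<exists>x\<in>X. {x, y} \<in> eset G}"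

definition edge_count :: "'v graph \<Rightarrow> 'v set \<Rightarrow> 'v set \<Rightarrow> nat" where
  "edge_count G X Y = card {(x, y). x \<in> X \<and> y \<in> Y \<and> {x, y} \<in> eset G}"

definition exp_size :: "nat \<Rightarrow> real \<Rightarrow> nat" where
  "exp_size n d = nat \<lceil>real n / (2 * d)\<rceil>"

definition expander :: "nat \<Rightarrow> real \<Rightarrow> 'v graph \<Rightarrow> bool" where
  "expander n d G \<longleftrightarrow> simple_graph G \<and> card (vset G) = n \<and>
     (\<forall>X\<subseteq>vset G. 1 \<le> card X \<and> card X < exp_size n d \<longrightarrow>
        d * real (card X) \<le> real (card (nbhd G X))) \<and>
     (\<forall>X Y. X \<subseteq> vset G \<and> Y \<subseteq> vset G \<and> X \<inter> Y = {} \<and>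
        card X = exp_size n d \<and> card Y = exp_size n d \<longrightarrow> 0 < edge_count G X Y)"


section \<open>Maker-Breaker games\<close>

text \<open>A history lists the sets claimed so far, one per turn, Maker's first. A strategy assigns to
  every history the set claimed next. A player who is entitled to more elements than remain claims
  all the remaining ones; in particular, once the board is exhausted every move is empty, which
  lets a play be a sequence indexed by all natural numbers.\<close>

type_synonym 'x strategy = "'x set list \<Rightarrow> 'x set"

definition legal_strategy :: "'x set \<Rightarrow> nat \<Rightarrow> 'x strategy \<Rightarrow> bool" where
  "legal_strategy X k \<sigma> \<longleftrightarrow>
     (\<forall>h. \<sigma> h \<subseteq> X - \<Union>(set h) \<and> card (\<sigma> h) = min k (card (X - \<Union>(set h))))"

primrec history :: "'x strategy \<Rightarrow> 'x strategy \<Rightarrow> nat \<Rightarrow> 'x set list" where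
  "history \<sigma> \<tau> 0 = []"
| "history \<sigma> \<tau> (Suc t) =
     history \<sigma> \<tau> t @ [if even t then \<sigma> (history \<sigma> \<tau> t) else \<tau> (history \<sigma> \<tau> t)]"

definition maker_claims :: "'x strategy \<Rightarrow> 'x strategy \<Rightarrow> 'x set" where
  "maker_claims \<sigma> \<tau> = (\<Union>t\<in>{t. even t}. \<sigma> (history \<sigma> \<tau> t))"

definition makers_win :: "nat \<Rightarrow> nat \<Rightarrow> 'x set \<Rightarrow> 'x set set \<Rightarrow> bool" where
  "makers_win a b X \<F> \<longleftrightarrow>
     (\<exists>\<sigma>. legal_strategy X a \<sigma> \<and>
        (\<forall>\<tau>. legal_strategy X b \<tau> \<longrightarrow> (\<exists>F\<in>\<F>. F \<subseteq> maker_claims \<sigma> \<tau>)))"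

definition tree_universal_sets :: "nat \<Rightarrow> real \<Rightarrow> 'v graph \<Rightarrow> 'v set set set" where
  "tree_universal_sets n \<Delta> G =
     {F. F \<subseteq> eset G \<and> (\<forall>T\<in>bounded_degree_trees n \<Delta>. contains_copy (vset G, F) T)}"

definition universality_game_makers_win :: "nat \<Rightarrow> nat \<Rightarrow> nat \<Rightarrow> real \<Rightarrow> 'v graph \<Rightarrow> bool" where
  "universality_game_makers_win a b n \<Delta> G \<longleftrightarrow>
     makers_win a b (eset G) (tree_universal_sets n \<Delta> G)"

end

theory Submission
  imports Defs
begin

text \<open>Maker aims at a graph \<open>M\<close> on the vertex set of \<open>G\<close> with large minimum degree in which any two
  disjoint sets of \<open>m\<close> vertices are joined by an edge. Both properties say that certain sets of
  edges of \<open>G\<close> are hit, so Beck's potential argument applies; the factor \<open>b * ln n\<close> lost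
  there is the one provided by the hypothesis, and one ends with minimum degree of order
  \<open>\<Delta> * n powr (2/3)\<close> and \<open>m\<close> of order \<open>n powr (1/3) / \<Delta>\<close>.

  Such a graph contains every spanning tree, because the minimum degree exceeds \<open>\<Delta> * m\<^sup>2 * ln n\<close>.
  Any \<open>m\<close> vertices dominate all but fewer than \<open>m\<close> others, so there are small sets in which every vertex
  has many neighbours. Almost all of the tree is embedded greedily: fewer than \<open>m\<close> vertices ever run out of
  free neighbours, and these use a reserved set. The rest is finished exactly. If the tree has many leaves,
  they are placed last by Hall's theorem. Otherwise it has many disjoint paths of length \<open>O(ln n)\<close> whose
  vertices have one child each. The leftover vertices are matched to the upper ends of these paths and to the
  inputs of a Benes routing network prepared in \<open>M\<close>, the lower ends are matched to its outputs, and the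
  network realises whatever permutation these uncontrolled matchings require.\<close>

section \<open>Hall's theorem and the splitting of permutations\<close>

text \<open>The exponent 2/3 is forced by the sizes. An expander joins disjoint sets of order
  \<open>n / d\<close> and has degrees of order \<open>d\<close>; the game costs a factor
  \<open>b * ln n\<close> in both, so \<open>m\<close> is of order \<open>n * b * ln n / d\<close>
  and the minimum degree of order \<open>d / (b * ln n)\<close>. That the latter exceed
  \<open>\<Delta> * m\<^sup>2 * ln n\<close> then asks for \<open>d ^ 3\<close> of order
  \<open>\<Delta> * n\<^sup>2 * (b * ln n) ^ 3 * ln n\<close>, and
  \<open>ln n \<le> \<Delta>\<close> absorbs the last logarithm. The obstacle is that no vertex is
  spare at the end, while Hall's theorem gives no say in who is matched with whom: linking paths
  fixed in advance would join the wrong ends. The routing network helps because, for every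
  permutation, its paths have the same length and together cover the same vertex set. Its depth
  dictates the length of the tree paths, and unary vertices are wanted there so that nothing hangs
  off the part that is cut out. Few leaves means few vertices that are not unary; hence the two
  cases.\<close>

lemma hall_marriage:
  assumes "finite I" "\<And>i. i \<in> I \<Longrightarrow> finite (S i)"
    and "\<And>J. J \<subseteq> I \<Longrightarrow> card J \<le> card (\<Union> (S ` J))"
  shows "\<exists>R. (\<forall>i\<in>I. R i \<in> S i) \<and> inj_on R I"
  using assms
proof (induction "card I" arbitrary: I S rule: less_induct)
  case less
  note fin = less.prems(1) and finS = less.prems(2) and hall = less.prems(3)
  show ?case
  proof (cases "I = {}")
    case True
    then show ?thesis by simp
  next
    case ne: False
    show ?thesis
    \<comment> \<open>If a proper subset \<open>J\<close> is tight, it is matched first and the rest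
      avoids its neighbourhood. Otherwise every proper nonempty subset has a neighbour to spare, and
      one element can be matched arbitrarily.\<close>
    proof (cases "\<exists>J. J \<subset> I \<and> J \<noteq> {} \<and> card (\<Union> (S ` J)) = card J")
      case True
      then obtain J where J: "J \<subset> I" "J \<noteq> {}" "card (\<Union> (S ` J)) = card J" by blast
      have finJ: "finite J" using J(1) fin finite_subset by blast
      have "\<exists>R. (\<forall>i\<in>J. R i \<in> S i) \<and> inj_on R J"
      proof (rule less.hyps)
        show "card J < card I" by (rule psubset_card_mono[OF fin J(1)])
        show "finite (S i)" if "i \<in> J" for i using finS J(1) that by blast
        show "card K \<le> card (\<Union> (S ` K))" if "K \<subseteq> J" for K using hall J(1) that by blast
      qed (rule finJ)
      then obtain R1 where R1: "\<forall>i\<in>J. R1 i \<in> S i" "inj_on R1 J" by blast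
      define S' where "S' j = S j - \<Union> (S ` J)" for j
      have c: "card (I - J) < card I"
        using J fin by (intro psubset_card_mono) auto
      have "\<exists>R. (\<forall>i\<in>I - J. R i \<in> S' i) \<and> inj_on R (I - J)"
      proof (rule less.hyps[OF c])
        show "finite (I - J)" using fin by simp
        show "finite (S' i)" if "i \<in> I - J" for i using that finS by (simp add: S'_def)
        show "card K \<le> card (\<Union> (S' ` K))" if K: "K \<subseteq> I - J" for K
        proof -
          have finK: "finite K" using K fin finite_subset by blast
          have "card K + card J = card (K \<union> J)"
            using K finK finJ by (subst card_Un_disjoint) auto
          also have "\<dots> \<le> card (\<Union> (S ` (K \<union> J)))" using hall[of "K \<union> J"] K J(1) by blast
          also have "\<Union> (S ` (K \<union> J)) = \<Union> (S' ` K) \<union> \<Union> (S ` J)" by (auto simp: S'_def)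
          also have "card \<dots> \<le> card (\<Union> (S' ` K)) + card (\<Union> (S ` J))" by (rule card_Un_le)
          finally show ?thesis using J(3) by linarith
        qed
      qed
      then obtain R2 where R2: "\<forall>i\<in>I - J. R2 i \<in> S' i" "inj_on R2 (I - J)" by blast
      define R where "R i = (if i \<in> J then R1 i else R2 i)" for i
      have "\<forall>i\<in>I. R i \<in> S i" using R1(1) R2(1) by (auto simp: R_def S'_def)
      moreover have "inj_on R I"
      proof (rule inj_onI)
        fix x y assume xy: "x \<in> I" "y \<in> I" "R x = R y"
        have sep: "R1 u \<noteq> R2 v" if "u \<in> J" "v \<in> I - J" for u v
          using R1(1) R2(1) that by (force simp: S'_def)
        have sep2: "R2 v \<noteq> R1 u" if "u \<in> J" "v \<in> I - J" for u v
          using sep[OF that] by simp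
        show "x = y"
          using xy R1(2) R2(2) sep sep2 unfolding R_def inj_on_def
          by (auto split: if_splits)
      qed
      ultimately show ?thesis by blast
    next
      case False
      obtain i where i: "i \<in> I" using ne by blast
      have "card {i} \<le> card (\<Union> (S ` {i}))" using hall[of "{i}"] i by blast
      then have "S i \<noteq> {}" by auto
      then obtain x where x: "x \<in> S i" by blast
      define S' where "S' j = S j - {x}" for j
      have c: "card (I - {i}) < card I" using fin i by (meson card_Diff1_less)
      have "\<exists>R. (\<forall>j\<in>I - {i}. R j \<in> S' j) \<and> inj_on R (I - {i})"
      proof (rule less.hyps[OF c])
        show "finite (I - {i})" using fin by simp
        show "finite (S' j)" if "j \<in> I - {i}" for j using that finS by (simp add: S'_def)
        show "card K \<le> card (\<Union> (S' ` K))" if K: "K \<subseteq> I - {i}" for K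
        proof (cases "K = {}")
          case Kne: False
          have KI: "K \<subset> I" using K i by blast
          have "card K \<le> card (\<Union> (S ` K))" using hall[of K] KI by blast
          moreover have "card (\<Union> (S ` K)) \<noteq> card K" using False KI Kne by blast
          ultimately have lt: "card K < card (\<Union> (S ` K))" by linarith
          have "\<Union> (S' ` K) = \<Union> (S ` K) - {x}" by (auto simp: S'_def)
          then have "card (\<Union> (S ` K)) - 1 \<le> card (\<Union> (S' ` K))"
            using diff_card_le_card_Diff[of "{x}" "\<Union> (S ` K)"] by simp
          then show ?thesis using lt by linarith
        qed simp
      qed
      then obtain R where R: "\<forall>j\<in>I - {i}. R j \<in> S' j" "inj_on R (I - {i})" by blast
      have "\<forall>j\<in>I. (R(i := x)) j \<in> S j" using R(1) x by (auto simp: S'_def)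
      moreover have "inj_on (R(i := x)) I"
        using R unfolding inj_on_def S'_def by auto
      ultimately show ?thesis by blast
    qed
  qed
qed

text \<open>A first-stage switch holds the wires \<open>i\<close> and \<open>i + N\<close>, a
  last-stage switch two outputs that agree modulo \<open>N\<close>. The wires are the edges of a
  2-regular bipartite multigraph between these switches; \<open>U\<close> is a perfect matching in
  it, and the wires outside \<open>U\<close> form another one. Each half can thus be sent through a
  subnetwork on \<open>N\<close> wires.\<close>

lemma benes_split:
  assumes N: "0 < (N::nat)" and pi: "bij_betw \<pi> {..<2*N} {..<2*N}"
  shows "\<exists>U\<subseteq>{..<2*N}. bij_betw (\<lambda>k. k mod N) U {..<N} \<and> bij_betw (\<lambda>k. \<pi> k mod N) U {..<N} \<and>
     bij_betw (\<lambda>k. k mod N) ({..<2*N} - U) {..<N} \<and>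
     bij_betw (\<lambda>k. \<pi> k mod N) ({..<2*N} - U) {..<N}"
proof -
  have fib: "{k\<in>{..<2*N}. k mod N = i} = {i, i + N}" if "i < N" for i
  proof -
    have "k = i \<or> k = i + N" if "k < 2*N" "k mod N = i" for k
    proof (cases "k < N")
      case False
      then have "k mod N = k - N" using that(1) by (simp add: mod_if)
      then show ?thesis using that False by simp
    qed (use that in simp)
    then show ?thesis using that by auto
  qed
  have pisub: "\<pi> ` A \<subseteq> {..<2*N}" if "A \<subseteq> {..<2*N}" for A
    using pi that unfolding bij_betw_def by blast
  define S where "S i = (\<lambda>k. \<pi> k mod N) ` {i, i + N}" for i
  have "\<exists>R. (\<forall>i\<in>{..<N}. R i \<in> S i) \<and> inj_on R {..<N}"
  proof (rule hall_marriage)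
    fix J assume J: "J \<subseteq> {..<N}"
    define K where "K = J \<union> (\<lambda>i. i + N) ` J"
    have KN: "K \<subseteq> {..<2*N}" using J by (auto simp: K_def)
    have finJ: "finite J" using J finite_subset by blast
    have "J \<inter> (\<lambda>i. i + N) ` J = {}" using J by auto
    then have cK: "card K = 2 * card J"
      using finJ unfolding K_def by (subst card_Un_disjoint) (auto simp: card_image)
    have cpK: "card (\<pi> ` K) = card K"
      using pi KN by (meson bij_betw_def card_image inj_on_subset)
    have US: "\<Union> (S ` J) = (\<lambda>k. k mod N) ` (\<pi> ` K)"
      by (auto simp: S_def K_def)
    define I where "I = \<Union> (S ` J)"
    have IN: "I \<subseteq> {..<N}" using N by (auto simp: I_def S_def)
    have finI: "finite I" using IN finite_subset by blast
    \<comment> \<open>Double counting for Hall's condition: the \<open>2 * card J\<close> wires of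
      the switches in \<open>J\<close> end in the switches of \<open>I\<close>, which have two
      outputs each.\<close>
    have "\<pi> ` K \<subseteq> (\<Union>i\<in>I. {i, i + N})"
    proof
      fix k assume k: "k \<in> \<pi> ` K"
      then have "k < 2*N" using pisub[OF KN] by blast
      moreover have "k mod N \<in> I" using k US I_def by blast
      ultimately have "k \<in> {k mod N, k mod N + N}"
        using fib[of "k mod N"] N by (metis (mono_tags, lifting) lessThan_iff mem_Collect_eq mod_less_divisor)
      then show "k \<in> (\<Union>i\<in>I. {i, i + N})" using \<open>k mod N \<in> I\<close> by blast
    qed
    then have "card (\<pi> ` K) \<le> card (\<Union>i\<in>I. {i, i + N})"
      using finI by (intro card_mono) auto
    also have "\<dots> \<le> (\<Sum>i\<in>I. card {i, i + N})" using finI by (rule card_UN_le)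
    also have "\<dots> \<le> (\<Sum>i\<in>I. 2)" by (intro sum_mono) (simp add: card_insert_if)
    finally have "card (\<pi> ` K) \<le> 2 * card I" by simp
    then show "card J \<le> card (\<Union> (S ` J))" unfolding I_def[symmetric] using cK cpK by linarith
  qed (auto simp: S_def)
  then obtain R where R: "\<forall>i\<in>{..<N}. R i \<in> S i" "inj_on R {..<N}" by blast
  have "\<forall>i\<in>{..<N}. \<exists>x. x \<in> {i, i + N} \<and> R i = \<pi> x mod N" using R(1) by (auto simp: S_def)
  then obtain x where x: "\<And>i. i < N \<Longrightarrow> x i \<in> {i, i + N}" "\<And>i. i < N \<Longrightarrow> R i = \<pi> (x i) mod N"
    by (metis lessThan_iff)
  define U where "U = x ` {..<N}"
  have xm: "x i mod N = i" if "i < N" for i using x(1)[OF that] that by (elim insertE) auto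
  have UN: "U \<subseteq> {..<2*N}"
  proof
    fix u assume "u \<in> U"
    then obtain i where "i < N" "u = x i" by (auto simp: U_def)
    then show "u \<in> {..<2*N}" using x(1)[of i] by auto
  qed
  have b1: "bij_betw (\<lambda>k. k mod N) U {..<N}"
    unfolding bij_betw_def
  proof
    show "inj_on (\<lambda>k. k mod N) U"
      by (rule inj_on_inverseI[where g = x]) (clarsimp simp: U_def xm simp del: mod_less_divisor)
    show "(\<lambda>k. k mod N) ` U = {..<N}"
      unfolding U_def image_image using xm by (simp cong: image_cong_simp)
  qed
  have cU: "card U = N" by (rule bij_betw_same_card[OF b1, unfolded card_lessThan])

  have i2: "inj_on (\<lambda>k. \<pi> k mod N) U"
  proof -
    have "inj_on ((\<lambda>k. \<pi> k mod N) \<circ> x) {..<N}"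
    proof (rule inj_onI)
      fix i j assume ij: "i \<in> {..<N}" "j \<in> {..<N}"
        "((\<lambda>k. \<pi> k mod N) \<circ> x) i = ((\<lambda>k. \<pi> k mod N) \<circ> x) j"
      then have "R i = R j" by (simp only: x(2) lessThan_iff o_apply)
      then show "i = j" using R(2) ij unfolding inj_on_def by blast
    qed
    then show ?thesis unfolding U_def by (rule inj_on_imageI)
  qed
  have b2: "bij_betw (\<lambda>k. \<pi> k mod N) U {..<N}"
    unfolding bij_betw_def
  proof
    show "(\<lambda>k. \<pi> k mod N) ` U = {..<N}"
      by (rule card_subset_eq) (use N i2 cU in \<open>auto simp: card_image\<close>)
  qed (rule i2)
  have cV: "card ({..<2*N} - U) = N" using cU UN by (simp add: card_Diff_subset finite_subset)
  have other: "k' \<in> {k mod N, k mod N + N}" if "k' < 2*N" "k' mod N = k mod N" for k k'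
    using that N by (metis (mono_tags, lifting) fib lessThan_iff mem_Collect_eq mod_less_divisor)
  \<comment> \<open>Each residue class has two members and \<open>U\<close> contains one of them, so
    one remains outside \<open>U\<close>; \<open>i4\<close> is the same on the output side.\<close>
  have i3: "inj_on (\<lambda>k. k mod N) ({..<2*N} - U)"
  proof (rule inj_onI)
    fix k k' assume k: "k \<in> {..<2*N} - U" "k' \<in> {..<2*N} - U" "k mod N = k' mod N"
    have "x (k mod N) \<in> U" "x (k mod N) \<in> {k mod N, k mod N + N}" using N x(1) U_def by auto
    moreover have "k \<in> {k mod N, k mod N + N}" "k' \<in> {k mod N, k mod N + N}"
      using k other[of k k] other[of k' k] by auto
    ultimately show "k = k'" using k by auto
  qed
  have b3: "bij_betw (\<lambda>k. k mod N) ({..<2*N} - U) {..<N}"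
    unfolding bij_betw_def
  proof
    show "(\<lambda>k. k mod N) ` ({..<2*N} - U) = {..<N}"
      by (rule card_subset_eq) (use N i3 cV in \<open>auto simp: card_image\<close>)
  qed (rule i3)
  have i4: "inj_on (\<lambda>k. \<pi> k mod N) ({..<2*N} - U)"
  proof (rule inj_onI)
    fix k k' assume k: "k \<in> {..<2*N} - U" "k' \<in> {..<2*N} - U" "\<pi> k mod N = \<pi> k' mod N"
    obtain u where u: "u \<in> U" "\<pi> u mod N = \<pi> k mod N"
      using b2 N unfolding bij_betw_def by (metis (no_types, lifting) image_iff lessThan_iff mod_less_divisor)
    have lt: "\<pi> u < 2*N" "\<pi> k < 2*N" "\<pi> k' < 2*N" using pisub[of "{u}"] pisub[of "{k}"] pisub[of "{k'}"] UN u k by auto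
    have "\<pi> u \<noteq> \<pi> k" "\<pi> u \<noteq> \<pi> k'" using pi u k UN unfolding bij_betw_def inj_on_def by (metis DiffE subsetD)+
    moreover have "\<pi> u \<in> {\<pi> k mod N, \<pi> k mod N + N}" "\<pi> k \<in> {\<pi> k mod N, \<pi> k mod N + N}"
      "\<pi> k' \<in> {\<pi> k mod N, \<pi> k mod N + N}"
      using other lt u k(3) by metis+
    ultimately have "\<pi> k = \<pi> k'" by auto
    then show "k = k'" using pi k unfolding bij_betw_def inj_on_def by blast
  qed
  have b4: "bij_betw (\<lambda>k. \<pi> k mod N) ({..<2*N} - U) {..<N}"
    unfolding bij_betw_def
  proof
    show "(\<lambda>k. \<pi> k mod N) ` ({..<2*N} - U) = {..<N}"
      by (rule card_subset_eq) (use N i4 cV in \<open>auto simp: card_image\<close>)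
  qed (rule i4)
  show ?thesis using UN b1 b2 b3 b4 by blast
qed

section \<open>Joined graphs\<close>

definition nbrs :: "'v set set \<Rightarrow> 'v \<Rightarrow> 'v set" where
  "nbrs E v = {u. {v, u} \<in> E}"

locale joined_graph =
  fixes V :: "'v set" and E :: "'v set set" and m \<delta> :: nat
  assumes finV: "finite V"
    \<comment> \<open>Since \<open>{u, v} = {v, u}\<close>, this yields \<open>v \<in> V\<close> as
      well.\<close>
    and edgeV: "\<And>u v. {u, v} \<in> E \<Longrightarrow> u \<in> V \<and> u \<noteq> v"
    and joined: "\<And>X Y. X \<subseteq> V \<Longrightarrow> Y \<subseteq> V \<Longrightarrow> X \<inter> Y = {} \<Longrightarrow> card X = m \<Longrightarrow> card Y = m \<Longrightarrow>
        \<exists>x\<in>X. \<exists>y\<in>Y. {x, y} \<in> E"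
    and mindeg: "\<And>v. v \<in> V \<Longrightarrow> \<delta> \<le> card (nbrs E v)"
    and m_pos: "1 \<le> m"
begin

abbreviation "nb \<equiv> nbrs E"

lemma nb_subset: "nb v \<subseteq> V - {v}"
proof
  fix u assume "u \<in> nb v"
  then have "{u, v} \<in> E" by (simp add: nbrs_def insert_commute)
  then show "u \<in> V - {v}" using edgeV by simp
qed

lemma finite_nb [simp]: "finite (nb v)"
  using nb_subset finV by (meson finite_Diff finite_subset)

lemma nb_commute: "u \<in> nb v \<longleftrightarrow> v \<in> nb u"
  by (simp add: nbrs_def insert_commute)

lemma joined_ge:
  assumes "X \<subseteq> V" "Y \<subseteq> V" "X \<inter> Y = {}" "m \<le> card X" "m \<le> card Y"
  shows "\<exists>x\<in>X. \<exists>y\<in>Y. y \<in> nb x"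
proof -
  obtain X' where X': "X' \<subseteq> X" "card X' = m" using assms(4) by (meson obtain_subset_with_card_n)
  obtain Y' where Y': "Y' \<subseteq> Y" "card Y' = m" using assms(5) by (meson obtain_subset_with_card_n)
  have "\<exists>x\<in>X'. \<exists>y\<in>Y'. {x, y} \<in> E"
    using assms(1-3) X' Y' by (intro joined) auto
  then show ?thesis using X' Y' by (auto simp: nbrs_def)
qed

text \<open>\<open>m\<close> vertices of \<open>C\<close> without neighbours in \<open>X\<close>
  would contradict joinedness, which enters most later arguments in this form.\<close>

lemma few_nonadjacent:
  assumes "X \<subseteq> V" "C \<subseteq> V" "X \<inter> C = {}" "m \<le> card X"
  shows "card {c\<in>C. nb c \<inter> X = {}} < m"
proof (rule ccontr)
  assume "\<not> ?thesis"
  then have "m \<le> card {c\<in>C. nb c \<inter> X = {}}" by simp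
  then have "\<exists>c\<in>{c\<in>C. nb c \<inter> X = {}}. \<exists>x\<in>X. x \<in> nb c"
    using assms by (intro joined_ge) auto
  then show False by blast
qed

lemma free_nbrs:
  assumes "v \<in> V" "finite B" "card B + k \<le> \<delta>"
  shows "\<exists>X\<subseteq>nb v - B. card X = k"
proof -
  have "card (nb v) - card B \<le> card (nb v - B)" using assms(2) by (rule diff_card_le_card_Diff)
  then have "k \<le> card (nb v - B)" using mindeg[OF assms(1)] assms(3) by linarith
  then show ?thesis by (meson obtain_subset_with_card_n)
qed

text \<open>Any \<open>m\<close> vertices \<open>A\<close> dominate everything outside
  \<open>A\<close> with fewer than \<open>m\<close> exceptions \<open>U\<close>. Each of the at most
  \<open>2 * m\<close> vertices in \<open>A \<union> U\<close> then contributes one neighbour of its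
  own.\<close>

lemma dominating_set:
  assumes "finite B" "card B + m \<le> \<delta>" "V \<noteq> {}"
  shows "\<exists>X\<subseteq>V - B. card X \<le> 3 * m \<and> (\<forall>v\<in>V. nb v \<inter> X \<noteq> {})"
proof -
  obtain v0 where "v0 \<in> V" using assms(3) by blast
  from free_nbrs[OF this assms(1,2)] obtain A where A: "A \<subseteq> V - B" "card A = m"
    using nb_subset by blast
  define U where "U = {c\<in>V - A. nb c \<inter> A = {}}"
  have "card U < m" unfolding U_def using A by (intro few_nonadjacent) auto
  moreover have fin: "finite A" "finite U" using A finV finite_subset by (auto simp: U_def)
  ultimately have cUA: "card (A \<union> U) \<le> 2 * m" using card_Un_le[of A U] A by linarith
  have "\<exists>x. x \<in> nb v - B" if "v \<in> V" for v
    using free_nbrs[of v B 1] that assms(1,2) m_pos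
    by (auto simp: card_1_singleton_iff)
  then obtain g where g: "\<And>v. v \<in> V \<Longrightarrow> g v \<in> nb v - B" by metis
  define X where "X = A \<union> g ` (A \<union> U)"
  have UAV: "A \<union> U \<subseteq> V" using A by (auto simp: U_def)
  have "X \<subseteq> V - B" using A g UAV nb_subset unfolding X_def by blast
  moreover have "card X \<le> 3 * m"
  proof -
    have "card X \<le> card A + card (g ` (A \<union> U))" unfolding X_def by (rule card_Un_le)
    also have "card (g ` (A \<union> U)) \<le> card (A \<union> U)" using fin by (intro card_image_le) auto
    finally show ?thesis using cUA A by linarith
  qed
  moreover have "nb v \<inter> X \<noteq> {}" if "v \<in> V" for v
  proof (cases "v \<in> A \<union> U")
    case True
    then show ?thesis using g[OF that] unfolding X_def by blast
  next
    case False
    then have "nb v \<inter> A \<noteq> {}" using that by (auto simp: U_def)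
    then show ?thesis unfolding X_def by blast
  qed
  ultimately show ?thesis by blast
qed

text \<open>A union of \<open>t\<close> disjoint dominating sets, each built with its predecessors
  added to the forbidden set.\<close>

lemma multi_dominating_set:
  assumes "finite B" "card B + 3 * m * t + m \<le> \<delta>" "V \<noteq> {}"
  shows "\<exists>X\<subseteq>V - B. card X \<le> 3 * m * t \<and> (\<forall>v\<in>V. t \<le> card (nb v \<inter> X))"
  using assms(2)
proof (induction t)
  case 0
  show ?case by (rule exI[of _ "{}"]) simp
next
  case (Suc t)
  then obtain X where X: "X \<subseteq> V - B" "card X \<le> 3 * m * t" "\<forall>v\<in>V. t \<le> card (nb v \<inter> X)"
    by (auto simp: algebra_simps)
  have finX: "finite X" using X(1) finV finite_subset by blast
  have "card (B \<union> X) \<le> card B + card X" by (rule card_Un_le)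
  then have "card (B \<union> X) + m \<le> \<delta>" using X(2) Suc.prems by (simp add: algebra_simps)
  from dominating_set[OF _ this assms(3)] obtain X' where X':
    "X' \<subseteq> V - (B \<union> X)" "card X' \<le> 3 * m" "\<forall>v\<in>V. nb v \<inter> X' \<noteq> {}"
    using assms(1) finX by auto
  have finX': "finite X'" using X'(1) finV finite_subset by blast
  have "X \<union> X' \<subseteq> V - B" using X X' by blast
  moreover have "card (X \<union> X') \<le> 3 * m * Suc t"
    using card_Un_le[of X X'] X(2) X'(2) by (simp add: algebra_simps)
  moreover have "Suc t \<le> card (nb v \<inter> (X \<union> X'))" if "v \<in> V" for v
  proof -
    have "card (nb v \<inter> (X \<union> X')) = card (nb v \<inter> X) + card (nb v \<inter> X')"
      unfolding Int_Un_distrib using X'(1) by (intro card_Un_disjoint) auto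
    moreover have "1 \<le> card (nb v \<inter> X')"
      using X'(3) that finX' by (metis One_nat_def Suc_leI card_gt_0_iff finite_Int)
    ultimately show ?thesis using X(3) that by fastforce
  qed
  ultimately show ?case by blast
qed

text \<open>A common neighbour need not exist, but \<open>m\<close> free neighbours of
  \<open>u\<close> and \<open>m\<close> other ones of \<open>v\<close> are joined by an
  edge.\<close>

lemma link:
  assumes "u \<in> V" "v \<in> V" "finite B" "card B + 2 * m \<le> \<delta>"
  shows "\<exists>c e. c \<in> V - B \<and> e \<in> V - B \<and> c \<noteq> e \<and> {u, c} \<in> E \<and> {c, e} \<in> E \<and> {e, v} \<in> E"
proof -
  obtain X where X: "X \<subseteq> nb u - B" "card X = m"
    using free_nbrs[of u B m] assms by auto
  have finX: "finite X" using X finite_nb by (meson finite_Diff finite_subset)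
  have "card (B \<union> X) + m \<le> \<delta>" using card_Un_le[of B X] X assms by linarith
  then obtain Y where Y: "Y \<subseteq> nb v - (B \<union> X)" "card Y = m"
    using free_nbrs[of v "B \<union> X" m] assms finX by auto
  have sub: "nb u \<subseteq> V" "nb v \<subseteq> V" using nb_subset by blast+
  obtain c e where ce: "c \<in> X" "e \<in> Y" "e \<in> nb c"
  proof -
    have "\<exists>x\<in>X. \<exists>y\<in>Y. y \<in> nb x"
      by (rule joined_ge) (use X Y sub in auto)
    then show ?thesis using that by blast
  qed
  then have "c \<in> nb u" "v \<in> nb e" using X Y nb_commute[of e v] by blast+
  then have "{u, c} \<in> E" "{c, e} \<in> E" "{e, v} \<in> E" using ce(3) by (simp_all add: nbrs_def)
  moreover have "c \<in> V - B" "e \<in> V - B" "c \<noteq> e" using ce X Y sub by blast+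
  ultimately show ?thesis by blast
qed

text \<open>The neighbourhood of \<open>a\<close> supplies two disjoint \<open>m\<close>-sets
  \<open>Y1\<close> and \<open>Y2\<close>. Of \<open>2 * m\<close> further vertices fewer than
  \<open>m\<close> miss \<open>Y1\<close> and fewer than \<open>m\<close> miss \<open>Y2\<close>, so
  some \<open>a'\<close> has a neighbour in each.\<close>

lemma four_cycle:
  assumes "finite B" "card B + 4 * m + 1 \<le> \<delta>" "V \<noteq> {}"
  shows "\<exists>a b a' b'. distinct [a, b, a', b'] \<and> {a, b, a', b'} \<subseteq> V - B \<and>
     {a, b} \<in> E \<and> {a, b'} \<in> E \<and> {a', b} \<in> E \<and> {a', b'} \<in> E"
proof -
  obtain v0 where v0: "v0 \<in> V" using assms(3) by blast
  have "\<exists>X\<subseteq>nb v0 - B. card X = 1" using free_nbrs[OF v0 assms(1), of 1] assms(2) by auto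
  then obtain a where a: "a \<in> V - B" using nb_subset[of v0] by (auto simp: card_1_singleton_iff)
  obtain Y where Y: "Y \<subseteq> nb a - B" "card Y = 2 * m"
    using free_nbrs[of a B "2 * m"] assms a by auto
  obtain Y1 where Y1: "Y1 \<subseteq> Y" "card Y1 = m" using obtain_subset_with_card_n[of m Y] Y(2) by auto
  define Y2 where "Y2 = Y - Y1"
  have finY: "finite Y" using Y finite_nb by (meson finite_Diff finite_subset)
  have cY2: "card Y2 = m" unfolding Y2_def using Y Y1 finY by (simp add: card_Diff_subset finite_subset)
  have sub: "nb a \<subseteq> V - {a}" by (rule nb_subset)
  define B' where "B' = insert a (B \<union> Y)"
  have "card B' \<le> Suc (card (B \<union> Y))" unfolding B'_def by (rule card_insert_le_m1) simp_all
  then have "card B' + 2 * m \<le> \<delta>" using card_Un_le[of B Y] assms(2) Y(2) by linarith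
  moreover have "finite B'" using assms(1) finY by (simp add: B'_def)
  \<comment> \<open>The neighbourhood of \<open>v0\<close> serves as a supply of vertices outside
    \<open>B'\<close>, its size being bounded below by \<open>\<delta>\<close>.\<close>
  ultimately obtain C where C: "C \<subseteq> nb v0 - B'" "card C = 2 * m" using free_nbrs[OF v0, of B' "2 * m"] by blast
  have CV: "C \<subseteq> V" using C nb_subset by blast
  have finC: "finite C" using CV finV finite_subset by blast
  have CB': "C \<inter> B' = {}" and YV: "Y \<subseteq> V" using C Y sub by blast+
  have "card {c\<in>C. nb c \<inter> Y1 = {}} < m"
    by (rule few_nonadjacent) (use CV CB' YV Y1 in \<open>auto simp: B'_def\<close>)
  moreover have "card {c\<in>C. nb c \<inter> Y2 = {}} < m"
    by (rule few_nonadjacent) (use CV CB' YV cY2 in \<open>auto simp: B'_def Y2_def\<close>)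
  ultimately have "card ({c\<in>C. nb c \<inter> Y1 = {}} \<union> {c\<in>C. nb c \<inter> Y2 = {}}) < card C"
    using card_Un_le[of "{c\<in>C. nb c \<inter> Y1 = {}}" "{c\<in>C. nb c \<inter> Y2 = {}}"] C(2) by linarith
  then have "\<not> C \<subseteq> {c\<in>C. nb c \<inter> Y1 = {}} \<union> {c\<in>C. nb c \<inter> Y2 = {}}"
    using finC card_mono[of "{c\<in>C. nb c \<inter> Y1 = {}} \<union> {c\<in>C. nb c \<inter> Y2 = {}}" C] by auto
  then obtain a' where a': "a' \<in> C" "nb a' \<inter> Y1 \<noteq> {}" "nb a' \<inter> Y2 \<noteq> {}" by blast
  then obtain b b' where "b \<in> nb a'" "b \<in> Y1" "b' \<in> nb a'" "b' \<in> Y2" by blast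
  moreover have "a' \<noteq> a" "a' \<notin> Y" "a' \<notin> B" using a'(1) CB' by (auto simp: B'_def)
  moreover have "b \<noteq> b'" "b \<in> Y" "b' \<in> Y" using calculation(2,4) Y1 by (auto simp: Y2_def)
  moreover have "b \<in> nb a" "b' \<in> nb a" "b \<notin> B" "b' \<notin> B" using calculation(9,10) Y by blast+
  ultimately have "distinct [a, b, a', b'] \<and> {a, b, a', b'} \<subseteq> V - B \<and>
     {a, b} \<in> E \<and> {a, b'} \<in> E \<and> {a', b} \<in> E \<and> {a', b'} \<in> E"
    using CV a sub a'(1) by (auto simp: nbrs_def)
  then show ?thesis by blast
qed

end

section \<open>Routing networks\<close>

text \<open>\<open>K\<close> bounds the forbidden set at the worst moment, when \<open>B\<close> and
  all earlier lists of length \<open>w\<close> have to be avoided.\<close>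

lemma greedy_disjoint:
  fixes N w K :: nat
  assumes step: "\<And>i B. i < N \<Longrightarrow> finite B \<Longrightarrow> card B \<le> K \<Longrightarrow>
      \<exists>xs. length xs = w \<and> distinct xs \<and> set xs \<subseteq> V - B \<and> P i xs"
    and B: "finite B" "card B + N * w \<le> K"
  shows "\<exists>F. \<forall>i<N. length (F i) = w \<and> distinct (F i) \<and> set (F i) \<subseteq> V - B \<and> P i (F i) \<and>
      (\<forall>j<N. i \<noteq> j \<longrightarrow> set (F i) \<inter> set (F j) = {})"
  using assms
proof (induction N)
  case 0
  show ?case by simp
next
  case (Suc N)
  have "\<exists>F. \<forall>i<N. length (F i) = w \<and> distinct (F i) \<and> set (F i) \<subseteq> V - B \<and> P i (F i) \<and>
      (\<forall>j<N. i \<noteq> j \<longrightarrow> set (F i) \<inter> set (F j) = {})"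
    by (rule Suc.IH) (use Suc.prems in auto)
  then obtain F where F: "\<And>i. i < N \<Longrightarrow> length (F i) = w \<and> distinct (F i) \<and> set (F i) \<subseteq> V - B \<and> P i (F i) \<and>
      (\<forall>j<N. i \<noteq> j \<longrightarrow> set (F i) \<inter> set (F j) = {})" by blast
  define C where "C = B \<union> (\<Union>i<N. set (F i))"
  have "card (\<Union>i<N. set (F i)) \<le> (\<Sum>i<N. card (set (F i)))" by (rule card_UN_le) simp
  also have "\<dots> \<le> (\<Sum>i<N. w)" using F by (intro sum_mono) (metis card_length lessThan_iff)
  finally have "card C \<le> K"
    using card_Un_le[of B "\<Union>i<N. set (F i)"] Suc.prems(3) by (simp add: C_def)
  moreover have "finite C" using Suc.prems(2) by (simp add: C_def)
  ultimately obtain xs where xs: "length xs = w" "distinct xs" "set xs \<subseteq> V - C" "P N xs"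
    using Suc.prems(1)[of N C] by auto
  have dj: "set xs \<inter> set (F i) = {}" if "i < N" for i using xs(3) that by (auto simp: C_def)
  have xsB: "set xs \<subseteq> V - B" using xs(3) by (auto simp: C_def)
  show ?case
  proof (rule exI[of _ "F(N := xs)"], intro allI impI)
    fix i assume i: "i < Suc N"
    show "length ((F(N := xs)) i) = w \<and> distinct ((F(N := xs)) i) \<and> set ((F(N := xs)) i) \<subseteq> V - B \<and>
       P i ((F(N := xs)) i) \<and> (\<forall>j<Suc N. i \<noteq> j \<longrightarrow> set ((F(N := xs)) i) \<inter> set ((F(N := xs)) j) = {})"
    proof (cases "i = N")
      case True
      then show ?thesis using xs xsB dj by (auto simp: less_Suc_eq)
    next
      case False
      then have iN: "i < N" using i by simp
      show ?thesis using F[OF iN] dj[OF iN] False by (auto simp: less_Suc_eq)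
    qed
  qed
qed

context joined_graph
begin

definition walk :: "'v list \<Rightarrow> bool" where
  "walk = successively (\<lambda>u v. {u, v} \<in> E)"

text \<open>A four-cycle on \<open>a b a' b'\<close> (entries 2, 3, 6, 7) with three-edge links from \<open>u\<close> to \<open>a\<close>
  and from \<open>u'\<close> to \<open>a'\<close>: arriving at \<open>a\<close> and \<open>a'\<close>, one may leave by \<open>b\<close> and \<open>b'\<close> in either order.\<close>

definition switch :: "'v \<Rightarrow> 'v \<Rightarrow> 'v list \<Rightarrow> bool" where
  "switch u u' xs \<longleftrightarrow>
     {u, xs!0} \<in> E \<and> {xs!0, xs!1} \<in> E \<and> {xs!1, xs!2} \<in> E \<and>
     {u', xs!4} \<in> E \<and> {xs!4, xs!5} \<in> E \<and> {xs!5, xs!6} \<in> E \<and>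
     {xs!2, xs!3} \<in> E \<and> {xs!2, xs!7} \<in> E \<and> {xs!6, xs!3} \<in> E \<and> {xs!6, xs!7} \<in> E"

lemma switch_exists:
  assumes "u \<in> V" "u' \<in> V" "finite B" "card B + 4 * m + 6 \<le> \<delta>"
  shows "\<exists>xs. length xs = 8 \<and> distinct xs \<and> set xs \<subseteq> V - B \<and> switch u u' xs"
proof -
  obtain a b a' b' where ab: "distinct [a, b, a', b']" "{a, b, a', b'} \<subseteq> V - B"
    "{a, b} \<in> E" "{a, b'} \<in> E" "{a', b} \<in> E" "{a', b'} \<in> E"
    using four_cycle[of B] assms by auto
  define B1 where "B1 = B \<union> {a, b, a', b'}"
  have "card {a, b, a', b'} \<le> 4" using card_length[of "[a, b, a', b']"] by simp
  then have cB1: "card B1 \<le> card B + 4"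
    unfolding B1_def using card_Un_le[of B "{a, b, a', b'}"] by linarith
  have fB1: "finite B1" using assms(3) by (simp add: B1_def)
  obtain c e where ce: "c \<in> V - B1" "e \<in> V - B1" "c \<noteq> e" "{u, c} \<in> E" "{c, e} \<in> E" "{e, a} \<in> E"
    using link[of u a B1] assms ab(2) cB1 fB1 by auto
  define B2 where "B2 = B1 \<union> {c, e}"
  have cB2: "card B2 \<le> card B + 6"
    unfolding B2_def using card_Un_le[of B1 "{c, e}"] card_length[of "[c, e]"] cB1 by simp
  have fB2: "finite B2" using fB1 by (simp add: B2_def)
  obtain c' e' where ce': "c' \<in> V - B2" "e' \<in> V - B2" "c' \<noteq> e'" "{u', c'} \<in> E" "{c', e'} \<in> E" "{e', a'} \<in> E"
    using link[of u' a' B2] assms ab(2) cB2 fB2 by auto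
  let ?xs = "[c, e, a, b, c', e', a', b']"
  have "distinct ?xs" "set ?xs \<subseteq> V - B"
    using ab(1,2) ce(1-3) ce'(1-3) by (auto simp: B1_def B2_def)
  moreover have "switch u u' ?xs" using ab ce ce' by (simp add: switch_def eval_nat_numeral)
  ultimately show ?thesis by (intro exI[of _ ?xs]) simp
qed

text \<open>The covered set \<open>A\<close> and the length \<open>l\<close> do not depend on the
  permutation; this makes the network usable inside a spanning embedding. Disjointness of the paths
  is left to counting: \<open>A\<close> will have \<open>N * l\<close> elements, so \<open>N\<close>
  lists of length \<open>l\<close> can cover it only without repetition.\<close>

definition routes :: "(nat \<Rightarrow> 'v) \<Rightarrow> (nat \<Rightarrow> 'v) \<Rightarrow> nat \<Rightarrow> nat \<Rightarrow> 'v set \<Rightarrow> bool" where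
  "routes s t N l A \<longleftrightarrow> (\<forall>\<pi>. bij_betw \<pi> {..<N} {..<N} \<longrightarrow>
     (\<exists>p. (\<forall>i<N. length (p i) = l \<and> walk (p i) \<and> hd (p i) = s i \<and> last (p i) = t (\<pi> i)) \<and>
          (\<Union>i<N. set (p i)) = A))"

text \<open>Wire \<open>k\<close> enters switch \<open>k mod N\<close>, leaves it at entry 3 for the
  first subnetwork if \<open>k \<in> U\<close> and at entry 7 for the second one otherwise, and
  finally passes a last-stage switch \<open>F (N + i)\<close> in reverse. Entries 3 and 7 are
  terminals of the subnetworks, hence contained in \<open>A1\<close> and \<open>A2\<close>. Each
  path gains 8 vertices: a terminal and three switch entries at either end.\<close>

lemma routes_step:
  fixes N l :: nat
  assumes N: "0 < N" and l: "0 < l"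
    and F: "\<And>i. i < N \<Longrightarrow> switch (s i) (s (i + N)) (F i)"
      "\<And>i. i < N \<Longrightarrow> switch (t i) (t (i + N)) (F (N + i))"
    and r1: "routes (\<lambda>i. F i ! 3) (\<lambda>i. F (N + i) ! 3) N l A1"
    and r2: "routes (\<lambda>i. F i ! 7) (\<lambda>i. F (N + i) ! 7) N l A2"
  shows "routes s t (2 * N) (l + 8)
     (s ` {..<2*N} \<union> t ` {..<2*N} \<union>
      (\<Union>i<2*N. {F i ! 0, F i ! 1, F i ! 2, F i ! 4, F i ! 5, F i ! 6}) \<union> A1 \<union> A2)"
  unfolding routes_def
proof (intro allI impI)
  fix \<pi> assume pi: "bij_betw \<pi> {..<2*N} {..<2*N}"
  obtain U where U: "U \<subseteq> {..<2*N}" "bij_betw (\<lambda>k. k mod N) U {..<N}" "bij_betw (\<lambda>k. \<pi> k mod N) U {..<N}"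
    "bij_betw (\<lambda>k. k mod N) ({..<2*N} - U) {..<N}" "bij_betw (\<lambda>k. \<pi> k mod N) ({..<2*N} - U) {..<N}"
    using benes_split[OF N pi] by blast
  define W where "W = {..<2*N} - U"
  \<comment> \<open>On a set \<open>X\<close> of wires that meets every switch once, at the inputs
    and at the outputs, \<open>\<pi>\<close> induces a permutation \<open>\<pi>1\<close> of the
    \<open>N\<close> wires of a subnetwork.\<close>
  have route: "\<exists>p. (\<forall>k\<in>X. length (p (k mod N)) = l \<and> walk (p (k mod N)) \<and> hd (p (k mod N)) = s' (k mod N)
       \<and> last (p (k mod N)) = t' (\<pi> k mod N)) \<and> (\<Union>k\<in>X. set (p (k mod N))) = A"
    if X: "bij_betw (\<lambda>k. k mod N) X {..<N}" "bij_betw (\<lambda>k. \<pi> k mod N) X {..<N}" and r: "routes s' t' N l A"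
    for X s' t' A
  proof -
    define \<pi>1 where "\<pi>1 = (\<lambda>k. \<pi> k mod N) \<circ> the_inv_into X (\<lambda>k. k mod N)"
    have "bij_betw \<pi>1 {..<N} {..<N}"
      unfolding \<pi>1_def by (rule bij_betw_trans[OF bij_betw_the_inv_into[OF X(1)] X(2)])
    then obtain p where p: "\<forall>i<N. length (p i) = l \<and> walk (p i) \<and> hd (p i) = s' i \<and> last (p i) = t' (\<pi>1 i)"
      "(\<Union>i<N. set (p i)) = A" using r unfolding routes_def by blast
    have "\<pi>1 (k mod N) = \<pi> k mod N" if "k \<in> X" for k
      using that by (simp add: \<pi>1_def the_inv_into_f_f[OF bij_betw_imp_inj_on[OF X(1)]])
    moreover have "(\<Union>k\<in>X. set (p (k mod N))) = (\<Union>i\<in>(\<lambda>k. k mod N) ` X. set (p i))" by simp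
    then have "(\<Union>k\<in>X. set (p (k mod N))) = A" using X(1) p(2) by (simp only: bij_betw_def)
    ultimately show ?thesis using p(1) N by (intro exI[of _ p]) auto
  qed
  obtain p1 where p1: "\<And>k. k \<in> U \<Longrightarrow> length (p1 (k mod N)) = l \<and> walk (p1 (k mod N)) \<and>
      hd (p1 (k mod N)) = F (k mod N) ! 3 \<and> last (p1 (k mod N)) = F (N + \<pi> k mod N) ! 3"
      "(\<Union>k\<in>U. set (p1 (k mod N))) = A1"
    using route[OF U(2,3) r1] by blast
  obtain p2 where p2: "\<And>k. k \<in> W \<Longrightarrow> length (p2 (k mod N)) = l \<and> walk (p2 (k mod N)) \<and>
      hd (p2 (k mod N)) = F (k mod N) ! 7 \<and> last (p2 (k mod N)) = F (N + \<pi> k mod N) ! 7"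
      "(\<Union>k\<in>W. set (p2 (k mod N))) = A2"
    using route[OF U(4,5) r2] unfolding W_def by blast
  define mid where "mid k = (if k \<in> U then p1 (k mod N) else p2 (k mod N))" for k
  \<comment> \<open>A wire \<open>k \<ge> N\<close> is the second one of its switch and uses the
    entries 4, 5, 6 in place of 0, 1, 2.\<close>
  define ix where "ix k x = 4 * (k div N) + x" for k x :: nat
  define pre where "pre k = [s k, F (k mod N) ! ix k 0, F (k mod N) ! ix k 1, F (k mod N) ! ix k 2]" for k
  define post where "post k = [F (N + k mod N) ! ix k 2, F (N + k mod N) ! ix k 1, F (N + k mod N) ! ix k 0, t k]" for k
  define p where "p k = pre k @ mid k @ post (\<pi> k)" for k
  have dm: "k < N \<and> k div N = 0 \<and> k mod N = k \<or> N \<le> k \<and> k div N = 1 \<and> k mod N + N = k \<and> k mod N < N"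
    if "k < 2 * N" for k
  proof (cases "k < N")
    case False
    then have "k div N = 1" using that N by (intro div_nat_eqI) auto
    then show ?thesis using False div_mult_mod_eq[of k N] N by auto
  qed simp
  have pre: "walk (pre k) \<and> {last (pre k), F (k mod N) ! 3} \<in> E \<and> {last (pre k), F (k mod N) ! 7} \<in> E"
    if k: "k < 2 * N" for k
  proof -
    have sw: "switch (s (k mod N)) (s (k mod N + N)) (F (k mod N))" using F(1) N by simp
    consider "k div N = 0" "k mod N = k" | "k div N = 1" "k mod N + N = k" using dm[OF k] by meson
    then show ?thesis
    proof cases
      case 1
      then show ?thesis using sw by (simp add: pre_def ix_def switch_def walk_def eval_nat_numeral)
    next
      case 2
      then show ?thesis using sw by (simp add: pre_def ix_def switch_def walk_def eval_nat_numeral)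
    qed
  qed
  have post: "walk (post k) \<and> {F (N + k mod N) ! 3, hd (post k)} \<in> E \<and> {F (N + k mod N) ! 7, hd (post k)} \<in> E"
    if k: "k < 2 * N" for k
  proof -
    have sw: "switch (t (k mod N)) (t (k mod N + N)) (F (N + k mod N))" using F(2) N by simp
    consider "k div N = 0" "k mod N = k" | "k div N = 1" "k mod N + N = k" using dm[OF k] by meson
    then show ?thesis
    proof cases
      case 1
      then show ?thesis using sw by (simp add: post_def ix_def switch_def walk_def insert_commute eval_nat_numeral)
    next
      case 2
      then show ?thesis using sw by (simp add: post_def ix_def switch_def walk_def insert_commute eval_nat_numeral)
    qed
  qed
  have pik: "\<pi> k < 2 * N" if "k < 2 * N" for k using pi that by (auto simp: bij_betw_def)
  have mid: "length (mid k) = l \<and> walk (mid k) \<and>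
     (hd (mid k) = F (k mod N) ! 3 \<and> last (mid k) = F (N + \<pi> k mod N) ! 3 \<or>
      hd (mid k) = F (k mod N) ! 7 \<and> last (mid k) = F (N + \<pi> k mod N) ! 7)"
    if "k < 2 * N" for k
    using p1(1)[of k] p2(1)[of k] that by (auto simp: mid_def W_def)
  have main: "length (p k) = l + 8 \<and> walk (p k) \<and> hd (p k) = s k \<and> last (p k) = t (\<pi> k)"
    if k: "k < 2 * N" for k
  proof -
    have ne: "mid k \<noteq> []" using mid[OF k] l by auto
    have "pre k \<noteq> []" "post (\<pi> k) \<noteq> []" by (simp_all add: pre_def post_def)
    then have "walk (p k)"
      using pre[OF k] post[OF pik[OF k]] mid[OF k] ne
      unfolding walk_def p_def successively_append_iff by auto
    then show ?thesis using mid[OF k] by (simp add: p_def pre_def post_def)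
  qed
  have "(\<Union>k<2*N. set (mid k)) = (\<Union>k\<in>U. set (mid k)) \<union> (\<Union>k\<in>W. set (mid k))"
    using U(1) by (auto simp: W_def)
  also have "(\<Union>k\<in>U. set (mid k)) = A1" using p1(2) by (simp add: mid_def)
  also have "(\<Union>k\<in>W. set (mid k)) = A2"
    unfolding p2(2)[symmetric] by (intro SUP_cong) (auto simp: mid_def W_def)
  finally have Umid: "(\<Union>k<2*N. set (mid k)) = A1 \<union> A2" .
  \<comment> \<open>Both wires of each switch run through it, so its entries other than 3 and 7 are
    all covered, whatever \<open>\<pi>\<close> is.\<close>
  have cov: "(\<Union>k<2*N. {G (k mod N) ! ix k 0, G (k mod N) ! ix k 1, G (k mod N) ! ix k 2}) =
      (\<Union>i<N. {G i ! 0, G i ! 1, G i ! 2, G i ! 4, G i ! 5, G i ! 6})" (is "?L = ?R") for G :: "nat \<Rightarrow> 'v list"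
  proof
    show "?L \<subseteq> ?R"
    proof (rule UN_least)
      fix k assume "k \<in> {..<2*N}"
      then have "k div N = 0 \<or> k div N = 1" "k mod N < N" using dm[of k] N by auto
      then show "{G (k mod N) ! ix k 0, G (k mod N) ! ix k 1, G (k mod N) ! ix k 2} \<subseteq> ?R"
        by (intro subset_trans[OF _ UN_upper[of "k mod N"]]) (auto simp: ix_def eval_nat_numeral)
    qed
    show "?R \<subseteq> ?L"
    proof (rule UN_least)
      fix i assume i: "i \<in> {..<N}"
      have "{G (i mod N) ! ix i 0, G (i mod N) ! ix i 1, G (i mod N) ! ix i 2} \<subseteq> ?L"
        using i by (intro UN_upper) auto
      moreover have "{G ((i + N) mod N) ! ix (i + N) 0, G ((i + N) mod N) ! ix (i + N) 1, G ((i + N) mod N) ! ix (i + N) 2} \<subseteq> ?L"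
        using i by (intro UN_upper) auto
      ultimately show "{G i ! 0, G i ! 1, G i ! 2, G i ! 4, G i ! 5, G i ! 6} \<subseteq> ?L"
        using i by (simp add: ix_def eval_nat_numeral)
    qed
  qed
  have "(\<Union>k<2*N. set (pre k)) = s ` {..<2*N} \<union> (\<Union>k<2*N. {F (k mod N) ! ix k 0, F (k mod N) ! ix k 1, F (k mod N) ! ix k 2})"
    by (auto simp: pre_def)
  also note cov[of F]
  finally have Upre: "(\<Union>k<2*N. set (pre k)) = s ` {..<2*N} \<union> (\<Union>i<N. {F i ! 0, F i ! 1, F i ! 2, F i ! 4, F i ! 5, F i ! 6})" .
  have "(\<Union>k<2*N. set (post (\<pi> k))) = (\<Union>k\<in>\<pi> ` {..<2*N}. set (post k))" by simp
  also have "\<pi> ` {..<2*N} = {..<2*N}" using pi by (simp add: bij_betw_def)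
  also have "(\<Union>k<2*N. set (post k)) = t ` {..<2*N} \<union> (\<Union>k<2*N. {F (N + k mod N) ! ix k 0, F (N + k mod N) ! ix k 1, F (N + k mod N) ! ix k 2})"
    by (auto simp: post_def)
  also note cov[of "\<lambda>i. F (N + i)"]
  finally have Upost: "(\<Union>k<2*N. set (post (\<pi> k))) = t ` {..<2*N} \<union>
     (\<Union>i<N. {F (N + i) ! 0, F (N + i) ! 1, F (N + i) ! 2, F (N + i) ! 4, F (N + i) ! 5, F (N + i) ! 6})" .
  have split: "(\<Union>i<2*N. H i) = (\<Union>i<N. H i) \<union> (\<Union>i<N. H (N + i))" for H :: "nat \<Rightarrow> 'v set"
  proof -
    have "{..<2*N} = {..<N} \<union> (\<lambda>i. N + i) ` {..<N}"
    proof (rule set_eqI)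
      fix x show "x \<in> {..<2*N} \<longleftrightarrow> x \<in> {..<N} \<union> (\<lambda>i. N + i) ` {..<N}"
        by (cases "x < N") (auto simp: image_iff intro!: bexI[of _ "x - N"])
    qed
    then show ?thesis by (simp add: UN_Un)
  qed
  have "(\<Union>k<2*N. set (p k)) = (\<Union>k<2*N. set (pre k)) \<union> (\<Union>k<2*N. set (mid k)) \<union> (\<Union>k<2*N. set (post (\<pi> k)))"
    by (auto simp: p_def)
  also have "\<dots> = s ` {..<2*N} \<union> t ` {..<2*N} \<union>
      (\<Union>i<2*N. {F i ! 0, F i ! 1, F i ! 2, F i ! 4, F i ! 5, F i ! 6}) \<union> A1 \<union> A2"
    unfolding Upre Upost Umid split by (simp only: Un_ac)
  finally show "\<exists>p. (\<forall>i<2*N. length (p i) = l + 8 \<and> walk (p i) \<and> hd (p i) = s i \<and> last (p i) = t (\<pi> i)) \<and>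
        (\<Union>i<2*N. set (p i)) = s ` {..<2*N} \<union> t ` {..<2*N} \<union>
      (\<Union>i<2*N. {F i ! 0, F i ! 1, F i ! 2, F i ! 4, F i ! 5, F i ! 6}) \<union> A1 \<union> A2"
    using main by blast
qed

text \<open>The recursion of the Benes network: \<open>2 ^ Suc q\<close> wires pass through switches, two networks on
  \<open>2 ^ q\<close> wires, and switches again.\<close>

lemma routing_network:
  assumes "inj_on s {..<2^q}" "inj_on t {..<2^q}" "s ` {..<2^q} \<subseteq> V" "t ` {..<2^q} \<subseteq> V"
    and "s ` {..<2^q} \<inter> t ` {..<2^q} = {}" "B \<inter> (s ` {..<2^q} \<union> t ` {..<2^q}) = {}"
    and "finite B" "card B + 2^q * (4 + 8 * q) + 4 * m + 6 \<le> \<delta>"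
  shows "\<exists>A\<subseteq>V - B. card A = 2^q * (4 + 8 * q) \<and> routes s t (2^q) (4 + 8 * q) A"
  using assms
proof (induction q arbitrary: s t B)
  case 0
  have st: "s 0 \<in> V" "t 0 \<in> V" "s 0 \<noteq> t 0" "s 0 \<notin> B" "t 0 \<notin> B" "finite B"
    using 0 by (auto simp: lessThan_Suc)
  \<comment> \<open>For one wire a single link suffices; its four vertices are the 4 in
    \<open>4 + 8 * q\<close>.\<close>
  define C where "C = B \<union> {s 0, t 0}"
  have "card C \<le> card B + 2" unfolding C_def using card_Un_le[of B "{s 0, t 0}"] card_length[of "[s 0, t 0]"] by simp
  then have "card C + 2 * m \<le> \<delta>" using 0 by simp
  then obtain c e where ce: "c \<in> V - C" "e \<in> V - C" "c \<noteq> e" "{s 0, c} \<in> E" "{c, e} \<in> E" "{e, t 0} \<in> E"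
    using link[of "s 0" "t 0" C] st by (auto simp: C_def)
  let ?p = "[s 0, c, e, t 0]"
  have d: "distinct ?p" using st ce by (auto simp: C_def)
  have "set ?p \<subseteq> V - B" using st ce by (auto simp: C_def)
  moreover have "card (set ?p) = 4" using distinct_card[OF d] by simp
  moreover have "routes s t 1 4 (set ?p)"
    unfolding routes_def
  proof (intro allI impI)
    fix \<pi> :: "nat \<Rightarrow> nat" assume "bij_betw \<pi> {..<1} {..<1}"
    then have "\<pi> 0 = 0" by (auto simp: bij_betw_def)
    then show "\<exists>p. (\<forall>i<1. length (p i) = 4 \<and> walk (p i) \<and> hd (p i) = s i \<and> last (p i) = t (\<pi> i)) \<and>
        (\<Union>i<1. set (p i)) = set ?p"
      using ce by (intro exI[of _ "\<lambda>_. ?p"]) (simp add: walk_def lessThan_Suc)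
  qed
  ultimately show ?case by (intro exI[of _ "set ?p"]) simp
next
  case (Suc q)
  define N :: nat where "N = 2^q"
  define l where "l = 4 + 8 * q"
  have N: "0 < N" "2 ^ Suc q = 2 * N" by (simp_all add: N_def)
  note asm = Suc.prems[unfolded N(2)]
  have cards: "card B + 2 * N * (l + 8) + 4 * m + 6 \<le> \<delta>" using asm(8) by (simp add: l_def algebra_simps)
  define S where "S = s ` {..<2*N}"
  define T where "T = t ` {..<2*N}"
  have cST: "card S = 2 * N" "card T = 2 * N" using asm(1,2) by (simp_all add: S_def T_def card_image)
  have fST: "finite S" "finite T" by (simp_all add: S_def T_def)
  define B0 where "B0 = B \<union> S \<union> T"
  have cB0: "card B0 \<le> card B + 4 * N"
    using card_Un_le[of "B \<union> S" T] card_Un_le[of B S] cST by (simp add: B0_def)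
  have fB0: "finite B0" using asm(7) fST by (simp add: B0_def)
  \<comment> \<open>Index \<open>i < N\<close> stands for the input switch of \<open>s i\<close> and
    \<open>s (i + N)\<close>, index \<open>N + i\<close> for the output switch of \<open>t i\<close>
    and \<open>t (i + N)\<close>.\<close>
  define u where "u i = (if i < N then s i else t (i - N))" for i
  define u' where "u' i = (if i < N then s (i + N) else t i)" for i
  have uV: "u i \<in> V" "u' i \<in> V" if "i < 2 * N" for i
    using asm(3,4) that by (auto simp: u_def u'_def)
  have "\<exists>F. \<forall>i<2*N. length (F i) = 8 \<and> distinct (F i) \<and> set (F i) \<subseteq> V - B0 \<and> switch (u i) (u' i) (F i) \<and>
      (\<forall>j<2*N. i \<noteq> j \<longrightarrow> set (F i) \<inter> set (F j) = {})"
  \<comment> \<open>\<open>B0\<close> has at most \<open>card B + 4 * N\<close> elements, and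
    \<open>2 * N\<close> switches of 8 vertices take \<open>16 * N\<close>.\<close>
  proof (rule greedy_disjoint[where K = "card B + 20 * N"])
    fix i and C :: "'v set"
    assume iC: "i < 2 * N" "finite C" "card C \<le> card B + 20 * N"
    have "20 * N \<le> 2 * N * (l + 8)" by (simp add: l_def)
    then have "card C + 4 * m + 6 \<le> \<delta>" using cards iC(3) by linarith
    then show "\<exists>xs. length xs = 8 \<and> distinct xs \<and> set xs \<subseteq> V - C \<and> switch (u i) (u' i) xs"
      using uV iC by (intro switch_exists) auto
  qed (use fB0 cB0 in auto)
  then obtain F where F: "\<And>i. i < 2 * N \<Longrightarrow> length (F i) = 8" "\<And>i. i < 2 * N \<Longrightarrow> distinct (F i)"
    "\<And>i. i < 2 * N \<Longrightarrow> set (F i) \<subseteq> V - B0" "\<And>i. i < 2 * N \<Longrightarrow> switch (u i) (u' i) (F i)"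
    "\<And>i j. i < 2 * N \<Longrightarrow> j < 2 * N \<Longrightarrow> i \<noteq> j \<Longrightarrow> set (F i) \<inter> set (F j) = {}" by blast
  define H where "H i = [F i ! 0, F i ! 1, F i ! 2, F i ! 4, F i ! 5, F i ! 6]" for i
  define G where "G = (\<Union>i<2*N. set (H i))"
  have memF: "F i ! x \<in> set (F i)" if "i < 2 * N" "x < 8" for i x using F(1) that by simp
  have HF: "set (H i) \<subseteq> set (F i)" if "i < 2 * N" for i using that by (simp add: H_def memF)
  have Finj: "F i ! x = F j ! y \<longleftrightarrow> i = j \<and> x = y" if "i < 2 * N" "j < 2 * N" "x < 8" "y < 8" for i j x y
    using F(1,2,5) that memF[of i x] memF[of j y] by (metis IntI empty_iff nth_eq_iff_index_eq)
  have cH: "card (set (H i)) = 6" if i: "i < 2 * N" for i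
  proof -
    have "distinct (H i)" by (simp add: H_def Finj[OF i i])
    then show ?thesis by (simp add: distinct_card) (simp add: H_def)
  qed
  have "card G = (\<Sum>i<2*N. card (set (H i)))"
    unfolding G_def
  proof (rule card_UN_disjoint)
    show "\<forall>i\<in>{..<2*N}. \<forall>j\<in>{..<2*N}. i \<noteq> j \<longrightarrow> set (H i) \<inter> set (H j) = {}"
    proof (intro ballI impI)
      fix i j assume "i \<in> {..<2*N}" "j \<in> {..<2*N}" "i \<noteq> j"
      then show "set (H i) \<inter> set (H j) = {}" using HF[of i] HF[of j] F(5)[of i j] by auto
    qed
  qed simp_all
  then have cG: "card G = 12 * N" using cH by simp
  have fG: "finite G" by (simp add: G_def)
  define b where "b x i = F i ! x" for x i
  define o' where "o' x i = F (N + i) ! x" for x i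
  have beq: "b x i = b y j \<longleftrightarrow> i = j \<and> x = y" "o' x i = o' y j \<longleftrightarrow> i = j \<and> x = y" "b x i \<noteq> o' y j"
    if "i < N" "j < N" "x < 8" "y < 8" for i j x y
    using Finj[of i j x y] Finj[of "N + i" "N + j" x y] Finj[of i "N + j" x y] that by (simp_all add: b_def o'_def)
  have bo_inj: "inj_on (b x) {..<N}" "inj_on (o' x) {..<N}" if "x < 8" for x
    using beq that by (simp_all add: inj_on_def)
  have bo_img: "b x ` {..<N} \<subseteq> V - B0" "o' x ` {..<N} \<subseteq> V - B0" if x: "x < 8" for x
  proof -
    have "b x i \<in> V - B0" "o' x i \<in> V - B0" if "i < N" for i
      using F(3)[of i] F(3)[of "N + i"] memF[of i x] memF[of "N + i" x] x that by (auto simp: b_def o'_def)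
    then show "b x ` {..<N} \<subseteq> V - B0" "o' x ` {..<N} \<subseteq> V - B0" by blast+
  qed
  have bo_disj: "b x ` {..<N} \<inter> o' y ` {..<N} = {}" if "x < 8" "y < 8" for x y
    using beq(3) that by (fastforce simp: disjoint_iff)
  have bb_disj: "b x ` {..<N} \<inter> b y ` {..<N} = {}" "o' x ` {..<N} \<inter> o' y ` {..<N} = {}" if "x < 8" "y < 8" "x \<noteq> y" for x y
    using beq(1,2) that by (fastforce simp: disjoint_iff)+
  have notG: "F i ! x \<notin> G" if x: "x = 3 \<or> x = 7" and i: "i < 2 * N" for i x
  proof
    assume "F i ! x \<in> G"
    then obtain j where j: "j < 2 * N" "F i ! x \<in> set (H j)" by (auto simp: G_def)
    then have "\<exists>y\<in>{0, 1, 2, 4, 5, 6}. F i ! x = F j ! y" by (simp add: H_def)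
    then obtain y where y: "y \<in> {0, 1, 2, 4, 5, 6}" "F i ! x = F j ! y" by blast
    then have "y < 8" "x < 8" "x \<noteq> y" using x by auto
    then show False using Finj[OF i j(1), of x y] y(2) by simp
  qed
  have G_disj: "b x ` {..<N} \<inter> G = {}" "o' x ` {..<N} \<inter> G = {}" if "x = 3 \<or> x = 7" for x
    using notG[OF that] by (auto simp: b_def o'_def)
  \<comment> \<open>The terminals of the second subnetwork must stay free while the first one is
    built, which may take any vertices outside \<open>B1\<close>.\<close>
  define X7 where "X7 = b 7 ` {..<N} \<union> o' 7 ` {..<N}"
  define B1 where "B1 = B0 \<union> G \<union> X7"
  have cX7: "card X7 \<le> 2 * N"
    using card_Un_le[of "b 7 ` {..<N}" "o' 7 ` {..<N}"] card_image_le[of "{..<N}" "b 7"] card_image_le[of "{..<N}" "o' 7"]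
    by (simp add: X7_def)
  have cB1: "card B1 \<le> card B + 18 * N"
    using card_Un_le[of "B0 \<union> G" X7] card_Un_le[of B0 G] cB0 cG cX7 by (simp add: B1_def)
  have "\<exists>A\<subseteq>V - B1. card A = N * l \<and> routes (b 3) (o' 3) N l A"
    unfolding N_def l_def
  proof (rule Suc.IH; (fold N_def l_def)?)
    show "B1 \<inter> (b 3 ` {..<N} \<union> o' 3 ` {..<N}) = {}"
      using bo_img[of 3] G_disj[of 3] bo_disj[of 3 7] bo_disj[of 7 3] bb_disj[of 3 7] unfolding B1_def X7_def by auto
    show "finite B1" using fB0 fG by (simp add: B1_def X7_def)
    show "card B1 + N * l + 4 * m + 6 \<le> \<delta>" using cB1 cards by (simp add: algebra_simps l_def)
  qed (use bo_inj[of 3] bo_img[of 3] bo_disj[of 3 3] in auto)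
  then obtain A1 where A1: "A1 \<subseteq> V - B1" "card A1 = N * l" "routes (b 3) (o' 3) N l A1" by blast
  define B2 where "B2 = B0 \<union> G \<union> A1"
  have cB2: "card B2 \<le> card B + 16 * N + N * l"
    using card_Un_le[of "B0 \<union> G" A1] card_Un_le[of B0 G] cB0 cG A1(2) by (simp add: B2_def)
  have fA1: "finite A1" using A1(1) finV finite_subset by blast
  have "\<exists>A\<subseteq>V - B2. card A = N * l \<and> routes (b 7) (o' 7) N l A"
    unfolding N_def l_def
  proof (rule Suc.IH; (fold N_def l_def)?)
    show "B2 \<inter> (b 7 ` {..<N} \<union> o' 7 ` {..<N}) = {}"
      using bo_img[of 7] G_disj[of 7] A1(1) unfolding B1_def X7_def B2_def by auto
    show "finite B2" using fB0 fG fA1 by (simp add: B2_def)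
    show "card B2 + N * l + 4 * m + 6 \<le> \<delta>" using cB2 cards by (simp add: algebra_simps)
  qed (use bo_inj[of 7] bo_img[of 7] bo_disj[of 7 7] in auto)
  then obtain A2 where A2: "A2 \<subseteq> V - B2" "card A2 = N * l" "routes (b 7) (o' 7) N l A2" by blast
  have fA2: "finite A2" using A2(1) finV finite_subset by blast
  define A where "A = S \<union> T \<union> G \<union> A1 \<union> A2"
  have GV: "G \<subseteq> V - B0" using HF F(3) unfolding G_def by blast
  have ST: "S \<subseteq> V - B" "T \<subseteq> V - B" "S \<inter> T = {}" using asm(3-6) unfolding S_def T_def by blast+
  have AB: "G \<inter> B0 = {}" "A1 \<inter> B0 = {}" "A1 \<inter> G = {}" "A2 \<inter> B0 = {}" "A2 \<inter> G = {}" "A2 \<inter> A1 = {}"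
    using GV A1(1) A2(1) unfolding B1_def B2_def by blast+
  have inV: "G \<subseteq> V - B" "A1 \<subseteq> V - B" "A2 \<subseteq> V - B"
    using GV A1(1) A2(1) unfolding B1_def B2_def B0_def by blast+
  have AV: "A \<subseteq> V - B" unfolding A_def using ST(1,2) inV by (simp only: Un_subset_iff simp_thms)
  have "card A = card S + card T + card G + card A1 + card A2"
  proof -
    have "S \<subseteq> B0" "T \<subseteq> B0" by (auto simp: B0_def)
    then have "S \<inter> T = {}" "(S \<union> T) \<inter> G = {}" "(S \<union> T \<union> G) \<inter> A1 = {}" "(S \<union> T \<union> G \<union> A1) \<inter> A2 = {}"
      using ST(3) AB by blast+
    then show ?thesis unfolding A_def using fST fG fA1 fA2 by (simp add: card_Un_disjoint)
  qed
  then have cA: "card A = 2 * N * (l + 8)" using cST cG A1(2) A2(2) by (simp add: algebra_simps)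
  have "routes s t (2 * N) (l + 8) (s ` {..<2*N} \<union> t ` {..<2*N} \<union>
      (\<Union>i<2*N. {F i ! 0, F i ! 1, F i ! 2, F i ! 4, F i ! 5, F i ! 6}) \<union> A1 \<union> A2)"
  proof (rule routes_step)
    show "switch (s i) (s (i + N)) (F i)" if "i < N" for i using F(4)[of i] that by (simp add: u_def u'_def)
    show "switch (t i) (t (i + N)) (F (N + i))" if "i < N" for i
      using F(4)[of "N + i"] that by (simp add: u_def u'_def add.commute)
    show "routes (\<lambda>i. F i ! 3) (\<lambda>i. F (N + i) ! 3) N l A1" using A1(3) unfolding b_def o'_def .
    show "routes (\<lambda>i. F i ! 7) (\<lambda>i. F (N + i) ! 7) N l A2" using A2(3) unfolding b_def o'_def .
    show "0 < l" by (simp add: l_def)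
  qed (rule N(1))
  then have "routes s t (2 * N) (l + 8) A" by (simp only: A_def S_def T_def G_def H_def list.set)
  moreover have l': "4 + 8 * Suc q = l + 8" by (simp add: l_def)
  ultimately show ?case unfolding N(2) l' using AV cA by blast
qed

end

section \<open>Matchings and greedy embeddings\<close>

lemma bounded_fibres_card:
  assumes "finite A" "\<And>x. card {l\<in>A. g l = x} \<le> D"
  shows "card A \<le> D * card (g ` A)"
proof -
  have "A = (\<Union>x\<in>g ` A. {l\<in>A. g l = x})" by auto
  then have "card A \<le> (\<Sum>x\<in>g ` A. card {l\<in>A. g l = x})"
    using assms(1) card_UN_le[of "g ` A" "\<lambda>x. {l\<in>A. g l = x}"] by simp
  also have "\<dots> \<le> (\<Sum>x\<in>g ` A. D)" using assms(2) by (intro sum_mono) auto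
  finally show ?thesis by (simp add: mult.commute)
qed

lemma card_remaining:
  assumes "finite X" "finite B" "A \<subseteq> X \<union> B" "card B \<le> b" "a + b \<le> card A"
  shows "a \<le> card X"
proof -
  have "card A \<le> card (X \<union> B)" using assms by (intro card_mono) auto
  also have "\<dots> \<le> card X + card B" by (rule card_Un_le)
  finally show ?thesis using assms by linarith
qed

context joined_graph
begin

text \<open>Hall's condition for \<open>A \<subseteq> L\<close> is checked by the number of images
  under \<open>g\<close>. Fewer than \<open>m\<close> images carry at most \<open>D * m\<close>
  elements of \<open>A\<close>, which a single neighbourhood in \<open>U\<close> accommodates. From
  \<open>m\<close> on, the images miss fewer than \<open>m\<close> vertices of \<open>U\<close>; and
  if a vertex of \<open>U\<close> is missed, its \<open>m\<close> neighbours among all images come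
  from outside \<open>A\<close>, so that \<open>A\<close> is smaller than \<open>U\<close> by at
  least \<open>m\<close>.\<close>

lemma joined_matching:
  assumes fin: "finite L" and U: "U \<subseteq> V" and cLU: "card L = card U"
    and g: "g ` L \<subseteq> V - U" and fib: "\<And>x. card {l\<in>L. g l = x} \<le> D"
    and degL: "\<And>l. l \<in> L \<Longrightarrow> D * m \<le> card (nb (g l) \<inter> U)"
    and degU: "\<And>u. u \<in> U \<Longrightarrow> m \<le> card (nb u \<inter> g ` L)"
  shows "\<exists>h. bij_betw h L U \<and> (\<forall>l\<in>L. {g l, h l} \<in> E)"
proof -
  have finU: "finite U" using U finV finite_subset by blast
  have "\<exists>h. (\<forall>l\<in>L. h l \<in> nb (g l) \<inter> U) \<and> inj_on h L"
  proof (rule hall_marriage[OF fin])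
    fix A assume A: "A \<subseteq> L"
    define N where "N = \<Union> ((\<lambda>l. nb (g l) \<inter> U) ` A)"
    have finA: "finite A" using A fin finite_subset by blast
    have NU: "N \<subseteq> U" by (auto simp: N_def)
    have finN: "finite N" using NU finU finite_subset by blast
    have "card {l\<in>A. g l = x} \<le> D" for x
    proof -
      have "{l\<in>A. g l = x} \<subseteq> {l\<in>L. g l = x}" using A by auto
      then have "card {l\<in>A. g l = x} \<le> card {l\<in>L. g l = x}" using fin by (intro card_mono) simp_all
      then show ?thesis using fib[of x] by linarith
    qed
    then have cA: "card A \<le> D * card (g ` A)" using bounded_fibres_card finA by blast
    have "card A \<le> card N"
    proof (cases "card (g ` A) < m")
      case True
      show ?thesis
      proof (cases "A = {}")
        case False
        then obtain l where l: "l \<in> A" by blast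
        have "D * m \<le> card (nb (g l) \<inter> U)" using degL l A by blast
        also have "\<dots> \<le> card N" using l finN by (intro card_mono) (auto simp: N_def)
        finally show ?thesis using cA True by (meson le_trans less_imp_le mult_le_mono2)
      qed simp
    next
      case False
      have "card {u\<in>U - N. nb u \<inter> g ` A = {}} < m"
        using g A U False by (intro few_nonadjacent) auto
      moreover have "{u\<in>U - N. nb u \<inter> g ` A = {}} = U - N"
        using nb_commute by (auto simp: N_def)
      ultimately have lt: "card U < m + card N"
        using NU finN by (simp add: card_Diff_subset)
      show ?thesis
      proof (rule ccontr)
        assume less: "\<not> card A \<le> card N"
        then have "card N < card U" using card_mono[OF fin A] cLU by linarith
        then have "\<not> U \<subseteq> N" using card_mono[OF finN, of U] by auto
        then obtain u where u: "u \<in> U" "u \<notin> N" by blast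
        have "nb u \<inter> g ` L \<subseteq> g ` (L - A)" using u nb_commute by (fastforce simp: N_def)
        then have "card (nb u \<inter> g ` L) \<le> card (g ` (L - A))" using fin by (intro card_mono) auto
        also have "\<dots> \<le> card (L - A)" using fin by (intro card_image_le) auto
        finally have "m \<le> card (L - A)" using degU[OF u(1)] by linarith
        then show False using less lt cLU finA A card_mono[OF fin A] by (simp add: card_Diff_subset)
      qed
    qed
    then show "card A \<le> card (\<Union> ((\<lambda>l. nb (g l) \<inter> U) ` A))" by (simp add: N_def)
  qed simp
  then obtain h where h: "\<forall>l\<in>L. h l \<in> nb (g l) \<inter> U" "inj_on h L" by blast
  have "h ` L = U"
    by (rule card_subset_eq[OF finU]) (use h cLU in \<open>auto simp: card_image\<close>)
  then show ?thesis using h by (auto simp: bij_betw_def nbrs_def)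
qed

text \<open>The set of used vertices without free neighbours in \<open>Y\<close> (or in a target set \<open>W c\<close>) only grows
  during the greedy embedding, so its final size, which is below \<open>m\<close>, bounds both the number of
  vertices placed in the rescue set \<open>Z\<close> and the number of class \<open>c\<close> vertices that miss \<open>W c\<close>.
  A vertex of \<open>J\<close> whose parent is not in \<open>J\<close> is placed freely.\<close>

lemma embed_almost_spanning:
  fixes J :: "nat set" and par cl :: "nat \<Rightarrow> nat" and W :: "nat \<Rightarrow> 'v set"
  assumes finJ: "finite J" and D: "1 \<le> D"
    and children: "\<And>i. card {j\<in>J. par j = i \<and> i < j} \<le> D"
    and sub: "Y \<subseteq> V" "Z \<subseteq> V" "\<And>c. W c \<subseteq> V"
    and disj: "Y \<inter> Z = {}" "\<And>c. W c \<inter> (Y \<union> Z) = {}" "\<And>c c'. c \<noteq> c' \<Longrightarrow> W c \<inter> W c' = {}"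
    and big: "card J + m \<le> card Y"
    and Z: "\<And>v. v \<in> V \<Longrightarrow> D * m \<le> card (nb v \<inter> Z)"
  shows "\<exists>f. inj_on f J \<and> (\<forall>j\<in>J. f j \<in> Y \<union> Z \<union> W (cl j)) \<and>
    (\<forall>j\<in>J. par j \<in> J \<and> par j < j \<longrightarrow> {f (par j), f j} \<in> E) \<and>
    card {j\<in>J. f j \<in> Z} \<le> D * m \<and>
    (\<forall>c. card (W c) + D * m \<le> card {j\<in>J. cl j = c} \<longrightarrow> card (W c - f ` J) < m)"
proof -
  define H where "H j \<longleftrightarrow> par j \<in> J \<and> par j < j" for j
  define Jk where "Jk k = J \<inter> {..<k}" for k
  \<comment> \<open>The last two clauses are certificates. A vertex placed in \<open>Z\<close> or
    off its target shows that its parent had no free neighbour in \<open>Y\<close> or in the target;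
    a vertex without placed parent misses its target only if that is full. Free sets shrink, so
    certificates stay valid.\<close>
  define Inv where "Inv f k \<longleftrightarrow> inj_on f (Jk k) \<and> (\<forall>j\<in>Jk k. f j \<in> Y \<union> Z \<union> W (cl j)) \<and>
     (\<forall>j\<in>Jk k. H j \<longrightarrow> {f (par j), f j} \<in> E) \<and>
     (\<forall>j\<in>Jk k. f j \<in> Z \<longrightarrow> H j \<and> nb (f (par j)) \<inter> (Y - f ` Jk k) = {}) \<and>
     (\<forall>j\<in>Jk k. f j \<notin> W (cl j) \<longrightarrow> W (cl j) \<subseteq> f ` Jk k \<or>
        (H j \<and> nb (f (par j)) \<inter> (W (cl j) - f ` Jk k) = {}))" for f :: "nat \<Rightarrow> 'v" and k
  have finJk: "finite (Jk k)" for k using finJ by (simp add: Jk_def)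
  have imgV: "f ` Jk k \<subseteq> V" if "Inv f k" for f k
    using that sub unfolding Inv_def by blast
  have parJ: "par j \<in> Jk k" if "j \<in> Jk k" "H j" for j k using that by (auto simp: Jk_def H_def)
  \<comment> \<open>The parents of \<open>K\<close> are embedded injectively and see nothing of
    \<open>X\<close>, so there are at most \<open>m - 1\<close> of them, each with at most
    \<open>D\<close> children. The spare \<open>D\<close> is what keeps \<open>Z\<close> from being
    used up.\<close>
  have few: "card K + D \<le> D * m"
    if I: "Inv f k" and K: "K \<subseteq> Jk k" "\<And>j. j \<in> K \<Longrightarrow> H j"
      and X: "X \<subseteq> V" "X \<inter> f ` Jk k = {}" "m \<le> card X" "\<And>j. j \<in> K \<Longrightarrow> nb (f (par j)) \<inter> X = {}"
    for f k K X
  proof -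
    have finK: "finite K" using K(1) finJk finite_subset by blast
    have PJ: "par ` K \<subseteq> Jk k" using K parJ by blast
    have "card {c\<in>f ` par ` K. nb c \<inter> X = {}} < m"
      using X PJ imgV[OF I] by (intro few_nonadjacent) blast+
    moreover have "{c\<in>f ` par ` K. nb c \<inter> X = {}} = f ` par ` K" using X(4) by auto
    moreover have "card (f ` par ` K) = card (par ` K)"
      using I PJ unfolding Inv_def by (meson card_image inj_on_subset)
    ultimately have lt: "card (par ` K) < m" by simp
    have "card {j\<in>K. par j = i} \<le> D" for i
    proof -
      have "{j\<in>K. par j = i} \<subseteq> {j\<in>J. par j = i \<and> i < j}" using K by (auto simp: H_def Jk_def)
      then have "card {j\<in>K. par j = i} \<le> card {j\<in>J. par j = i \<and> i < j}"
        using finJ by (intro card_mono) simp_all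
      then show ?thesis using children[of i] by linarith
    qed
    then have "card K \<le> D * card (par ` K)" using bounded_fibres_card finK by blast
    also have "\<dots> \<le> D * (m - 1)" using lt by (intro mult_le_mono2) linarith
    finally have "card K + D \<le> D * (m - 1) + D" by simp
    also have "\<dots> = D * m" using m_pos by (cases m) simp_all
    finally show ?thesis .
  qed
  have cimg: "card (f ` Jk k) \<le> card J" for f :: "nat \<Rightarrow> 'v" and k
    using card_image_le[OF finJk, of f k] card_mono[OF finJ, of "Jk k"] by (simp add: Jk_def)
  have finV': "finite X" if "X \<subseteq> V" for X using that finV finite_subset by blast
  have freeY: "m \<le> card (Y - f ` Jk k)" for f :: "nat \<Rightarrow> 'v" and k
  proof -
    have "card Y - card (f ` Jk k) \<le> card (Y - f ` Jk k)"
      using finJk by (intro diff_card_le_card_Diff) auto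
    then show ?thesis using big cimg[of f k] by linarith
  qed
  have usedZ: "card {j\<in>Jk k. f j \<in> Z} + D \<le> D * m" if I: "Inv f k" for f k
  proof (rule few[OF I, of _ "Y - f ` Jk k"])
    show "H j" "nb (f (par j)) \<inter> (Y - f ` Jk k) = {}" if "j \<in> {j\<in>Jk k. f j \<in> Z}" for j
      using I that unfolding Inv_def by blast+
  qed (use sub freeY in auto)
  have step: "\<exists>f. Inv f k" for k
  proof (induction k)
    case 0
    show ?case by (simp add: Inv_def Jk_def)
  next
    case (Suc k)
    then obtain f where I: "Inv f k" by blast
    show ?case
    proof (cases "k \<in> J")
      case False
      then have "Jk (Suc k) = Jk k" by (auto simp: Jk_def less_Suc_eq)
      then show ?thesis using I unfolding Inv_def by auto
    next
      case True
      define U where "U = f ` Jk k"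
      define N where "N = (if H k then nb (f (par k)) else V)"
      have JS: "Jk (Suc k) = insert k (Jk k)" "k \<notin> Jk k" using True by (auto simp: Jk_def less_Suc_eq)
      have HV: "f (par k) \<in> V" if "H k"
      proof -
        have "par k \<in> Jk k" using that by (auto simp: H_def Jk_def)
        then show ?thesis using imgV[OF I] by blast
      qed
      \<comment> \<open>Order of preference: the target set of the class, then \<open>Y\<close>, and
        \<open>Z\<close> only if both fail.\<close>
      have "\<exists>v. v \<in> N \<and> v \<notin> U \<and> v \<in> Y \<union> Z \<union> W (cl k) \<and>
          (v \<in> Z \<longrightarrow> H k \<and> N \<inter> (Y - U) = {}) \<and> (v \<notin> W (cl k) \<longrightarrow> N \<inter> (W (cl k) - U) = {})"
      proof (cases "N \<inter> (W (cl k) - U) = {}")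
        case False
        then show ?thesis using disj(2) by blast
      next
        case WN: True
        show ?thesis
        proof (cases "N \<inter> (Y - U) = {}")
          case False
          then show ?thesis using disj(1) WN by blast
        next
          case YN: True
          have Hk: "H k"
          proof (rule ccontr)
            assume "\<not> H k"
            then have "Y - U = {}" using YN sub(1) unfolding N_def by auto
            then have "card (Y - f ` Jk k) = 0" unfolding U_def by (simp only: card.empty)
            then show False using freeY[of f k] m_pos by linarith
          qed
          have "D * m \<le> card (N \<inter> Z)" using Z[OF HV[OF Hk]] Hk by (simp add: N_def)
          moreover have "card (U \<inter> Z) < D * m"
          proof -
            have "U \<inter> Z = f ` {j\<in>Jk k. f j \<in> Z}" by (auto simp: U_def)
            then have "card (U \<inter> Z) \<le> card {j\<in>Jk k. f j \<in> Z}"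
              using finJk by (simp add: card_image_le)
            then show ?thesis using usedZ[OF I] D by linarith
          qed
          ultimately have "\<not> N \<inter> Z \<subseteq> U \<inter> Z"
            using finJk card_mono[of "U \<inter> Z" "N \<inter> Z"] by (auto simp: U_def)
          then show ?thesis using WN YN Hk by blast
        qed
      qed
      then obtain v where v: "v \<in> N" "v \<notin> U" "v \<in> Y \<union> Z \<union> W (cl k)"
        "v \<in> Z \<longrightarrow> H k \<and> N \<inter> (Y - U) = {}" "v \<notin> W (cl k) \<longrightarrow> N \<inter> (W (cl k) - U) = {}" by blast
      define f' where "f' = f(k := v)"
      have f'k: "f' k = v" by (simp add: f'_def)
      have f'j: "f' j = f j" if "j \<in> Jk k" for j using that JS(2) by (auto simp: f'_def)
      have img: "f' ` Jk (Suc k) = insert v U" unfolding JS U_def using f'j f'k by force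
      have f'par: "f' (par j) = f (par j)" if "j \<in> Jk (Suc k)" "H j" for j
        using that f'j by (auto simp: JS Jk_def H_def)
      have "Inv f' (Suc k)"
        unfolding Inv_def
      proof (intro conjI ballI impI)
        show "inj_on f' (Jk (Suc k))"
        proof -
          have "inj_on f' (Jk k)" using I f'j unfolding Inv_def by (metis inj_on_cong)
          moreover have "v \<notin> f' ` (Jk k - {k})" using v(2) f'j JS(2) by (auto simp: U_def)
          ultimately show ?thesis unfolding JS using f'k by simp
        qed
        fix j assume j: "j \<in> Jk (Suc k)"
        then have jc: "j = k \<or> j \<in> Jk k" by (simp add: JS)
        show "f' j \<in> Y \<union> Z \<union> W (cl j)"
          using jc v(3) f'k f'j I unfolding Inv_def by metis
        show "{f' (par j), f' j} \<in> E" if "H j"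
        proof (cases "j = k")
          case True
          then show ?thesis using v(1) f'par[OF j that] that f'k by (simp add: N_def nbrs_def)
        next
          case False
          then show ?thesis using jc f'par[OF j that] f'j I that unfolding Inv_def by auto
        qed
        show "H j" if "f' j \<in> Z"
          using jc v(4) f'k f'j I that unfolding Inv_def by metis
        show "nb (f' (par j)) \<inter> (Y - f' ` Jk (Suc k)) = {}" if z: "f' j \<in> Z"
        proof (cases "j = k")
          case True
          then have "H k" "N \<inter> (Y - U) = {}" using v(4) z f'k by auto
          then show ?thesis using f'par[OF j] True img by (auto simp: N_def)
        next
          case False
          then have "H j \<and> nb (f (par j)) \<inter> (Y - U) = {}"
            using jc f'j I z unfolding Inv_def U_def by auto
          then show ?thesis using f'par[OF j] img by auto
        qed
        show "W (cl j) \<subseteq> f' ` Jk (Suc k) \<or> H j \<and> nb (f' (par j)) \<inter> (W (cl j) - f' ` Jk (Suc k)) = {}"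
          if w: "f' j \<notin> W (cl j)"
        proof (cases "j = k")
          case True
          then have "N \<inter> (W (cl k) - U) = {}" using v(5) w f'k by auto
          then show ?thesis using f'par[OF j] True img sub(3)[of "cl k"] by (cases "H k") (auto simp: N_def)
        next
          case False
          then have "W (cl j) \<subseteq> U \<or> H j \<and> nb (f (par j)) \<inter> (W (cl j) - U) = {}"
            using jc f'j I w unfolding Inv_def U_def by auto
          then show ?thesis using f'par[OF j] img by auto
        qed
      qed
      then show ?thesis by blast
    qed
  qed
  obtain k where k: "J \<subseteq> {..<k}" using finJ unfolding finite_nat_set_iff_bounded by blast
  then have JkJ: "Jk k = J" by (auto simp: Jk_def)
  obtain f where I: "Inv f k" using step by blast
  \<comment> \<open>If \<open>m\<close> vertices of \<open>W c\<close> stayed free,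
    \<open>few\<close> would leave fewer than \<open>D * m\<close> vertices of class
    \<open>c\<close> outside \<open>W c\<close>, so more than \<open>card (W c)\<close> of them
    would lie inside.\<close>
  have "card (W c - f ` J) < m" if c: "card (W c) + D * m \<le> card {j\<in>J. cl j = c}" for c
  proof (rule ccontr)
    assume "\<not> ?thesis"
    then have ge: "m \<le> card (W c - f ` J)" by simp
    define K where "K = {j\<in>J. cl j = c \<and> f j \<notin> W c}"
    have ne: "\<not> W c \<subseteq> f ` J"
    proof
      assume "W c \<subseteq> f ` J"
      then have "card (W c - f ` J) = 0" by (simp only: Diff_eq_empty_iff[THEN iffD2] card.empty)
      then show False using ge m_pos by linarith
    qed
    have KH: "H j \<and> nb (f (par j)) \<inter> (W c - f ` J) = {}" if "j \<in> K" for j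
    proof -
      have "j \<in> J" "cl j = c" "f j \<notin> W (cl j)" using that by (auto simp: K_def)
      then show ?thesis using I ne unfolding Inv_def JkJ by blast
    qed
    have "card K + D \<le> D * m"
      by (rule few[OF I, of K "W c - f ` J"]) (use KH ge sub(3) in \<open>auto simp: JkJ K_def\<close>)
    moreover have "card {j\<in>J. cl j = c \<and> f j \<in> W c} \<le> card (W c)"
      using I finV'[OF sub(3)] unfolding Inv_def JkJ
      by (intro card_inj_on_le[of f]) (auto intro: inj_on_subset)
    moreover have "card {j\<in>J. cl j = c} \<le> card K + card {j\<in>J. cl j = c \<and> f j \<in> W c}"
    proof -
      have "{j\<in>J. cl j = c} = K \<union> {j\<in>J. cl j = c \<and> f j \<in> W c}" by (auto simp: K_def)
      then show ?thesis by (metis card_Un_le)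
    qed
    ultimately show False using c D by linarith
  qed
  moreover have "card {j\<in>J. f j \<in> Z} \<le> D * m" using usedZ[OF I] unfolding JkJ by linarith
  ultimately show ?thesis using I unfolding Inv_def JkJ H_def by blast
qed

end

section \<open>Trees as parent functions\<close>

lemma rtrancl_leaves_set:
  assumes "(x, y) \<in> R\<^sup>*" "x \<in> S" "y \<notin> S"
  shows "\<exists>u v. (u, v) \<in> R \<and> u \<in> S \<and> v \<notin> S"
  using assms by (induction rule: rtrancl_induct) blast+

text \<open>Distinct vertex lists rather than reachability, because such a path is to be closed to a
  \<open>graph_cycle\<close>.\<close>

definition path_connected_in :: "'v set set \<Rightarrow> 'v set \<Rightarrow> bool" where
  "path_connected_in E S \<longleftrightarrow> (\<forall>x\<in>S. \<forall>y\<in>S. \<exists>xs. xs \<noteq> [] \<and> distinct xs \<and> set xs \<subseteq> S \<and>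
     hd xs = x \<and> last xs = y \<and> successively (\<lambda>a b. {a, b} \<in> E) xs)"

lemma path_connected_in_insert:
  assumes S: "path_connected_in E S" and u: "u \<in> S" "{u, v} \<in> E" "v \<notin> S"
  shows "path_connected_in E (insert v S)"
  unfolding path_connected_in_def
proof (intro ballI)
  fix x y assume x: "x \<in> insert v S" and y: "y \<in> insert v S"
  let ?P = "\<lambda>xs. xs \<noteq> [] \<and> distinct xs \<and> set xs \<subseteq> insert v S \<and>
     hd xs = x \<and> last xs = y \<and> successively (\<lambda>a b. {a, b} \<in> E) xs"
  have vu: "{v, u} \<in> E" using u(2) by (simp add: insert_commute)
  consider "x = v" "y = v" | "x = v" "y \<in> S" | "x \<in> S" "y = v" | "x \<in> S" "y \<in> S" using x y by blast
  then show "\<exists>xs. ?P xs"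
  proof cases
    case 1
    then show ?thesis by (intro exI[of _ "[v]"]) simp
  next
    case 2
    obtain xs where "xs \<noteq> []" "distinct xs" "set xs \<subseteq> S" "hd xs = u" "last xs = y"
      "successively (\<lambda>a b. {a, b} \<in> E) xs"
      using S u(1) 2(2) unfolding path_connected_in_def by meson
    then show ?thesis using u 2 vu by (intro exI[of _ "v # xs"]) (auto simp: successively_Cons)
  next
    case 3
    obtain xs where "xs \<noteq> []" "distinct xs" "set xs \<subseteq> S" "hd xs = x" "last xs = u"
      "successively (\<lambda>a b. {a, b} \<in> E) xs"
      using S u(1) 3(1) unfolding path_connected_in_def by meson
    then show ?thesis using u 3 by (intro exI[of _ "xs @ [v]"]) (auto simp: successively_append_iff)
  next
    case 4
    then show ?thesis using S unfolding path_connected_in_def by (meson subset_insertI2)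
  qed
qed

lemma closed_path_gives_cycle:
  assumes xs: "distinct xs" "successively (\<lambda>a b. {a, b} \<in> eset T) xs" "2 \<le> length xs"
    and v: "v \<notin> set xs" "{v, hd xs} \<in> eset T" "{v, last xs} \<in> eset T"
  shows "graph_cycle T (v # xs)"
  unfolding graph_cycle_def
proof (intro conjI allI impI)
  show "3 \<le> length (v # xs)" "distinct (v # xs)" using xs v by auto
  fix i assume i: "i < length (v # xs)"
  have ne: "xs \<noteq> []" using xs(3) by auto
  consider "i = 0" | j where "i = Suc j" "Suc j < length xs" | "i = length xs"
    using i by (cases i) (auto simp: less_Suc_eq)
  then show "{(v # xs) ! i, (v # xs) ! (Suc i mod length (v # xs))} \<in> eset T"
  proof cases
    case 1
    then show ?thesis using v(2) ne by (simp add: hd_conv_nth)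
  next
    case 2
    then show ?thesis using xs(2) by (simp add: successively_conv_nth)
  next
    case 3
    then show ?thesis using v(3) ne by (simp add: last_conv_nth insert_commute nth_Cons')
  qed
qed

text \<open>The tree is exhausted by adding, one at a time, a vertex adjacent to the set reached so
  far. Acyclicity leaves it exactly one neighbour there, its parent, so the parent edges are all the
  edges.\<close>

lemma tree_parent_order:
  assumes T: "is_tree T" and n: "card (vset T) = n"
  shows "\<exists>ord par. bij_betw ord {..<n} (vset T) \<and> (\<forall>j. 0 < j \<and> j < n \<longrightarrow> par j < j) \<and>
     eset T = {{ord j, ord (par j)} | j. 0 < j \<and> j < n}"
proof -
  have sg: "finite (vset T)" "\<And>e. e \<in> eset T \<Longrightarrow> e \<subseteq> vset T \<and> card e = 2"
    using T by (auto simp: is_tree_def simple_graph_def)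
  have conn: "vset T \<noteq> {}" "\<And>u v. u \<in> vset T \<Longrightarrow> v \<in> vset T \<Longrightarrow> (u, v) \<in> {(x, y). {x, y} \<in> eset T}\<^sup>*"
    using T by (auto simp: is_tree_def connected_graph_def)
  have acyc: "\<not> graph_cycle T xs" for xs using T by (auto simp: is_tree_def)
  have npos: "0 < n" using n conn(1) sg(1) by (simp add: card_gt_0_iff flip: n)
  have "\<exists>ord par. inj_on ord {..<k} \<and> ord ` {..<k} \<subseteq> vset T \<and> (\<forall>j. 0 < j \<and> j < k \<longrightarrow> par j < j) \<and>
      {e \<in> eset T. e \<subseteq> ord ` {..<k}} = {{ord j, ord (par j)} | j. 0 < j \<and> j < k} \<and>
      path_connected_in (eset T) (ord ` {..<k})" if "0 < k" "k \<le> n" for k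
    using that
  proof (induction k rule: nat_induct_non_zero)
    case 1
    obtain x where x: "x \<in> vset T" using conn(1) by blast
    have "\<not> e \<subseteq> {x}" if "e \<in> eset T" for e
      using sg(2)[OF that] card_mono[of "{x}" e] by auto
    then have "{e \<in> eset T. e \<subseteq> (\<lambda>_. x) ` {..<1::nat}} = {}" by (auto simp: lessThan_Suc)
    moreover have "path_connected_in (eset T) ((\<lambda>_. x) ` {..<1::nat})"
      unfolding path_connected_in_def by (auto simp: lessThan_Suc intro!: exI[of _ "[x]"])
    ultimately show ?case using x
      by (intro exI[of _ "\<lambda>_. x"] exI[of _ "\<lambda>_. 0"]) (auto simp: lessThan_Suc)
  next
    case (Suc k)
    then obtain ord par where IH: "inj_on ord {..<k}" "ord ` {..<k} \<subseteq> vset T"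
      "\<forall>j. 0 < j \<and> j < k \<longrightarrow> par j < j"
      "{e \<in> eset T. e \<subseteq> ord ` {..<k}} = {{ord j, ord (par j)} | j. 0 < j \<and> j < k}"
      "path_connected_in (eset T) (ord ` {..<k})" by auto
    define S where "S = ord ` {..<k}"
    have "card S = k" using IH(1) by (simp add: S_def card_image)
    then have "S \<noteq> vset T" using Suc.prems n by auto
    then obtain y where y: "y \<in> vset T" "y \<notin> S" using IH(2) by (auto simp: S_def)
    have S0: "ord 0 \<in> S" using Suc.hyps by (simp add: S_def)
    then have "ord 0 \<in> vset T" using IH(2) by (auto simp: S_def)
    from rtrancl_leaves_set[OF conn(2)[OF this y(1)] S0 y(2)]
    obtain u v where uv: "{u, v} \<in> eset T" "u \<in> S" "v \<notin> S" by blast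
    have vT: "v \<in> vset T" using sg(2)[OF uv(1)] by auto
    obtain i where i: "i < k" "u = ord i" using uv(2) by (auto simp: S_def)
    define ord' where "ord' = ord(k := v)"
    define par' where "par' = par(k := i)"
    have o: "ord' j = ord j" if "j < k" for j using that by (simp add: ord'_def)
    have img: "ord' ` {..<Suc k} = insert v S"
      using o by (force simp: S_def ord'_def lessThan_Suc)
    have "inj_on ord' {..<Suc k}"
      using IH(1) uv(3) unfolding S_def ord'_def lessThan_Suc by (auto simp: inj_on_def)
    moreover have "ord' ` {..<Suc k} \<subseteq> vset T" using img vT IH(2) S_def by auto
    moreover have "\<forall>j. 0 < j \<and> j < Suc k \<longrightarrow> par' j < j" using IH(3) i by (auto simp: par'_def less_Suc_eq)
    moreover have "path_connected_in (eset T) (ord' ` {..<Suc k})"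
      unfolding img using path_connected_in_insert[of "eset T" S u v] IH(5) uv by (simp add: S_def)
    moreover have "{e \<in> eset T. e \<subseteq> ord' ` {..<Suc k}} = {{ord' j, ord' (par' j)} | j. 0 < j \<and> j < Suc k}"
    proof -
      \<comment> \<open>A second neighbour \<open>w\<close> in \<open>S\<close> would close a cycle
        with a path from \<open>u\<close> to \<open>w\<close> inside \<open>S\<close>; for this the
        induction carries \<open>path_connected_in\<close>.\<close>
      have uniq: "e = {u, v}" if e: "e \<in> eset T" "e \<subseteq> insert v S" "v \<in> e" for e
      proof -
        obtain w where w: "e = {v, w}" "w \<noteq> v"
          using sg(2)[OF e(1)] e(3) by (auto simp: card_2_iff)
        then have wS: "w \<in> S" using e(2) by auto
        obtain xs where xs: "xs \<noteq> []" "distinct xs" "set xs \<subseteq> S" "hd xs = u" "last xs = w"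
          "successively (\<lambda>a b. {a, b} \<in> eset T) xs"
          using IH(5) uv(2) wS unfolding path_connected_in_def S_def by meson
        have "w = u"
        proof (rule ccontr)
          assume "w \<noteq> u"
          then have "2 \<le> length xs" using xs(1,4,5) by (cases xs rule: list.exhaust; cases "tl xs") auto
          then have "graph_cycle T (v # xs)"
            using xs uv e(1) w by (intro closed_path_gives_cycle) (auto simp: insert_commute)
          then show False using acyc by blast
        qed
        then show ?thesis using w by auto
      qed
      have "{e \<in> eset T. e \<subseteq> insert v S} = insert {u, v} {e \<in> eset T. e \<subseteq> S}"
        using uniq uv by blast
      also have "\<dots> = insert {ord' k, ord' (par' k)} {{ord' j, ord' (par' j)} | j. 0 < j \<and> j < k}"
      proof -
        have "{{ord' j, ord' (par' j)} | j. 0 < j \<and> j < k} = {{ord j, ord (par j)} | j. 0 < j \<and> j < k}"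
          using IH(3) o by (intro Collect_cong ex_cong1) (auto simp: par'_def)
        moreover have "{ord' k, ord' (par' k)} = {u, v}" using i by (auto simp: ord'_def par'_def)
        ultimately show ?thesis using IH(4) by (simp add: S_def)
      qed
      also have "\<dots> = {{ord' j, ord' (par' j)} | j. 0 < j \<and> j < Suc k}"
        using Suc.hyps by (auto simp: less_Suc_eq)
      finally show ?thesis unfolding img .
    qed
    ultimately show ?case by - (rule exI[of _ ord'], rule exI[of _ par'], intro conjI)
  qed
  from this[OF npos order_refl] obtain ord par where r: "inj_on ord {..<n}" "ord ` {..<n} \<subseteq> vset T"
     "\<forall>j. 0 < j \<and> j < n \<longrightarrow> par j < j"
     "{e \<in> eset T. e \<subseteq> ord ` {..<n}} = {{ord j, ord (par j)} | j. 0 < j \<and> j < n}" by (elim exE conjE) (rule that)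
  have img: "ord ` {..<n} = vset T"
    by (rule card_subset_eq[OF sg(1) r(2)]) (use r(1) n in \<open>simp add: card_image\<close>)
  have "bij_betw ord {..<n} (vset T)" using r(1) img by (simp add: bij_betw_def)
  moreover have "{e \<in> eset T. e \<subseteq> vset T} = eset T" using sg(2) by auto
  then have "eset T = {{ord j, ord (par j)} | j. 0 < j \<and> j < n}" using r(4) unfolding img by simp
  ultimately show ?thesis using r(3) by - (rule exI[of _ ord], rule exI[of _ par], intro conjI)
qed

section \<open>Leaves, branchings and unary segments of a rooted tree\<close>

text \<open>\<open>0 < j\<close> keeps out the root, whose value under \<open>par\<close> is
  arbitrary.\<close>

definition children :: "nat \<Rightarrow> (nat \<Rightarrow> nat) \<Rightarrow> nat \<Rightarrow> nat set" where
  "children n par i = {j. 0 < j \<and> j < n \<and> par j = i}"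

lemma finite_children [simp]: "finite (children n par i)"
  by (simp add: children_def)

text \<open>The numbers of children sum to \<open>n - 1\<close>. A leaf falls one short of the value
  one, a branching vertex exceeds it by at least one, so there are fewer branching vertices than
  leaves.\<close>

lemma nonunary_bound:
  assumes par: "\<And>j. 0 < j \<Longrightarrow> j < n \<Longrightarrow> par j < j" and n: "0 < n"
  shows "card {u. u < n \<and> card (children n par u) \<noteq> 1} \<le> 2 * card {u. u < n \<and> children n par u = {}}"
proof -
  define c where "c i = card (children n par i)" for i
  have "(\<Sum>i<n. c i) = card (\<Union>i<n. children n par i)"
    unfolding c_def by (rule card_UN_disjoint[symmetric]) (auto simp: children_def)
  also have "(\<Union>i<n. children n par i) = {0<..<n}"
  proof
    show "{0<..<n} \<subseteq> (\<Union>i<n. children n par i)"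
    proof
      fix j assume j: "j \<in> {0<..<n}"
      then have "par j < n" "j \<in> children n par (par j)" using par[of j] by (auto simp: children_def)
      then show "j \<in> (\<Union>i<n. children n par i)" by blast
    qed
  qed (auto simp: children_def)
  finally have sum: "(\<Sum>i<n. c i) = n - 1" by simp
  define L where "L = {u. u < n \<and> c u = 0}"
  define Br where "Br = {u. u < n \<and> 2 \<le> c u}"
  have "(\<Sum>i<n. 1 + (if i \<in> Br then 1 else 0)) \<le> (\<Sum>i<n. c i + (if i \<in> L then 1 else 0))"
    by (intro sum_mono) (auto simp: L_def Br_def)
  moreover have "(\<Sum>i<n. if i \<in> Br then 1 else 0) = card Br"
    by (subst sum.If_cases) (auto simp: Br_def intro!: arg_cong[of _ _ card])
  moreover have "(\<Sum>i<n. if i \<in> L then 1 else 0) = card L"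
    by (subst sum.If_cases) (auto simp: L_def intro!: arg_cong[of _ _ card])
  ultimately have "n + card Br \<le> n - 1 + card L"
    using sum unfolding sum.distrib by (simp only: sum_constant card_lessThan mult_1_right of_nat_id)
  then have "card Br \<le> card L" using n by linarith
  moreover have "{u. u < n \<and> c u \<noteq> 1} = L \<union> Br" by (auto simp: L_def Br_def)
  ultimately have "card {u. u < n \<and> c u \<noteq> 1} \<le> 2 * card L"
    using card_Un_le[of L Br] by simp
  moreover have "L = {u. u < n \<and> children n par u = {}}" by (simp add: L_def c_def)
  ultimately show ?thesis by (simp add: c_def)
qed

lemma depth_exists:
  assumes par: "\<And>j. 0 < j \<Longrightarrow> j < n \<Longrightarrow> par j < (j::nat)"
  shows "\<exists>dep::nat \<Rightarrow> nat. \<forall>j. 0 < j \<and> j < n \<longrightarrow> dep j = Suc (dep (par j))"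
proof -
  have ex: "\<exists>i. (par ^^ i) j = 0" if "j < n" for j
    using that
  proof (induction j rule: less_induct)
    case (less j)
    show ?case
    proof (cases "j = 0")
      case True
      then show ?thesis by (intro exI[of _ 0]) simp
    next
      case False
      then have "par j < j" using par less.prems by simp
      then obtain i where "(par ^^ i) (par j) = 0" using less by fastforce
      then have "(par ^^ Suc i) j = 0" by (simp add: funpow_swap1)
      then show ?thesis by blast
    qed
  qed
  have "(LEAST i. (par ^^ i) j = 0) = Suc (LEAST i. (par ^^ i) (par j) = 0)" if j: "0 < j" "j < n" for j
  proof -
    obtain i where "(par ^^ i) j = 0" using ex j by blast
    then have "(LEAST i. (par ^^ i) j = 0) = Suc (LEAST i. (par ^^ Suc i) j = 0)"
      by (rule Least_Suc) (use j in simp)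
    then show ?thesis by (simp add: funpow_swap1)
  qed
  then show ?thesis by (intro exI[of _ "\<lambda>j. LEAST i. (par ^^ i) j = 0"]) blast
qed

text \<open>Cutting at the depths congruent to a fixed residue modulo \<open>r\<close> makes the segments below
  different cut points disjoint, and each segment that is not unary is charged to its first
  non-unary vertex.\<close>

lemma unary_segments:
  assumes par: "\<And>j. 0 < j \<Longrightarrow> j < n \<Longrightarrow> par j < (j::nat)" and n: "0 < n" and r: "0 < r"
    and count: "r * (N + 2 * card {u. u < n \<and> children n par u = {}}) \<le> n"
  shows "\<exists>z. inj_on (\<lambda>(i, k). z i k) ({..<N} \<times> {..<r}) \<and>
     (\<forall>i<N. \<forall>k<r. z i k < n \<and> card (children n par (z i k)) = 1) \<and>
     (\<forall>i<N. \<forall>k. Suc k < r \<longrightarrow> 0 < z i (Suc k) \<and> par (z i (Suc k)) = z i k)"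
proof -
  obtain dep where dep: "\<And>j. 0 < j \<Longrightarrow> j < n \<Longrightarrow> dep j = Suc (dep (par j))"
    using depth_exists[OF par] by blast
  define unary where "unary u \<longleftrightarrow> u < n \<and> card (children n par u) = 1" for u
  define dn where "dn u = (SOME j. j \<in> children n par u)" for u
  have dn: "0 < dn u \<and> dn u < n \<and> par (dn u) = u" if "unary u" for u
  proof -
    have "children n par u \<noteq> {}" using that by (auto simp: unary_def)
    then have "dn u \<in> children n par u" unfolding dn_def by (rule some_in_eq[THEN iffD2])
    then show ?thesis by (simp add: children_def)
  qed
  define seg where "seg v k = (dn ^^ k) v" for v k
  have chain: "seg v k < n \<and> dep (seg v k) = dep v + k \<and> (par ^^ k) (seg v k) = v"
    if "v < n" "\<And>i. i < k \<Longrightarrow> unary (seg v i)" for v k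
    using that
  proof (induction k)
    case 0
    then show ?case by (simp add: seg_def)
  next
    case (Suc k)
    have IH: "seg v k < n \<and> dep (seg v k) = dep v + k \<and> (par ^^ k) (seg v k) = v" using Suc by simp
    have "unary (seg v k)" using Suc.prems by simp
    from dn[OF this] have d: "0 < dn (seg v k)" "dn (seg v k) < n" "par (dn (seg v k)) = seg v k" by auto
    have s: "seg v (Suc k) = dn (seg v k)" by (simp add: seg_def)
    show ?case unfolding s using d dep[OF d(1,2)] IH by (simp add: funpow_swap1)
  qed
  define Dp where "Dp \<rho> = {v. v < n \<and> dep v mod r = \<rho>}" for \<rho>
  \<comment> \<open>Along a segment the depth grows by one per step. For starting depths in one
    residue class the depth of a point thus determines \<open>k < r\<close>, and \<open>par\<close>
    iterated \<open>k\<close> times recovers the start.\<close>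
  have inj: "v = v' \<and> k = k'"
    if v: "v \<in> Dp \<rho>" "v' \<in> Dp \<rho>" and k: "k < r" "k' < r" "\<And>i. i < k \<Longrightarrow> unary (seg v i)"
      "\<And>i. i < k' \<Longrightarrow> unary (seg v' i)" and eq: "seg v k = seg v' k'" for \<rho> v v' k k'
  proof -
    have c: "dep (seg v k) = dep v + k" "(par ^^ k) (seg v k) = v"
        "dep (seg v' k') = dep v' + k'" "(par ^^ k') (seg v' k') = v'"
      using chain[of v k] chain[of v' k'] v k by (auto simp: Dp_def)
    have "\<exists>a. dep w = r * a + \<rho>" if "w \<in> Dp \<rho>" for w
      using that mult_div_mod_eq[of r "dep w"] by (intro exI[of _ "dep w div r"]) (simp add: Dp_def)
    then obtain a a' where "dep v = r * a + \<rho>" "dep v' = r * a' + \<rho>" using v by meson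
    moreover have "dep v + k = dep v' + k'" using c(1,3) eq by simp
    ultimately have "k + r * a = k' + r * a'" by linarith
    then have "(k + r * a) mod r = (k' + r * a') mod r" by (rule arg_cong)
    then have kk: "k = k'" using k(1,2) by (simp only: mod_mult_self2 mod_less)
    moreover have "v = v'" using c(2,4) eq unfolding kk by metis
    ultimately show ?thesis by blast
  qed
  have finD: "finite (Dp \<rho>)" for \<rho> by (simp add: Dp_def)
  \<comment> \<open>Pigeonhole: the \<open>r\<close> residue classes of depths partition the
    \<open>n\<close> vertices.\<close>
  have "\<exists>\<rho><r. n \<le> r * card (Dp \<rho>)"
  proof (rule ccontr)
    assume "\<not> ?thesis"
    then have "(\<Sum>\<rho><r. r * card (Dp \<rho>)) < (\<Sum>\<rho><r. n)" using r by (intro sum_strict_mono) auto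
    moreover have "(\<Sum>\<rho><r. card (Dp \<rho>)) = card (\<Union>\<rho><r. Dp \<rho>)"
      by (rule card_UN_disjoint[symmetric]) (auto simp: Dp_def)
    moreover have "(\<Union>\<rho><r. Dp \<rho>) = {..<n}" using r by (auto simp: Dp_def)
    ultimately show False by (simp flip: sum_distrib_left)
  qed
  then obtain \<rho> where \<rho>: "n \<le> r * card (Dp \<rho>)" by blast
  define good where "good = {v \<in> Dp \<rho>. \<forall>k<r. unary (seg v k)}"
  define bad where "bad = {v \<in> Dp \<rho>. \<not> (\<forall>k<r. unary (seg v k))}"
  \<comment> \<open>All points before the first non-unary one are unary, so that point still lies on
    the segment and \<open>inj\<close> applies to it.\<close>
  define ft where "ft v = (LEAST k. \<not> unary (seg v k))" for v
  have ft: "ft v < r \<and> \<not> unary (seg v (ft v)) \<and> (\<forall>i<ft v. unary (seg v i))" if v: "v \<in> bad" for v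
  proof -
    obtain k where k: "k < r" "\<not> unary (seg v k)" using v by (auto simp: bad_def)
    have "ft v \<le> k" unfolding ft_def by (rule Least_le[of "\<lambda>k. \<not> unary (seg v k)", OF k(2)])
    moreover have "\<not> unary (seg v (ft v))" unfolding ft_def by (rule LeastI[of "\<lambda>k. \<not> unary (seg v k)", OF k(2)])
    moreover have "unary (seg v i)" if "i < ft v" for i
      using not_less_Least[of i "\<lambda>k. \<not> unary (seg v k)"] that unfolding ft_def by blast
    ultimately show ?thesis using k(1) by auto
  qed
  have "card bad \<le> card {u. u < n \<and> card (children n par u) \<noteq> 1}"
  proof (rule card_inj_on_le[of "\<lambda>v. seg v (ft v)"])
    show "inj_on (\<lambda>v. seg v (ft v)) bad"
      using inj ft unfolding inj_on_def bad_def by blast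
    show "(\<lambda>v. seg v (ft v)) ` bad \<subseteq> {u. u < n \<and> card (children n par u) \<noteq> 1}"
    proof
      fix u assume "u \<in> (\<lambda>v. seg v (ft v)) ` bad"
      then obtain v where v: "v \<in> bad" "u = seg v (ft v)" by blast
      have "v < n" using v(1) by (simp add: bad_def Dp_def)
      then show "u \<in> {u. u < n \<and> card (children n par u) \<noteq> 1}"
        using chain[of v "ft v"] ft[OF v(1)] v(2) by (auto simp: unary_def)
    qed
  qed simp
  then have cb: "card bad \<le> 2 * card {u. u < n \<and> children n par u = {}}"
    using nonunary_bound[OF par n] by linarith
  have "Dp \<rho> = good \<union> bad" by (auto simp: good_def bad_def)
  then have "card (Dp \<rho>) \<le> card good + card bad" by (simp add: card_Un_le)
  then have "r * card (Dp \<rho>) \<le> r * (card good + card bad)" by simp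
  then have "r * (N + 2 * card {u. u < n \<and> children n par u = {}}) \<le> r * (card good + card bad)"
    using count \<rho> by linarith
  then have "N + 2 * card {u. u < n \<and> children n par u = {}} \<le> card good + card bad" using r by simp
  then have "N \<le> card good" using cb by linarith
  then obtain G where G: "G \<subseteq> good" "card G = N" by (meson obtain_subset_with_card_n)
  have gD: "good \<subseteq> Dp \<rho>" unfolding good_def by (rule Collect_subset)
  have "finite G" by (rule finite_subset[OF subset_trans[OF G(1) gD] finD])
  from ex_bij_betw_nat_finite[OF this] obtain top where top: "bij_betw top {..<N} G"
    unfolding G(2) lessThan_atLeast0 by blast
  have tg: "top i \<in> good" if "i < N" for i using bij_betwE[OF top] G(1) that by blast
  show ?thesis
  proof (intro exI[of _ "\<lambda>i k. seg (top i) k"] conjI allI impI)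
    show "inj_on (\<lambda>(i, k). seg (top i) k) ({..<N} \<times> {..<r})"
    proof (rule inj_onI, clarsimp)
      fix i k i' k' assume h: "i < N" "k < r" "i' < N" "k' < r" "seg (top i) k = seg (top i') k'"
      have t: "top i \<in> Dp \<rho>" "top i' \<in> Dp \<rho>" using tg h by (simp_all add: good_def)
      have "top i = top i' \<and> k = k'"
      proof (rule inj[OF t h(2,4) _ _ h(5)])
        show "unary (seg (top i) l)" if "l < k" for l using tg[OF h(1)] h(2) that by (simp add: good_def)
        show "unary (seg (top i') l)" if "l < k'" for l using tg[OF h(3)] h(4) that by (simp add: good_def)
      qed
      then show "i = i' \<and> k = k'" using bij_betw_imp_inj_on[OF top] h(1,3) by (simp add: inj_on_def)
    qed
    fix i assume i: "i < N"
    show "seg (top i) k < n" "card (children n par (seg (top i) k)) = 1" if "k < r" for k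
      using tg[OF i] that by (auto simp: good_def unary_def)
    show "0 < seg (top i) (Suc k)" "par (seg (top i) (Suc k)) = seg (top i) k" if "Suc k < r" for k
    proof -
      have "unary (seg (top i) k)" using tg[OF i] that by (auto simp: good_def)
      from dn[OF this] show "0 < seg (top i) (Suc k)" "par (seg (top i) (Suc k)) = seg (top i) k"
        by (simp_all add: seg_def)
    qed
  qed
qed

section \<open>Spanning trees in joined graphs\<close>

context joined_graph
begin

text \<open>A map assembled from pieces need only be shown to cover \<open>V\<close>; with
  \<open>n\<close> arguments for \<open>n\<close> vertices injectivity is automatic.\<close>

lemma surj_embedding_inj:
  assumes "card V = n" "V \<subseteq> F ` {..<n}"
  shows "inj_on F {..<n} \<and> F ` {..<n} \<subseteq> V"
proof -
  have le: "card (F ` {..<n}) \<le> n" using card_image_le[of "{..<n}" F] by simp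
  have eq: "V = F ` {..<n}"
    using assms le by (intro card_seteq) auto
  then have "card (F ` {..<n}) = card {..<n}" using assms(1) by simp
  then have "inj_on F {..<n}" by (intro eq_card_imp_inj_on) auto
  then show ?thesis using eq by simp
qed

text \<open>The leaves are matched with the vertices \<open>U\<close> that the rest of the tree
  leaves over. Both degree conditions of this matching are prepared beforehand: parents of leaves
  are directed into \<open>W0\<close>, into which every vertex has many neighbours, and
  \<open>Z\<close> loses at most \<open>D * m\<close> vertices.\<close>

lemma embed_many_leaves:
  assumes cV: "card V = n" and n: "2 \<le> n" and D: "1 \<le> D"
    and par: "\<And>j. 0 < j \<Longrightarrow> j < n \<Longrightarrow> par j < j"
    and ch: "\<And>i. card (children n par i) \<le> D"
    and leaves: "D * (13 * m * m + D * m) \<le> card {u. u < n \<and> children n par u = {}}"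
    and \<delta>: "13 * D * m * m \<le> \<delta>"
  shows "\<exists>F. inj_on F {..<n} \<and> F ` {..<n} \<subseteq> V \<and> (\<forall>j. 0 < j \<and> j < n \<longrightarrow> {F (par j), F j} \<in> E)"
proof -
  define L where "L = {u. u < n \<and> children n par u = {}}"
  define J where "J = {..<n} - L"
  define P where "P = par ` L"
  define a where "a = D * m * m"
  have mm: "m \<le> m * m" "m * m \<le> a" using m_pos D by (simp_all add: a_def mult.assoc)
  have da: "13 * a \<le> \<delta>" using \<delta> by (simp add: a_def mult.assoc)
  have finL: "finite L" by (simp add: L_def)
  have finJ: "finite J" by (simp add: J_def)
  have Vne: "V \<noteq> {}" using cV n by auto
  have "par 1 < 1" using par[of 1] n by simp
  then have "1 \<in> children n par 0" using n by (simp add: children_def)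
  then have L0: "0 \<notin> L" by (auto simp: L_def)
  have Lch: "0 < l \<and> l < n \<and> par l < n \<and> l \<in> children n par (par l)" if "l \<in> L" for l
  proof -
    have "0 < l" "l < n" using that L0 by (auto simp: L_def intro: gr0I)
    then show ?thesis using par[of l] by (simp add: children_def)
  qed
  have PJ: "P \<subseteq> J" using Lch by (fastforce simp: P_def J_def L_def)
  have fibL: "card {l\<in>L. par l = x} \<le> D" for x
  proof -
    have "{l\<in>L. par l = x} \<subseteq> children n par x" using Lch by (auto simp: children_def)
    then show ?thesis using ch[of x] card_mono[OF finite_children] le_trans by blast
  qed
  \<comment> \<open>A parent has at most \<open>D\<close> leaves. This gives enough leaf parents to
    fill \<open>W0\<close> even if \<open>D * m\<close> of them go astray.\<close>
  have "D * (13 * m * m + D * m) \<le> D * card P"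
    using leaves bounded_fibres_card[OF finL fibL] unfolding P_def L_def by linarith
  then have cP: "13 * m * m + D * m \<le> card P" using D by simp
  have cL: "13 * a \<le> card L" using leaves by (simp add: L_def a_def algebra_simps)
  obtain W0 where W0: "W0 \<subseteq> V" "card W0 \<le> 3 * m * (2 * m)" "\<forall>v\<in>V. 2 * m \<le> card (nb v \<inter> W0)"
    using multi_dominating_set[of "{}" "2 * m"] Vne da mm by auto
  have finW: "finite W0" using W0(1) finV finite_subset by blast
  have cW: "card W0 \<le> 6 * a" using W0(2) mm by linarith
  \<comment> \<open>Again a factor 2, because up to \<open>D * m\<close> vertices of
    \<open>Z\<close> may be consumed.\<close>
  have "3 * m * (2 * D * m) = 6 * a" by (simp add: a_def algebra_simps)
  then have "card W0 + 3 * m * (2 * D * m) + m \<le> \<delta>" using cW da mm by linarith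
  from multi_dominating_set[OF finW this Vne] obtain Z where Z: "Z \<subseteq> V - W0"
    "card Z \<le> 3 * m * (2 * D * m)" "\<forall>v\<in>V. 2 * D * m \<le> card (nb v \<inter> Z)" by blast
  have finZ: "finite Z" using Z(1) finV finite_subset by blast
  have cZ: "card Z \<le> 6 * a" using Z(2) by (simp add: a_def algebra_simps)
  define Y where "Y = V - (W0 \<union> Z)"
  define W where "W c = (if c = 0 then W0 else {})" for c :: nat
  define cl :: "nat \<Rightarrow> nat" where "cl j = (if j \<in> P then 0 else 1)" for j
  have "n - card (W0 \<union> Z) \<le> card Y"
    unfolding Y_def using diff_card_le_card_Diff[of "W0 \<union> Z" V] finW finZ cV by simp
  then have cY: "n \<le> card Y + 12 * a" using card_Un_le[of W0 Z] cW cZ by linarith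
  have cJ: "card J + card L = n"
  proof -
    have "L \<subseteq> {..<n}" by (auto simp: L_def)
    then show ?thesis
      using card_Diff_subset[OF finL, of "{..<n}"] card_mono[of "{..<n}" L] by (simp add: J_def)
  qed
  have "\<exists>f. inj_on f J \<and> (\<forall>j\<in>J. f j \<in> Y \<union> Z \<union> W (cl j)) \<and>
    (\<forall>j\<in>J. par j \<in> J \<and> par j < j \<longrightarrow> {f (par j), f j} \<in> E) \<and>
    card {j\<in>J. f j \<in> Z} \<le> D * m \<and>
    (\<forall>c. card (W c) + D * m \<le> card {j\<in>J. cl j = c} \<longrightarrow> card (W c - f ` J) < m)"
  proof (rule embed_almost_spanning[OF finJ D])
    show "card {j\<in>J. par j = i \<and> i < j} \<le> D" for i
    proof -
      have "{j\<in>J. par j = i \<and> i < j} \<subseteq> children n par i" by (auto simp: children_def J_def)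
      then show ?thesis using ch[of i] card_mono[OF finite_children] le_trans by blast
    qed
    \<comment> \<open>\<open>W0\<close> and \<open>Z\<close> cost at most \<open>12 * a\<close>
      vertices; the \<open>13 * a\<close> leaves set aside pay for these and for
      \<open>m \<le> a\<close>.\<close>
    show "card J + m \<le> card Y" using cY cJ cL mm by linarith
    show "D * m \<le> card (nb v \<inter> Z)" if "v \<in> V" for v using Z(3) that by fastforce
  qed (use W0 Z in \<open>auto simp: Y_def W_def\<close>)
  then obtain f where f: "inj_on f J" "\<And>j. j \<in> J \<Longrightarrow> f j \<in> Y \<union> Z \<union> W (cl j)"
    "\<And>j. j \<in> J \<Longrightarrow> par j \<in> J \<and> par j < j \<Longrightarrow> {f (par j), f j} \<in> E"
    "card {j\<in>J. f j \<in> Z} \<le> D * m"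
    "\<And>c. card (W c) + D * m \<le> card {j\<in>J. cl j = c} \<Longrightarrow> card (W c - f ` J) < m" by blast
  have "{j\<in>J. cl j = 0} = P" using PJ by (auto simp: cl_def)
  then have W0f: "card (W0 - f ` J) < m" using f(5)[of 0] cP W0(2) by (simp add: W_def)
  have "Y \<subseteq> V" "Z \<subseteq> V" "W c \<subseteq> V" for c using Z(1) W0(1) by (auto simp: Y_def W_def)
  then have fV: "f ` J \<subseteq> V" using f(2) by blast
  define U where "U = V - f ` J"
  have "card (f ` J) = card J" using f(1) by (rule card_image)
  then have cU: "card L = card U"
    using card_Diff_subset[of "f ` J" V] fV finJ cV cJ by (simp add: U_def)
  have gP: "(\<lambda>l. f (par l)) ` L = f ` P" by (auto simp: P_def)
  have "\<exists>h. bij_betw h L U \<and> (\<forall>l\<in>L. {f (par l), h l} \<in> E)"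
  proof (rule joined_matching[OF finL _ cU, where D = D])
    show "U \<subseteq> V" by (simp add: U_def)
    show "(\<lambda>l. f (par l)) ` L \<subseteq> V - U" unfolding gP U_def using PJ fV by auto
    show "card {l\<in>L. f (par l) = x} \<le> D" for x
    proof (cases "\<exists>l\<in>L. f (par l) = x")
      case True
      then obtain l where l: "l \<in> L" "f (par l) = x" by blast
      have "{k\<in>L. f (par k) = x} \<subseteq> {k\<in>L. par k = par l}"
        using l f(1) PJ unfolding P_def inj_on_def by auto
      then have "card {k\<in>L. f (par k) = x} \<le> card {k\<in>L. par k = par l}"
        using finL by (intro card_mono) simp_all
      then show ?thesis using fibL[of "par l"] by linarith
    next
      case False
      then have "{l\<in>L. f (par l) = x} = {}" by blast
      then show ?thesis by (simp only: card.empty)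
    qed
    show "D * m \<le> card (nb (f (par l)) \<inter> U)" if l: "l \<in> L" for l
    proof (rule card_remaining)
      have "f (par l) \<in> V" using l PJ fV by (auto simp: P_def)
      then show "D * m + D * m \<le> card (nb (f (par l)) \<inter> Z)" using Z(3) by fastforce
      show "nb (f (par l)) \<inter> Z \<subseteq> (nb (f (par l)) \<inter> U) \<union> f ` {j\<in>J. f j \<in> Z}"
        using Z(1) by (auto simp: U_def)
      show "card (f ` {j\<in>J. f j \<in> Z}) \<le> D * m"
        using f(4) card_image_le[of "{j\<in>J. f j \<in> Z}" f] finJ by simp
    qed (use finJ in auto)
    show "m \<le> card (nb u \<inter> (\<lambda>l. f (par l)) ` L)" if u: "u \<in> U" for u
    proof (rule card_remaining)
      show "m + m \<le> card (nb u \<inter> W0)" using W0(3) u by (fastforce simp: U_def)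
      show "card (W0 - f ` J) \<le> m" using W0f by simp
      have "f j \<in> f ` P" if "j \<in> J" "f j \<in> W0" for j
        using f(2)[OF that(1)] that Z(1) by (auto simp: Y_def W_def cl_def split: if_splits)
      then show "nb u \<inter> W0 \<subseteq> (nb u \<inter> (\<lambda>l. f (par l)) ` L) \<union> (W0 - f ` J)"
        unfolding gP by blast
    qed (use finW in auto)
  qed
  then obtain h where h: "bij_betw h L U" "\<And>l. l \<in> L \<Longrightarrow> {f (par l), h l} \<in> E" by blast
  define F where "F j = (if j \<in> L then h j else f j)" for j
  have "V \<subseteq> F ` {..<n}"
  proof
    fix v assume v: "v \<in> V"
    show "v \<in> F ` {..<n}"
    proof (cases "v \<in> U")
      case True
      then obtain l where "l \<in> L" "v = h l" using h(1) by (auto simp: bij_betw_def)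
      then show ?thesis by (intro image_eqI[of _ _ l]) (auto simp: F_def L_def)
    next
      case False
      then obtain j where "j \<in> J" "v = f j" using v by (auto simp: U_def)
      then show ?thesis by (intro image_eqI[of _ _ j]) (auto simp: F_def J_def)
    qed
  qed
  from surj_embedding_inj[OF cV this] have "inj_on F {..<n} \<and> F ` {..<n} \<subseteq> V" .
  moreover have "{F (par j), F j} \<in> E" if j: "0 < j" "j < n" for j
  proof -
    have "j \<in> children n par (par j)" "par j < n" using j par[OF j] by (auto simp: children_def)
    then have pL: "par j \<notin> L" "par j \<in> J" by (auto simp: L_def J_def)
    show ?thesis
    proof (cases "j \<in> L")
      case True
      then show ?thesis using h(2) pL by (simp add: F_def)
    next
      case False
      then have "j \<in> J" using j by (simp add: J_def)
      then show ?thesis using f(3)[of j] pL par[OF j] False by (simp add: F_def)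
    qed
  qed
  ultimately show ?thesis by blast
qed

text \<open>The matchings return the terminals in an order of their own; \<open>\<pi>\<close>
  translates it into the enumerations \<open>s\<close> and \<open>t\<close> for which the network
  was built.\<close>

lemma routes_between_sets:
  assumes r: "routes s t N l A" and b: "bij_betw s {..<N} S" "bij_betw t {..<N} T"
    "bij_betw \<sigma> {..<N} S" "bij_betw \<tau> {..<N} T"
  shows "\<exists>p. (\<forall>i<N. length (p i) = l \<and> walk (p i) \<and> hd (p i) = \<sigma> i \<and> last (p i) = \<tau> i) \<and>
     (\<Union>i<N. set (p i)) = A"
proof -
  define \<rho> where "\<rho> = the_inv_into {..<N} s \<circ> \<sigma>"
  have br: "bij_betw \<rho> {..<N} {..<N}"
    unfolding \<rho>_def by (rule bij_betw_trans[OF b(3) bij_betw_the_inv_into[OF b(1)]])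
  define \<rho>' where "\<rho>' = the_inv_into {..<N} \<rho>"
  have br': "bij_betw \<rho>' {..<N} {..<N}" unfolding \<rho>'_def by (rule bij_betw_the_inv_into[OF br])
  define \<pi> where "\<pi> = (the_inv_into {..<N} t \<circ> \<tau>) \<circ> \<rho>'"
  have "bij_betw \<pi> {..<N} {..<N}"
    unfolding \<pi>_def by (rule bij_betw_trans[OF br' bij_betw_trans[OF b(4) bij_betw_the_inv_into[OF b(2)]]])
  then obtain p where p: "\<And>i. i < N \<Longrightarrow> length (p i) = l \<and> walk (p i) \<and> hd (p i) = s i \<and> last (p i) = t (\<pi> i)"
    "(\<Union>i<N. set (p i)) = A" using r unfolding routes_def by blast
  have \<rho>: "\<rho> i < N" "s (\<rho> i) = \<sigma> i" "t (\<pi> (\<rho> i)) = \<tau> i" if i: "i < N" for i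
  proof -
    show "\<rho> i < N" using bij_betwE[OF br] i by simp
    have "\<sigma> i \<in> s ` {..<N}" "\<tau> i \<in> t ` {..<N}" using b i by (auto simp: bij_betw_def)
    then show "s (\<rho> i) = \<sigma> i" using f_the_inv_into_f[OF bij_betw_imp_inj_on[OF b(1)]] by (simp add: \<rho>_def)
    have "\<rho>' (\<rho> i) = i" unfolding \<rho>'_def using the_inv_into_f_f[OF bij_betw_imp_inj_on[OF br]] i by simp
    then show "t (\<pi> (\<rho> i)) = \<tau> i"
      using f_the_inv_into_f[OF bij_betw_imp_inj_on[OF b(2)] \<open>\<tau> i \<in> t ` {..<N}\<close>] by (simp add: \<pi>_def)
  qed
  have "(\<Union>i<N. set (p (\<rho> i))) = (\<Union>i\<in>\<rho> ` {..<N}. set (p i))" by simp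
  also have "\<rho> ` {..<N} = {..<N}" using br by (simp add: bij_betw_def)
  finally have "(\<Union>i<N. set (p (\<rho> i))) = A" using p(2) by simp
  then show ?thesis using p(1) \<rho> by (intro exI[of _ "\<lambda>i. p (\<rho> i)"]) simp
qed

text \<open>Roles along a segment: \<open>z i 0\<close> and \<open>z i (l + 2)\<close> are embedded
  with the bulk of the tree, \<open>z i 1\<close> receives a leftover vertex, and the
  \<open>l\<close> positions in between form a path of the network; hence the length
  \<open>l + 3\<close>. As its parent is cut out, \<open>z i (l + 2)\<close> is placed freely in the
  bulk embedding.\<close>

lemma embed_many_unary_segments:
  fixes z :: "nat \<Rightarrow> nat \<Rightarrow> nat" and q :: nat
  defines "N \<equiv> 2 ^ q" and "l \<equiv> 4 + 8 * q"
  assumes cV: "card V = n" and D: "1 \<le> D"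
    and par: "\<And>j. 0 < j \<Longrightarrow> j < n \<Longrightarrow> par j < j"
    and ch: "\<And>i. card (children n par i) \<le> D"
    and N: "20 * D * m * m \<le> N"
    and z_inj: "inj_on (\<lambda>(i, k). z i k) ({..<N} \<times> {..<l + 3})"
    and z_unary: "\<And>i k. i < N \<Longrightarrow> k < l + 3 \<Longrightarrow> z i k < n \<and> card (children n par (z i k)) = 1"
    and z_par: "\<And>i k. i < N \<Longrightarrow> Suc k < l + 3 \<Longrightarrow> 0 < z i (Suc k) \<and> par (z i (Suc k)) = z i k"
    and \<delta>: "18 * D * m * m + N * l + 4 * m + 6 \<le> \<delta>"
  shows "\<exists>F. inj_on F {..<n} \<and> F ` {..<n} \<subseteq> V \<and> (\<forall>j. 0 < j \<and> j < n \<longrightarrow> {F (par j), F j} \<in> E)"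
proof -
  define a where "a = D * m * m"
  have mm: "m \<le> m * m" "m * m \<le> a" "D * m \<le> a" using m_pos D by (simp_all add: a_def mult.assoc)
  \<comment> \<open>\<open>20 * a\<close> covers the at most \<open>18 * a\<close> vertices of
    \<open>W0\<close>, \<open>W1\<close> and \<open>Z\<close> together with \<open>m\<close>, and it
    provides enough segment ends to fill \<open>W0\<close> and \<open>W1\<close>.\<close>
  have Na: "20 * a \<le> N" using N by (simp add: a_def mult.assoc)
  have Nl: "4 * N \<le> N * l" by (simp add: l_def)
  have da: "18 * a + N * l + 4 * m + 6 \<le> \<delta>" using \<delta> by (simp add: a_def mult.assoc)
  have N0: "0 < N" by (simp add: N_def)
  have Vne: "V \<noteq> {}" using z_unary[of 0 0] N0 cV by auto
  then obtain v0 where v0: "v0 \<in> V" by blast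
  have "card (nb v0) \<le> card V" using nb_subset[of v0] by (intro card_mono finV) auto
  then have \<delta>n: "\<delta> \<le> n" using mindeg[OF v0] cV by linarith
  have sub_fin: "finite X" if "X \<subseteq> V" for X using that finV finite_subset by blast

  obtain W0 where W0: "W0 \<subseteq> V" "card W0 \<le> 3 * m * (2 * m)" "\<forall>v\<in>V. 2 * m \<le> card (nb v \<inter> W0)"
    using multi_dominating_set[of "{}" "2 * m"] Vne da mm by auto
  have fW0: "finite W0" using sub_fin W0(1) .
  have cW0: "card W0 \<le> 6 * (m * m)" using W0(2) by linarith
  have "card W0 + 3 * m * (2 * m) + m \<le> \<delta>" using cW0 da mm by linarith
  from multi_dominating_set[OF fW0 this Vne] obtain W1 where W1: "W1 \<subseteq> V - W0"
    "card W1 \<le> 3 * m * (2 * m)" "\<forall>v\<in>V. 2 * m \<le> card (nb v \<inter> W1)" by blast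
  have fW1: "finite W1" using sub_fin W1(1) by blast
  have cW1: "card W1 \<le> 6 * (m * m)" using W1(2) by linarith
  have cW01: "card (W0 \<union> W1) \<le> 12 * (m * m)" using card_Un_le[of W0 W1] cW0 cW1 by linarith
  have eZ: "3 * m * (2 * D * m) = 6 * a" by (simp add: a_def)
  have "card (W0 \<union> W1) + 3 * m * (2 * D * m) + m \<le> \<delta>" using cW01 eZ da mm by linarith
  from multi_dominating_set[OF _ this Vne] obtain Z where Z: "Z \<subseteq> V - (W0 \<union> W1)"
    "card Z \<le> 3 * m * (2 * D * m)" "\<forall>v\<in>V. 2 * D * m \<le> card (nb v \<inter> Z)" using fW0 fW1 by blast
  have fZ: "finite Z" using sub_fin Z(1) by blast
  define B where "B = W0 \<union> W1 \<union> Z"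
  have fB: "finite B" using fW0 fW1 fZ by (simp add: B_def)
  have BV: "B \<subseteq> V" using W0(1) W1(1) Z(1) by (auto simp: B_def)
  have cB: "card B \<le> 18 * a"
    using card_Un_le[of "W0 \<union> W1" Z] cW01 Z(2) eZ mm unfolding B_def by linarith
  \<comment> \<open>A set into which every vertex has \<open>m\<close> neighbours, padded to exactly
    \<open>N\<close> vertices to serve as terminals of the network.\<close>
  have ports: "\<exists>S. S \<subseteq> V - C \<and> card S = N \<and> (\<forall>v\<in>V. m \<le> card (nb v \<inter> S))"
    if C: "C \<subseteq> V" "card C \<le> 18 * a + N" for C
  proof -
    have fC: "finite C" using sub_fin C(1) .
    have e: "3 * m * m = 3 * (m * m)" by simp
    have "card C + 3 * m * m + m \<le> \<delta>" using C(2) e da Na Nl mm by linarith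
    from multi_dominating_set[OF fC this Vne] obtain S0 where S0: "S0 \<subseteq> V - C"
      "card S0 \<le> 3 * m * m" "\<forall>v\<in>V. m \<le> card (nb v \<inter> S0)" by blast
    have "card S0 \<le> N" using S0(2) e Na mm by linarith
    moreover have "N \<le> card (V - C)"
      using card_Diff_subset[OF fC C(1)] C(2) cV \<delta>n da Na Nl by linarith
    ultimately obtain S where S: "S0 \<subseteq> S" "S \<subseteq> V - C" "card S = N"
      using exists_subset_between[of S0 N "V - C"] S0(1) finV by auto
    have "m \<le> card (nb v \<inter> S)" if "v \<in> V" for v
    proof -
      have "card (nb v \<inter> S0) \<le> card (nb v \<inter> S)" using S(1) by (intro card_mono) auto
      then show ?thesis using S0(3) that by fastforce
    qed
    then show ?thesis using S by blast
  qed
  have "card B \<le> 18 * a + N" using cB by simp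
  from ports[OF BV this] obtain S where S: "S \<subseteq> V - B" "card S = N" "\<forall>v\<in>V. m \<le> card (nb v \<inter> S)" by blast
  have "card (B \<union> S) \<le> 18 * a + N" using card_Un_le[of B S] cB S(2) by linarith
  moreover have "B \<union> S \<subseteq> V" using BV S(1) by blast
  ultimately obtain T where T: "T \<subseteq> V - (B \<union> S)" "card T = N" "\<forall>v\<in>V. m \<le> card (nb v \<inter> T)" using ports by meson
  have fS: "finite S" and fT: "finite T" using sub_fin S(1) T(1) by blast+
  obtain s where s: "bij_betw s {..<N} S" using ex_bij_betw_nat_finite[OF fS] S(2) by (auto simp: lessThan_atLeast0)
  obtain t where t: "bij_betw t {..<N} T" using ex_bij_betw_nat_finite[OF fT] T(2) by (auto simp: lessThan_atLeast0)
  have "\<exists>A\<subseteq>V - B. card A = 2^q * (4 + 8 * q) \<and> routes s t (2^q) (4 + 8 * q) A"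
  proof (rule routing_network; (fold N_def)?; (fold l_def)?)
    show "inj_on s {..<N}" "inj_on t {..<N}" using s t by (auto dest: bij_betw_imp_inj_on)
    have st: "s ` {..<N} = S" "t ` {..<N} = T" using s t by (auto dest: bij_betw_imp_surj_on)
    show "s ` {..<N} \<subseteq> V" "t ` {..<N} \<subseteq> V" "s ` {..<N} \<inter> t ` {..<N} = {}"
      "B \<inter> (s ` {..<N} \<union> t ` {..<N}) = {}" using S(1) T(1) unfolding st by blast+
    show "finite B" by (rule fB)
    show "card B + N * l + 4 * m + 6 \<le> \<delta>" using cB da by linarith
  qed
  then obtain A where A: "A \<subseteq> V - B" "card A = N * l" "routes s t N l A" unfolding N_def l_def by blast
  have fA: "finite A" using sub_fin A(1) by blast

  have z_eq: "i = i' \<and> k = k'" if "z i k = z i' k'" "i < N" "k < l + 3" "i' < N" "k' < l + 3" for i k i' k'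
    using inj_onD[OF z_inj, of "(i, k)" "(i', k')"] that by simp
  define Rm where "Rm = (\<lambda>(i, k). z i k) ` ({..<N} \<times> {1..l + 1})"
  have cRm: "card Rm = N * (l + 1)"
  proof -
    have "card Rm = card ({..<N} \<times> {1..l + 1})"
      unfolding Rm_def by (intro card_image inj_on_subset[OF z_inj]) auto
    then show ?thesis by simp
  qed
  have Rmn: "Rm \<subseteq> {..<n}" using z_unary by (auto simp: Rm_def)
  have fRm: "finite Rm" using Rmn finite_subset by blast
  define J where "J = {..<n} - Rm"
  have finJ: "finite J" by (simp add: J_def)
  have cJ: "card J + N * (l + 1) = n"
    using card_Diff_subset[OF fRm Rmn] card_mono[of "{..<n}" Rm] Rmn cRm by (simp add: J_def)
  define P0 where "P0 = (\<lambda>i. z i 0) ` {..<N}"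
  define P1 where "P1 = (\<lambda>i. z i (l + 2)) ` {..<N}"
  have zJ: "z i k \<in> J" if "i < N" "k = 0 \<or> k = l + 2" for i k
  proof -
    have "z i k \<notin> Rm"
    proof
      assume "z i k \<in> Rm"
      then obtain i' k' where h: "i' < N" "1 \<le> k'" "k' \<le> l + 1" "z i k = z i' k'" by (auto simp: Rm_def)
      have "k < l + 3" "k' < l + 3" using that(2) h(3) by auto
      then have "k = k'" using z_eq[OF h(4) that(1) _ h(1)] by blast
      then show False using h that(2) by linarith
    qed
    moreover have "k < l + 3" using that(2) by auto
    ultimately show ?thesis using z_unary[OF that(1)] by (simp add: J_def)
  qed
  have PJ: "P0 \<subseteq> J" "P1 \<subseteq> J" using zJ by (auto simp: P0_def P1_def)
  have z0_inj: "inj_on (\<lambda>i. z i 0) {..<N}" "inj_on (\<lambda>i. z i (l + 2)) {..<N}"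
    by (auto intro!: inj_onI dest: z_eq)
  then have cP: "card P0 = N" "card P1 = N" by (simp_all add: P0_def P1_def card_image)
  have P01: "P0 \<inter> P1 = {}"
  proof -
    have "z i 0 \<noteq> z i' (l + 2)" if "i < N" "i' < N" for i i' using z_eq[of i 0 i' "l + 2"] that by auto
    then show ?thesis by (auto simp: P0_def P1_def)
  qed
  define Y where "Y = V - (B \<union> A)"
  define W where "W c = (if c = 0 then W0 else if c = 1 then W1 else {})" for c :: nat
  define cl :: "nat \<Rightarrow> nat" where "cl j = (if j \<in> P0 then 0 else if j \<in> P1 then 1 else 2)" for j
  have cl01: "{j\<in>J. cl j = 0} = P0" "{j\<in>J. cl j = 1} = P1"
    using PJ P01 by (auto simp: cl_def)
  have "n - card (B \<union> A) \<le> card Y"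
    unfolding Y_def using diff_card_le_card_Diff[of "B \<union> A" V] fB fA cV by simp
  then have cY: "n \<le> card Y + 18 * a + N * l" using card_Un_le[of B A] cB A(2) by linarith
  have "\<exists>f. inj_on f J \<and> (\<forall>j\<in>J. f j \<in> Y \<union> Z \<union> W (cl j)) \<and>
    (\<forall>j\<in>J. par j \<in> J \<and> par j < j \<longrightarrow> {f (par j), f j} \<in> E) \<and>
    card {j\<in>J. f j \<in> Z} \<le> D * m \<and>
    (\<forall>c. card (W c) + D * m \<le> card {j\<in>J. cl j = c} \<longrightarrow> card (W c - f ` J) < m)"
  proof (rule embed_almost_spanning[OF finJ D])
    show "card {j\<in>J. par j = i \<and> i < j} \<le> D" for i
    proof -
      have "{j\<in>J. par j = i \<and> i < j} \<subseteq> children n par i" by (auto simp: children_def J_def)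
      then show ?thesis using ch[of i] card_mono[OF finite_children] le_trans by blast
    qed
    have "N * (l + 1) = N * l + N" by simp
    then show "card J + m \<le> card Y" using cY cJ Na mm by linarith
    show "D * m \<le> card (nb v \<inter> Z)" if "v \<in> V" for v using Z(3) that by fastforce
    show "Y \<subseteq> V" "Z \<subseteq> V" "Y \<inter> Z = {}" using Z(1) by (auto simp: Y_def B_def)
    show "W c \<subseteq> V" "W c \<inter> (Y \<union> Z) = {}" for c using W0(1) W1(1) Z(1) by (auto simp: W_def Y_def B_def)
    show "W c \<inter> W c' = {}" if "c \<noteq> c'" for c c' using that W1(1) by (auto simp: W_def)
  qed
  then obtain f where f: "inj_on f J" "\<And>j. j \<in> J \<Longrightarrow> f j \<in> Y \<union> Z \<union> W (cl j)"
    "\<And>j. j \<in> J \<Longrightarrow> par j \<in> J \<and> par j < j \<Longrightarrow> {f (par j), f j} \<in> E"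
    "card {j\<in>J. f j \<in> Z} \<le> D * m"
    "\<And>c. card (W c) + D * m \<le> card {j\<in>J. cl j = c} \<Longrightarrow> card (W c - f ` J) < m" by blast
  have W0f: "card (W0 - f ` J) < m" using f(5)[of 0] cP(1) cl01 cW0 Na mm by (simp add: W_def)
  have W1f: "card (W1 - f ` J) < m" using f(5)[of 1] cP(2) cl01 cW1 Na mm by (simp add: W_def)
  have YZW: "Y \<union> Z \<union> W c \<subseteq> V - A" for c using Z(1) W0(1) W1(1) A(1) by (auto simp: Y_def W_def B_def)
  then have fV: "f ` J \<subseteq> V - A" using f(2) by blast
  \<comment> \<open>\<open>J\<close> omits \<open>N * (l + 1)\<close> tree vertices and
    \<open>A\<close> takes up \<open>N * l\<close> vertices of the graph, so exactly one leftover
    vertex per segment remains.\<close>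
  define Q where "Q = V - A - f ` J"
  have cQ: "card Q = N"
  proof -
    have "card (V - A) = n - N * l" using card_Diff_subset[OF fA] A(1,2) cV by auto
    moreover have "card (f ` J) = card J" using f(1) by (rule card_image)
    ultimately have "card Q = n - N * l - card J"
      unfolding Q_def using card_Diff_subset[of "f ` J" "V - A"] fV finJ by simp
    moreover have "N * (l + 1) = N * l + N" by simp
    ultimately show ?thesis using cJ by linarith
  qed
  have QV: "Q \<subseteq> V" by (auto simp: Q_def)
  have st: "S \<subseteq> A \<and> T \<subseteq> A"
  proof -
    obtain p where p: "\<forall>i<N. length (p i) = l \<and> walk (p i) \<and> hd (p i) = s i \<and> last (p i) = t i" "(\<Union>i<N. set (p i)) = A"
      using routes_between_sets[OF A(3) s t s t] by blast
    have "p i \<noteq> []" if "i < N" for i using p(1) that by (auto simp: l_def)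
    then have "s i \<in> A \<and> t i \<in> A" if "i < N" for i
      using p that by (metis UN_I hd_in_set last_in_set lessThan_iff)
    then show ?thesis using s t by (auto simp: bij_betw_def)
  qed
  have Wimg: "f j \<in> f ` P0" if "j \<in> J" "f j \<in> W0" for j
  proof -
    have "W0 \<inter> (Y \<union> Z) = {}" "W0 \<inter> W1 = {}" using W1(1) Z(1) by (auto simp: Y_def B_def)
    then have "cl j = 0" using f(2)[OF that(1)] that(2) unfolding W_def by (auto split: if_splits)
    then show ?thesis using that(1) cl01(1) by blast
  qed
  have Wimg1: "f j \<in> f ` P1" if "j \<in> J" "f j \<in> W1" for j
  proof -
    have "W1 \<inter> (Y \<union> Z) = {}" "W0 \<inter> W1 = {}" using W1(1) Z(1) by (auto simp: Y_def B_def)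
    then have "cl j = 1" using f(2)[OF that(1)] that(2) unfolding W_def by (auto split: if_splits)
    then show ?thesis using that(1) cl01(2) by blast
  qed
  have degP0: "m \<le> card (nb v \<inter> f ` P0)" if "v \<in> V" for v
  proof (rule card_remaining)
    show "m + m \<le> card (nb v \<inter> W0)" using W0(3) that by fastforce
    show "card (W0 - f ` J) \<le> m" using W0f by simp
    show "nb v \<inter> W0 \<subseteq> (nb v \<inter> f ` P0) \<union> (W0 - f ` J)" using Wimg by blast
  qed (use fW0 in auto)
  have degP1: "m \<le> card (nb v \<inter> f ` P1)" if "v \<in> V" for v
  proof (rule card_remaining)
    show "m + m \<le> card (nb v \<inter> W1)" using W1(3) that by fastforce
    show "card (W1 - f ` J) \<le> m" using W1f by simp
    show "nb v \<inter> W1 \<subseteq> (nb v \<inter> f ` P1) \<union> (W1 - f ` J)" using Wimg1 by blast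
  qed (use fW1 in auto)
  have degQ: "m \<le> card (nb v \<inter> Q)" if "v \<in> V" for v
  proof (rule card_remaining)
    have "2 * D * m \<le> card (nb v \<inter> Z)" using Z(3) that by blast
    moreover have "m \<le> D * m" using D by simp
    ultimately show "m + D * m \<le> card (nb v \<inter> Z)" by linarith
    have "Z \<subseteq> V - A" using Z(1) A(1) by (auto simp: B_def)
    then show "nb v \<inter> Z \<subseteq> (nb v \<inter> Q) \<union> f ` {j\<in>J. f j \<in> Z}" by (auto simp: Q_def)
    show "card (f ` {j\<in>J. f j \<in> Z}) \<le> D * m"
      using f(4) card_image_le[of "{j\<in>J. f j \<in> Z}" f] finJ by simp
  qed (use finJ in auto)

  have perfect: "\<exists>h. bij_betw h {..<N} X \<and> (\<forall>i<N. {g i, h i} \<in> E)"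
    if X: "X \<subseteq> V" "card X = N" "\<And>v. v \<in> V \<Longrightarrow> m \<le> card (nb v \<inter> X)"
      and g: "inj_on g {..<N}" "g ` {..<N} \<subseteq> V - X" "\<And>v. v \<in> V \<Longrightarrow> m \<le> card (nb v \<inter> g ` {..<N})" for X g
  proof -
    have "\<exists>h. bij_betw h {..<N} X \<and> (\<forall>i\<in>{..<N}. {g i, h i} \<in> E)"
    proof (rule joined_matching[where D = 1])
      show "card {i\<in>{..<N}. g i = x} \<le> 1" for x
      proof (rule card_le_Suc0_iff_eq[THEN iffD2, unfolded One_nat_def[symmetric]])
        show "\<forall>i\<in>{i\<in>{..<N}. g i = x}. \<forall>j\<in>{i\<in>{..<N}. g i = x}. i = j" using g(1) by (auto simp: inj_on_def)
      qed simp
      show "1 * m \<le> card (nb (g i) \<inter> X)" if "i \<in> {..<N}" for i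
        using X(3)[of "g i"] g(2) that by auto
    qed (use X g in auto)
    then show ?thesis by blast
  qed
  \<comment> \<open>Three perfect matchings follow: upper ends to \<open>Q\<close>, lower ends to
    \<open>T\<close>, and \<open>Q\<close> to \<open>S\<close>. They determine which input has to be
    routed to which output.\<close>
  have "\<exists>h. bij_betw h {..<N} Q \<and> (\<forall>i<N. {(f \<circ> (\<lambda>i. z i 0)) i, h i} \<in> E)"
  proof (rule perfect[OF QV cQ degQ])
    have img: "(f \<circ> (\<lambda>i. z i 0)) ` {..<N} = f ` P0" by (auto simp: P0_def)
    show "inj_on (f \<circ> (\<lambda>i. z i 0)) {..<N}"
      using z0_inj(1) f(1) PJ(1) unfolding P0_def by (meson comp_inj_on inj_on_subset)
    show "(f \<circ> (\<lambda>i. z i 0)) ` {..<N} \<subseteq> V - Q" unfolding img using PJ(1) fV by (auto simp: Q_def)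
    show "m \<le> card (nb v \<inter> (f \<circ> (\<lambda>i. z i 0)) ` {..<N})" if "v \<in> V" for v unfolding img using degP0 that .
  qed
  then obtain h1 where h1: "bij_betw h1 {..<N} Q" "\<And>i. i < N \<Longrightarrow> {f (z i 0), h1 i} \<in> E" by auto
  have "\<exists>h. bij_betw h {..<N} T \<and> (\<forall>i<N. {(f \<circ> (\<lambda>i. z i (l + 2))) i, h i} \<in> E)"
  proof (rule perfect[OF _ T(2)])
    have img: "(f \<circ> (\<lambda>i. z i (l + 2))) ` {..<N} = f ` P1" by (auto simp: P1_def)
    show "inj_on (f \<circ> (\<lambda>i. z i (l + 2))) {..<N}"
      using z0_inj(2) f(1) PJ(2) unfolding P1_def by (meson comp_inj_on inj_on_subset)
    show "(f \<circ> (\<lambda>i. z i (l + 2))) ` {..<N} \<subseteq> V - T" unfolding img using PJ(2) fV st by auto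
    show "m \<le> card (nb v \<inter> (f \<circ> (\<lambda>i. z i (l + 2))) ` {..<N})" if "v \<in> V" for v unfolding img using degP1 that .
  qed (use T in auto)
  then obtain h3 where h3: "bij_betw h3 {..<N} T" "\<And>i. i < N \<Longrightarrow> {f (z i (l + 2)), h3 i} \<in> E" by auto
  have "\<exists>h. bij_betw h {..<N} S \<and> (\<forall>i<N. {h1 i, h i} \<in> E)"
  proof (rule perfect[OF _ S(2)])
    have img: "h1 ` {..<N} = Q" using h1(1) by (simp add: bij_betw_def)
    show "inj_on h1 {..<N}" using h1(1) by (simp add: bij_betw_def)
    show "h1 ` {..<N} \<subseteq> V - S" unfolding img using st by (auto simp: Q_def)
    show "m \<le> card (nb v \<inter> h1 ` {..<N})" if "v \<in> V" for v unfolding img using degQ that .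
  qed (use S in auto)
  then obtain h2 where h2: "bij_betw h2 {..<N} S" "\<And>i. i < N \<Longrightarrow> {h1 i, h2 i} \<in> E" by auto
  obtain p where p: "\<And>i. i < N \<Longrightarrow> length (p i) = l \<and> walk (p i) \<and> hd (p i) = h2 i \<and> last (p i) = h3 i"
    "(\<Union>i<N. set (p i)) = A"
    using routes_between_sets[OF A(3) s t h2(1) h3(1)] by blast

  define Pt where "Pt i = [f (z i 0), h1 i] @ p i @ [f (z i (l + 2))]" for i
  have Ptl: "length (Pt i) = l + 3" if "i < N" for i using p(1)[OF that] by (simp add: Pt_def)
  have Ptw: "{Pt i ! k, Pt i ! Suc k} \<in> E" if i: "i < N" and k: "Suc k < l + 3" for i k
  proof -
    have "p i \<noteq> []" using p(1)[OF i] by (auto simp: l_def)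
    then have "successively (\<lambda>u v. {u, v} \<in> E) (Pt i)"
      using p(1)[OF i] h1(2)[OF i] h2(2)[OF i] h3(2)[OF i]
      unfolding Pt_def walk_def successively_append_iff by (simp add: insert_commute)
    then show ?thesis using k Ptl[OF i] by (simp add: successively_conv_nth)
  qed
  define Zs where "Zs = (\<lambda>(i, k). z i k) ` ({..<N} \<times> {..<l + 3})"
  define F where "F j = (if j \<in> Zs then (case the_inv_into ({..<N} \<times> {..<l + 3}) (\<lambda>(i, k). z i k) j of (i, k) \<Rightarrow> Pt i ! k)
     else f j)" for j
  have Fz: "F (z i k) = Pt i ! k" if "i < N" "k < l + 3" for i k
  proof -
    have "z i k \<in> Zs" using that by (force simp: Zs_def)
    moreover have "the_inv_into ({..<N} \<times> {..<l + 3}) (\<lambda>(i, k). z i k) (z i k) = (i, k)"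
      using the_inv_into_f_f[OF z_inj, of "(i, k)"] that by simp
    ultimately show ?thesis by (simp add: F_def)
  qed
  have FJ: "F j = f j" if j: "j \<in> J" for j
  proof (cases "j \<in> Zs")
    case True
    then obtain i k where ik: "i < N" "k < l + 3" "j = z i k" by (auto simp: Zs_def)
    have "k = 0 \<or> k = l + 2"
    proof (rule ccontr)
      assume "\<not> ?thesis"
      then have "(i, k) \<in> {..<N} \<times> {1..l + 1}" using ik by auto
      then have "j \<in> Rm" unfolding Rm_def ik(3) by (intro image_eqI) auto
      then show False using j by (simp add: J_def)
    qed
    moreover have "Pt i ! (l + 2) = f (z i (l + 2))" using p(1)[OF ik(1)] by (simp add: Pt_def nth_append)
    moreover have "Pt i ! 0 = f (z i 0)" by (simp add: Pt_def)
    ultimately show ?thesis using Fz[OF ik(1,2)] ik(3) by auto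
  qed (simp add: F_def)
  have "V \<subseteq> F ` {..<n}"
  proof
    fix v assume v: "v \<in> V"
    consider "v \<in> f ` J" | "v \<in> Q" | "v \<in> A" using v by (auto simp: Q_def)
    then show "v \<in> F ` {..<n}"
    proof cases
      case 1
      then show ?thesis using FJ by (force simp: J_def)
    next
      case 2
      then obtain i where i: "i < N" "v = h1 i" using h1(1) by (auto simp: bij_betw_def)
      then have "F (z i 1) = v" using Fz[of i 1] by (simp add: Pt_def)
      moreover have "z i 1 < n" using z_unary[OF i(1), of 1] by simp
      ultimately show ?thesis by blast
    next
      case 3
      then obtain i where i: "i < N" "v \<in> set (p i)" using p(2) by blast
      then obtain k where k: "k < l" "v = p i ! k" using p(1)[OF i(1)] by (auto simp: in_set_conv_nth)
      have "F (z i (k + 2)) = v" using Fz[of i "k + 2"] i(1) k p(1)[OF i(1)] by (simp add: Pt_def nth_append)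
      moreover have "z i (k + 2) < n" using z_unary[OF i(1), of "k + 2"] k(1) by simp
      ultimately show ?thesis by blast
    qed
  qed
  from surj_embedding_inj[OF cV this] have "inj_on F {..<n} \<and> F ` {..<n} \<subseteq> V" .
  moreover have "{F (par j), F j} \<in> E" if j: "0 < j" "j < n" for j
  proof -
    have seg: ?thesis if "i < N" "Suc k < l + 3" "j = z i (Suc k)" for i k
      using Ptw[OF that(1,2)] Fz[of i k] Fz[of i "Suc k"] z_par[OF that(1,2)] that by simp
    have pj: "par j < n" "par j < j" using par[OF j] j by auto
    show ?thesis
    proof (cases "j \<in> Rm")
      case True
      then obtain i k where ik: "i < N" "1 \<le> k" "k \<le> l + 1" "j = z i k" by (auto simp: Rm_def)
      then obtain k' where "k = Suc k'" by (cases k) auto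
      then show ?thesis using seg[of i k'] ik by simp
    next
      case jR: False
      then have jJ: "j \<in> J" using j by (simp add: J_def)
      show ?thesis
      proof (cases "par j \<in> Rm")
        case True
        then obtain i k where ik: "i < N" "1 \<le> k" "k \<le> l + 1" "par j = z i k" by (auto simp: Rm_def)
        have k3: "k < l + 3" "Suc k < l + 3" using ik(3) by auto
        \<comment> \<open>A vertex outside \<open>Rm\<close> with its parent in \<open>Rm\<close> is
          the next vertex of the same segment, because the parent has a single child.\<close>
        have "card (children n par (par j)) = 1" using z_unary[OF ik(1) k3(1)] ik(4) by simp
        then obtain x where x: "children n par (par j) = {x}" by (auto simp: card_1_singleton_iff)
        have "j \<in> children n par (par j)" using j by (simp add: children_def)
        moreover have "z i (Suc k) \<in> children n par (par j)"
          using z_par[OF ik(1) k3(2)] z_unary[OF ik(1) k3(2)] ik(4) by (simp add: children_def)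
        ultimately have "j = z i (Suc k)" using x by auto
        then show ?thesis using seg[OF ik(1) k3(2)] by blast
      next
        case False
        then have "par j \<in> J" using pj by (simp add: J_def)
        then show ?thesis using f(3)[OF jJ] pj FJ jJ by simp
      qed
    qed
  qed
  ultimately show ?thesis by blast
qed

text \<open>With \<open>a = D * m * m\<close> and \<open>d = D * D * m\<close> the cases split at
  \<open>13 * a + d\<close> leaves. Below that, segments of length at most \<open>11 * L\<close> are
  sought; \<open>unary_segments\<close> then asks \<open>n\<close> to be at least
  \<open>726 * L * a + 22 * L * d\<close>, and the network needs minimum degree below
  \<open>600 * L * a\<close>. The constants 1000, 30 and 600 are generous.\<close>

theorem embed_spanning_tree:
  assumes cV: "card V = n" and n: "2 \<le> n" "n < 2 ^ L" and D: "1 \<le> D"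
    and par: "\<And>j. 0 < j \<Longrightarrow> j < n \<Longrightarrow> par j < j"
    and ch: "\<And>i. card (children n par i) \<le> D"
    and n_large: "1000 * L * (D * m * m) + 30 * L * (D * D * m) \<le> n"
    and \<delta>: "600 * L * (D * m * m) \<le> \<delta>"
  shows "\<exists>F. inj_on F {..<n} \<and> F ` {..<n} \<subseteq> V \<and> (\<forall>j. 0 < j \<and> j < n \<longrightarrow> {F (par j), F j} \<in> E)"
proof -
  define a where "a = D * m * m"
  define d where "d = D * D * m"
  have L: "1 \<le> L" using n by (cases L) auto
  have La: "a \<le> L * a" using L by simp
  have mm: "m \<le> a" "1 \<le> a" using m_pos D by (simp_all add: a_def mult.assoc)
  have nl: "1000 * (L * a) + 30 * (L * d) \<le> n" using n_large by (simp add: a_def d_def mult.assoc)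
  have dl: "600 * (L * a) \<le> \<delta>" using \<delta> by (simp add: a_def mult.assoc)
  define Lf where "Lf = card {u. u < n \<and> children n par u = {}}"
  show ?thesis
  proof (cases "D * (13 * m * m + D * m) \<le> Lf")
    case True
    have "13 * D * m * m = 13 * a" by (simp add: a_def)
    then have "13 * D * m * m \<le> \<delta>" using La dl by linarith
    then show ?thesis using embed_many_leaves[OF cV n(1) D par ch] True unfolding Lf_def by blast
  next
    case False
    have "D * (13 * m * m + D * m) = 13 * a + d" by (simp add: a_def d_def algebra_simps)
    then have Lf: "Lf \<le> 13 * a + d" using False by linarith
    \<comment> \<open>The network has a power of 2 as its number of wires, so \<open>N\<close> is
      controlled up to a factor 2.\<close>
    have "\<exists>q. 20 * a \<le> 2 ^ q \<and> (2::nat) ^ q \<le> 40 * a"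
    proof -
      define q where "q = (LEAST q. 20 * a \<le> (2::nat) ^ q)"
      have ex: "20 * a \<le> (2::nat) ^ (20 * a)" using less_exp[of "20 * a"] by simp
      have q1: "20 * a \<le> 2 ^ q" unfolding q_def by (rule LeastI[of "\<lambda>q. 20 * a \<le> (2::nat) ^ q", OF ex])
      have "q \<noteq> 0" using q1 mm(2) by (cases q) auto
      then obtain q' where q': "q = Suc q'" by (cases q) auto
      have "\<not> 20 * a \<le> (2::nat) ^ q'"
        using not_less_Least[of q' "\<lambda>q. 20 * a \<le> (2::nat) ^ q"] q' unfolding q_def by auto
      then show ?thesis using q1 q' by (intro exI[of _ q]) simp
    qed
    then obtain q where q: "20 * a \<le> 2 ^ q" "(2::nat) ^ q \<le> 40 * a" by blast
    have "(2::nat) ^ q < 2 ^ L" using q(2) nl La n(2) by linarith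
    then have qL: "q < L" by simp
    have len: "4 + 8 * q \<le> 8 * L" using qL by linarith
    have cnt: "(4 + 8 * q + 3) * (2 ^ q + 2 * Lf) \<le> n"
    proof -
      have "(4 + 8 * q + 3) * (2 ^ q + 2 * Lf) \<le> (11 * L) * (66 * a + 2 * d)"
        using len q(2) Lf L by (intro mult_le_mono) linarith+
      also have "\<dots> = 726 * (L * a) + 22 * (L * d)" by (simp add: algebra_simps)
      finally show ?thesis using nl by linarith
    qed
    have "0 < n" using n by simp
    have "0 < 4 + 8 * q + 3" by simp
    from unary_segments[OF _ \<open>0 < n\<close> this cnt[unfolded Lf_def]] par
    obtain z :: "nat \<Rightarrow> nat \<Rightarrow> nat" where z: "inj_on (\<lambda>(i, k). z i k) ({..<2 ^ q} \<times> {..<4 + 8 * q + 3})"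
      "\<forall>i<2 ^ q. \<forall>k<4 + 8 * q + 3. z i k < n \<and> card (children n par (z i k)) = 1"
      "\<forall>i<2 ^ q. \<forall>k. Suc k < 4 + 8 * q + 3 \<longrightarrow> 0 < z i (Suc k) \<and> par (z i (Suc k)) = z i k"
      by blast
    have "2 ^ q * (4 + 8 * q) \<le> (40 * a) * (8 * L)" using q(2) len by (rule mult_le_mono)
    also have "\<dots> = 320 * (L * a)" by simp
    finally have "18 * a + 2 ^ q * (4 + 8 * q) + 4 * m + 6 \<le> \<delta>" using dl La mm by linarith
    then have "18 * D * m * m + 2 ^ q * (4 + 8 * q) + 4 * m + 6 \<le> \<delta>" by (simp add: a_def mult.assoc)
    moreover have "20 * D * m * m \<le> 2 ^ q" using q(1) by (simp add: a_def mult.assoc)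
    ultimately show ?thesis
      using embed_many_unary_segments[OF cV D par ch, where z = z and q = q] z by blast
  qed
qed

end

section \<open>The game\<close>

definition maker_part :: "'x set list \<Rightarrow> 'x set" where
  "maker_part h = (\<Union>i\<in>{i. i < length h \<and> even i}. h ! i)"

definition breaker_part :: "'x set list \<Rightarrow> 'x set" where
  "breaker_part h = (\<Union>i\<in>{i. i < length h \<and> odd i}. h ! i)"

lemma parts_append:
  "maker_part (h @ [x]) = (if even (length h) then maker_part h \<union> x else maker_part h)"
  "breaker_part (h @ [x]) = (if even (length h) then breaker_part h else breaker_part h \<union> x)"
proof -
  have s: "{i. i < length (h @ [x]) \<and> Q i} = {i. i < length h \<and> Q i} \<union> (if Q (length h) then {length h} else {})"
    for Q :: "nat \<Rightarrow> bool" by (auto simp: less_Suc_eq)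
  have c: "(\<Union>i\<in>{i. i < length h \<and> Q i}. (h @ [x]) ! i) = (\<Union>i\<in>{i. i < length h \<and> Q i}. h ! i)"
    for Q :: "nat \<Rightarrow> bool" by (auto simp: nth_append)
  show "maker_part (h @ [x]) = (if even (length h) then maker_part h \<union> x else maker_part h)"
    unfolding maker_part_def s UN_Un c by auto
  show "breaker_part (h @ [x]) = (if even (length h) then breaker_part h else breaker_part h \<union> x)"
    unfolding breaker_part_def s UN_Un c by auto
qed

lemma parts_union: "\<Union> (set h) = maker_part h \<union> breaker_part h"
  unfolding maker_part_def breaker_part_def set_conv_nth by auto

lemma length_history [simp]: "length (history \<sigma> \<tau> t) = t"
  by (induction t) auto

text \<open>The power stays at most 2 for exponents up to \<open>b\<close>, so each factor adds at
  most \<open>2 * (1 / (2 * b)) = 1 / b\<close>. A bound linear in \<open>k\<close> lets the growth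
  of a weight be charged to Breaker's elements one by one.\<close>

lemma biased_power_bound:
  assumes "1 \<le> b" "k \<le> b"
  shows "(1 + 1 / (2 * real b)) ^ k \<le> 1 + real k / real b"
  using assms(2)
proof (induction k)
  case (Suc k)
  let ?B = "1 + 1 / (2 * real b)"
  have b: "0 < real b" using assms(1) by simp
  have IH: "?B ^ k \<le> 1 + real k / real b" using Suc by simp
  have "real k / real b \<le> 1" using Suc.prems b by simp
  then have "?B ^ k \<le> 2" using IH by linarith
  then have "?B ^ k * (1 / (2 * real b)) \<le> 2 * (1 / (2 * real b))"
    using b by (intro mult_right_mono) auto
  moreover have "?B ^ Suc k = ?B ^ k + ?B ^ k * (1 / (2 * real b))" by (simp add: algebra_simps)
  ultimately have "?B ^ Suc k \<le> 1 + real k / real b + 1 / real b" using IH by simp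
  then show ?case by (simp add: add_divide_distrib)
qed simp

text \<open>Beck's criterion with a base slightly smaller than \<open>2 powr (1 / b)\<close>. Maker takes the element of
  largest danger; the weight that Breaker's \<open>b\<close> elements add is at most \<open>b\<close> times \<open>1 / b\<close> of
  that danger, so the total weight of the sets not yet hit never increases.\<close>

lemma maker_hits_family:
  fixes X :: "'x set" and H :: "'x set set"
  defines "w \<equiv> \<lambda>b::nat. 1 / (1 + 1 / (2 * real b))"
  assumes finX: "finite X" and H: "H \<subseteq> Pow X" and b: "1 \<le> b" and weight: "(\<Sum>F\<in>H. w b ^ card F) < 1"
  shows "\<exists>\<sigma>. legal_strategy X 1 \<sigma> \<and>
     (\<forall>\<tau>. legal_strategy X b \<tau> \<longrightarrow> (\<forall>F\<in>H. F \<inter> maker_claims \<sigma> \<tau> \<noteq> {}))"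
proof -
  define v where "v = w b"
  define \<beta> where "\<beta> = 1 + 1 / (2 * real b)"
  have b0: "0 < real b" using b by simp
  then have "1 \<le> \<beta>" by (simp add: \<beta>_def)
  moreover have "v = 1 / \<beta>" by (simp add: v_def w_def \<beta>_def)
  ultimately have \<beta>: "0 < v" "v * \<beta> = 1" by simp_all
  have finH: "finite H" using H finX finite_subset by blast
  have finF: "finite F" if "F \<in> H" for F using that H finX finite_subset by blast
  define unhit where "unhit M = {F\<in>H. F \<inter> M = {}}" for M
  have finU: "finite (unhit M)" for M using finH by (simp add: unhit_def)
  define \<Phi> where "\<Phi> M B = (\<Sum>F\<in>unhit M. v ^ card (F - B))" for M B
  define danger where "danger M B e = (\<Sum>F\<in>{F\<in>unhit M. e \<in> F}. v ^ card (F - B))" for M B e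
  define pick where "pick M B U = (SOME e. e \<in> U \<and> (\<forall>e'\<in>U. danger M B e' \<le> danger M B e))" for M B U
  have pick: "pick M B U \<in> U \<and> (\<forall>e'\<in>U. danger M B e' \<le> danger M B (pick M B U))"
    if U: "finite U" "U \<noteq> {}" for M B U
  proof -
    have "Max (danger M B ` U) \<in> danger M B ` U" using U by (intro Max_in) auto
    then obtain e where "e \<in> U" "danger M B e = Max (danger M B ` U)" by (metis imageE)
    then have "e \<in> U \<and> (\<forall>e'\<in>U. danger M B e' \<le> danger M B e)" using U(1) by simp
    then show ?thesis unfolding pick_def by (rule someI)
  qed
  define \<sigma> where "\<sigma> h = (if X - \<Union> (set h) = {} then {} else
     {pick (maker_part h) (breaker_part h) (X - \<Union> (set h))})" for h
  have legal: "legal_strategy X 1 \<sigma>"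
    unfolding legal_strategy_def
  proof (intro allI conjI)
    fix h
    show "\<sigma> h \<subseteq> X - \<Union> (set h)" 
      using pick[of "X - \<Union> (set h)" "maker_part h" "breaker_part h"] finX
      by (cases "X - \<Union> (set h) = {}") (simp_all add: \<sigma>_def del: Diff_eq_empty_iff)
    define U where "U = X - \<Union> (set h)"
    have "1 \<le> card U" if "U \<noteq> {}" using that finX by (simp add: U_def Suc_le_eq card_gt_0_iff)
    then show "card (\<sigma> h) = min 1 (card (X - \<Union> (set h)))"
      unfolding \<sigma>_def U_def[symmetric] by (cases "U = {}") simp_all
  qed
  \<comment> \<open>A round is Maker's move \<open>e\<close> and Breaker's reply \<open>T\<close>.
    Maker's move removes the danger of \<open>e\<close> from the potential; the reply multiplies
    each remaining weight by at most \<open>1 + card (F \<inter> T) / b\<close>.\<close>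
  have round: "\<Phi> (M \<union> {e}) (B \<union> T) \<le> \<Phi> M B"
    if e: "e \<in> U" "\<forall>e'\<in>U. danger M B e' \<le> danger M B e" and T: "T \<subseteq> U" "card T \<le> b"
      and U: "finite U" "U \<inter> B = {}" for M B U T e
  proof -
    have finT: "finite T" using T(1) U(1) finite_subset by blast
    let ?A = "unhit (M \<union> {e})"
    have split: "\<Phi> M B = \<Phi> (M \<union> {e}) B + danger M B e"
    proof -
      have "unhit M = ?A \<union> {F\<in>unhit M. e \<in> F}" "?A \<inter> {F\<in>unhit M. e \<in> F} = {}"
        by (auto simp: unhit_def)
      then show ?thesis unfolding \<Phi>_def danger_def
        using sum.union_disjoint[of ?A "{F\<in>unhit M. e \<in> F}" "\<lambda>F. v ^ card (F - B)"] finU by simp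
    qed
    have "\<Phi> (M \<union> {e}) (B \<union> T) \<le> (\<Sum>F\<in>?A. v ^ card (F - B) * (1 + real (card (F \<inter> T)) / real b))"
      unfolding \<Phi>_def
    proof (rule sum_mono)
      fix F assume "F \<in> ?A"
      then have fF: "finite F" using finF by (simp add: unhit_def)
      have "F - B = (F - (B \<union> T)) \<union> (F \<inter> T)" using T(1) U(2) by blast
      moreover have "card ((F - (B \<union> T)) \<union> (F \<inter> T)) = card (F - (B \<union> T)) + card (F \<inter> T)"
        using fF by (intro card_Un_disjoint) auto
      ultimately have c: "card (F - B) = card (F - (B \<union> T)) + card (F \<inter> T)" by simp
      have "v ^ card (F - (B \<union> T)) = v ^ card (F - (B \<union> T)) * (v * \<beta>) ^ card (F \<inter> T)" using \<beta>(2) by simp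
      also have "\<dots> = v ^ card (F - B) * \<beta> ^ card (F \<inter> T)"
        unfolding c power_add power_mult_distrib by simp
      also have "\<dots> \<le> v ^ card (F - B) * (1 + real (card (F \<inter> T)) / real b)"
      proof (rule mult_left_mono)
        have "card (F \<inter> T) \<le> b" using card_mono[OF finT, of "F \<inter> T"] T(2) by simp
        then show "\<beta> ^ card (F \<inter> T) \<le> 1 + real (card (F \<inter> T)) / real b"
          unfolding \<beta>_def by (rule biased_power_bound[OF b])
      qed (use \<beta> in simp)
      finally show "v ^ card (F - (B \<union> T)) \<le> v ^ card (F - B) * (1 + real (card (F \<inter> T)) / real b)" .
    qed
    also have "\<dots> = \<Phi> (M \<union> {e}) B + (\<Sum>F\<in>?A. real (card (F \<inter> T)) * v ^ card (F - B)) / real b"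
      unfolding \<Phi>_def sum_divide_distrib sum.distrib[symmetric] by (rule sum.cong) (simp_all add: algebra_simps)
    \<comment> \<open>Double counting of pairs of a set not yet hit and an element of
      \<open>T\<close> in it.\<close>
    also have "(\<Sum>F\<in>?A. real (card (F \<inter> T)) * v ^ card (F - B)) = (\<Sum>t\<in>T. danger (M \<union> {e}) B t)"
    proof -
      have "(\<Sum>F\<in>?A. real (card (F \<inter> T)) * v ^ card (F - B)) =
          (\<Sum>F\<in>?A. \<Sum>t\<in>T. if t \<in> F then v ^ card (F - B) else 0)"
      proof (rule sum.cong[OF refl])
        fix F
        have "(\<Sum>t\<in>T. if t \<in> F then v ^ card (F - B) else 0) = (\<Sum>t\<in>T \<inter> F. v ^ card (F - B))"
          using finT by (rule sum.inter_restrict[symmetric])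
        also have "T \<inter> F = F \<inter> T" by blast
        finally show "real (card (F \<inter> T)) * v ^ card (F - B) =
          (\<Sum>t\<in>T. if t \<in> F then v ^ card (F - B) else 0)" by simp
      qed
      also have "\<dots> = (\<Sum>t\<in>T. \<Sum>F\<in>?A. if t \<in> F then v ^ card (F - B) else 0)" by (rule sum.swap)
      also have "\<dots> = (\<Sum>t\<in>T. danger (M \<union> {e}) B t)"
      proof (rule sum.cong[OF refl])
        fix t
        show "(\<Sum>F\<in>?A. if t \<in> F then v ^ card (F - B) else 0) = danger (M \<union> {e}) B t"
          unfolding danger_def using finU by (rule sum.inter_filter[symmetric])
      qed
      finally show ?thesis .
    qed
    \<comment> \<open>The elements of \<open>T\<close> were available when Maker chose
      \<open>e\<close>, so none of them was more dangerous.\<close>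
    also have "(\<Sum>t\<in>T. danger (M \<union> {e}) B t) \<le> (\<Sum>t\<in>T. danger M B e)"
    proof (rule sum_mono)
      fix t assume t: "t \<in> T"
      have "danger (M \<union> {e}) B t \<le> danger M B t"
        unfolding danger_def using finH \<beta>(1) by (intro sum_mono2) (auto simp: unhit_def)
      then show "danger (M \<union> {e}) B t \<le> danger M B e" using e(2) t T(1) by (meson order_trans subsetD)
    qed
    also have "(\<Sum>t\<in>T. danger M B e) \<le> real b * danger M B e"
    proof -
      have "0 \<le> danger M B e" unfolding danger_def using \<beta>(1) by (intro sum_nonneg) simp
      then show ?thesis using T(2) by (simp add: mult_right_mono)
    qed
    finally have "\<Phi> (M \<union> {e}) (B \<union> T) \<le> \<Phi> (M \<union> {e}) B + real b * danger M B e / real b"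
      using b0 by (simp add: divide_right_mono)
    then show ?thesis using split b0 by simp
  qed
  have "F \<inter> maker_claims \<sigma> \<tau> \<noteq> {}" if \<tau>: "legal_strategy X b \<tau>" and F: "F \<in> H" for \<tau> F
  proof
    assume no: "F \<inter> maker_claims \<sigma> \<tau> = {}"
    define h where "h t = history \<sigma> \<tau> (2 * t)" for t
    define h' where "h' t = h t @ [\<sigma> (h t)]" for t
    have hS: "h (Suc t) = h' t @ [\<tau> (h' t)]" for t by (simp add: h_def h'_def)
    have lh: "length (h t) = 2 * t" for t by (simp add: h_def)
    have mp': "maker_part (h' t) = maker_part (h t) \<union> \<sigma> (h t)"
      "breaker_part (h' t) = breaker_part (h t)" "odd (length (h' t))" for t
      unfolding h'_def by (simp_all add: parts_append lh)
    have mp: "maker_part (h (Suc t)) = maker_part (h t) \<union> \<sigma> (h t)"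
      "breaker_part (h (Suc t)) = breaker_part (h t) \<union> \<tau> (h' t)" for t
      unfolding hS parts_append using mp' by simp_all
    have \<tau>l: "\<tau> (h' t) \<subseteq> X - \<Union> (set (h' t))" "card (\<tau> (h' t)) \<le> b" for t
      using \<tau> unfolding legal_strategy_def by (auto simp: min_def)
    have small: "\<Phi> (maker_part (h t)) (breaker_part (h t)) < 1" for t
    proof (induction t)
      case 0
      have "unhit {} = H" by (auto simp: unhit_def)
      then show ?case using weight by (simp add: h_def maker_part_def breaker_part_def \<Phi>_def v_def)
    next
      case (Suc t)
      let ?M = "maker_part (h t)" and ?B = "breaker_part (h t)" and ?U = "X - \<Union> (set (h t))"
      have sub: "\<tau> (h' t) \<subseteq> ?U" using \<tau>l(1)[of t] by (auto simp: h'_def)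
      have "\<Phi> (maker_part (h (Suc t))) (breaker_part (h (Suc t))) \<le> \<Phi> ?M ?B"
      proof (cases "?U = {}")
        case True
        then have "\<sigma> (h t) = {}" "\<tau> (h' t) = {}" using sub by (auto simp: \<sigma>_def)
        then show ?thesis unfolding mp by simp
      next
        case False
        have \<sigma>h: "\<sigma> (h t) = {pick ?M ?B ?U}" using False unfolding \<sigma>_def by (simp only: if_False)
        have p: "pick ?M ?B ?U \<in> ?U" "\<forall>e'\<in>?U. danger ?M ?B e' \<le> danger ?M ?B (pick ?M ?B ?U)"
          using pick[of ?U ?M ?B] False finX by blast+
        show ?thesis unfolding mp \<sigma>h
          by (rule round[OF p sub \<tau>l(2)]) (use finX parts_union[of "h t"] in auto)
      qed
      then show ?case using Suc by linarith
    qed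
    \<comment> \<open>Maker alone takes an element per round as long as there is one, so the board
      is exhausted after \<open>card X\<close> rounds.\<close>
    have "card (X - \<Union> (set (h t))) \<le> card X - t" for t
    proof (induction t)
      case 0
      show ?case using finX by (simp add: h_def)
    next
      case (Suc t)
      let ?U = "X - \<Union> (set (h t))"
      have sub: "X - \<Union> (set (h (Suc t))) \<subseteq> ?U - \<sigma> (h t)" unfolding hS h'_def by auto
      have "\<sigma> (h t) \<subseteq> ?U" "card (\<sigma> (h t)) = min 1 (card ?U)"
        using legal unfolding legal_strategy_def by auto
      moreover have "finite (\<sigma> (h t))" by (simp add: \<sigma>_def)
      ultimately have "card (?U - \<sigma> (h t)) = card ?U - min 1 (card ?U)"
        by (simp add: card_Diff_subset)
      moreover have "card (X - \<Union> (set (h (Suc t)))) \<le> card (?U - \<sigma> (h t))"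
        using sub finX by (intro card_mono) auto
      ultimately show ?case using Suc by linarith
    qed
    then have "X - \<Union> (set (h (card X))) = {}"
      using finX by (metis card_0_eq diff_self_eq_0 finite_Diff le_zero_eq)
    then have all: "X \<subseteq> maker_part (h (card X)) \<union> breaker_part (h (card X))"
      using parts_union[of "h (card X)"] by auto
    have "maker_part (h t) \<subseteq> maker_claims \<sigma> \<tau>" for t
    proof (induction t)
      case (Suc t)
      have "\<sigma> (h t) \<subseteq> maker_claims \<sigma> \<tau>" unfolding maker_claims_def h_def
        by (intro UN_upper[of "2 * t" _ "\<lambda>t. \<sigma> (history \<sigma> \<tau> t)"]) simp
      then show ?case unfolding mp using Suc by blast
    qed (simp add: h_def maker_part_def)
    then have F0: "F \<inter> maker_part (h (card X)) = {}" using no by blast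
    \<comment> \<open>A set missed by Maker would belong to Breaker entirely and weigh
      \<open>v ^ 0 = 1\<close>, more than the whole potential.\<close>
    then have "F - breaker_part (h (card X)) = {}" using all F H by blast
    then have "v ^ card (F - breaker_part (h (card X))) = 1" by (simp only: card.empty power_0)
    moreover have "v ^ card (F - breaker_part (h (card X))) \<le> \<Phi> (maker_part (h (card X))) (breaker_part (h (card X)))"
      unfolding \<Phi>_def using F F0 finU \<beta>(1) by (intro member_le_sum) (auto simp: unhit_def)
    ultimately show False using small[of "card X"] by linarith
  qed
  then show ?thesis using legal by blast
qed

section \<open>Minimum degree and joinedness as families of edge sets to be hit\<close>

text \<open>Applied to the edges at a vertex: hitting each of \<open>k\<close> disjoint blocks there
  gives Maker degree \<open>k\<close>.\<close>

lemma disjoint_blocks: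
  assumes "finite A" "k * s \<le> card A"
  shows "\<exists>bl. \<forall>i<k. bl i \<subseteq> A \<and> card (bl i) = s \<and> (\<forall>j<k. i \<noteq> j \<longrightarrow> bl i \<inter> bl j = {})"
  using assms(2)
proof (induction k)
  case (Suc k)
  then have "k * s \<le> card A" by simp
  from Suc.IH[OF this] obtain bl where
    "\<forall>i<k. bl i \<subseteq> A \<and> card (bl i) = s \<and> (\<forall>j<k. i \<noteq> j \<longrightarrow> bl i \<inter> bl j = {})" by (elim exE)
  then have bl: "\<And>i. i < k \<Longrightarrow> bl i \<subseteq> A" "\<And>i. i < k \<Longrightarrow> card (bl i) = s"
    "\<And>i j. i < k \<Longrightarrow> j < k \<Longrightarrow> i \<noteq> j \<Longrightarrow> bl i \<inter> bl j = {}" by simp_all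
  define C where "C = (\<Union>i<k. bl i)"
  have CA: "C \<subseteq> A" using bl(1) by (auto simp: C_def)
  have "card C \<le> (\<Sum>i<k. card (bl i))" unfolding C_def by (rule card_UN_le) simp
  also have "\<dots> = k * s" using bl(2) by simp
  finally have "s \<le> card (A - C)"
    using Suc.prems assms(1) CA by (simp add: card_Diff_subset finite_subset)
  then obtain S where S: "S \<subseteq> A - C" "card S = s" by (meson obtain_subset_with_card_n)
  have dj: "S \<inter> bl i = {}" if "i < k" for i using S(1) that by (auto simp: C_def)
  show ?case
  proof (intro exI[of _ "bl(k := S)"] allI impI)
    fix i assume "i < Suc k"
    then consider "i = k" | "i < k" by linarith
    then show "(bl(k := S)) i \<subseteq> A \<and> card ((bl(k := S)) i) = s \<and>
        (\<forall>j<Suc k. i \<noteq> j \<longrightarrow> (bl(k := S)) i \<inter> (bl(k := S)) j = {})"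
    proof cases
      case 1
      then show ?thesis using S dj by (auto simp: less_Suc_eq)
    next
      case 2
      have "bl i \<inter> S = {}" using dj[OF 2] by blast
      then show ?thesis using bl(1,2)[OF 2] bl(3)[OF 2] 2 by (simp add: less_Suc_eq)
    qed
  qed
qed simp

text \<open>Joinedness at size \<open>k\<close> becomes abundance at size
  \<open>k * (s + 1)\<close>: \<open>k\<close> vertices of \<open>X\<close> with fewer than
  \<open>s\<close> neighbours in \<open>Y\<close> each would together miss \<open>k\<close> vertices
  of \<open>Y\<close>. So at least \<open>k * s\<close> vertices of \<open>X\<close> have
  \<open>s\<close> neighbours in \<open>Y\<close>.\<close>

lemma edges_between_large_sets:
  assumes V: "finite V"
    and joined: "\<And>X Y. X \<subseteq> V \<Longrightarrow> Y \<subseteq> V \<Longrightarrow> X \<inter> Y = {} \<Longrightarrow> card X = k \<Longrightarrow> card Y = k \<Longrightarrow>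
        \<exists>x\<in>X. \<exists>y\<in>Y. {x, y} \<in> E"
    and XY: "X \<subseteq> V" "Y \<subseteq> V" "X \<inter> Y = {}" "card X = k * (s + 1)" "card Y = k * (s + 1)"
  shows "k * s * s \<le> card {e\<in>E. \<exists>x\<in>X. \<exists>y\<in>Y. e = {x, y}}"
proof -
  have fX: "finite X" and fY: "finite Y" using XY V finite_subset by blast+
  define nY where "nY x = {y\<in>Y. {x, y} \<in> E}" for x
  have fn: "finite (nY x)" for x using fY by (simp add: nY_def)
  define X' where "X' = {x\<in>X. card (nY x) < s}"
  have "card X' \<le> k"
  proof (rule ccontr)
    assume "\<not> ?thesis"
    then have "k \<le> card X'" by simp
    then obtain S where S: "S \<subseteq> X'" "card S = k" by (meson obtain_subset_with_card_n)
    have "S \<subseteq> X" using S(1) by (auto simp: X'_def)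
    then have fS: "finite S" using fX finite_subset by blast
    define N where "N = (\<Union>x\<in>S. nY x)"
    have "card N \<le> (\<Sum>x\<in>S. card (nY x))" unfolding N_def using fS by (rule card_UN_le)
    also have "\<dots> \<le> (\<Sum>x\<in>S. s)" using S(1) by (intro sum_mono) (auto simp: X'_def)
    finally have "card N \<le> k * s" using S(2) by simp
    moreover have "N \<subseteq> Y" by (auto simp: N_def nY_def)
    ultimately have "k \<le> card (Y - N)"
      using XY(5) fY by (simp add: card_Diff_subset finite_subset)
    then obtain T where T: "T \<subseteq> Y - N" "card T = k" by (meson obtain_subset_with_card_n)
    have "\<exists>x\<in>S. \<exists>y\<in>T. {x, y} \<in> E"
      using S T XY by (intro joined) (auto simp: X'_def)
    then show False using T(1) by (auto simp: N_def nY_def)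
  qed
  moreover have X'X: "X' \<subseteq> X" by (auto simp: X'_def)
  ultimately have cg: "k * s \<le> card (X - X')"
    using XY(4) fX by (simp add: card_Diff_subset finite_subset)
  define P where "P = Sigma (X - X') nY"
  have "k * s * s \<le> card (X - X') * s" using cg by simp
  also have "\<dots> = (\<Sum>x\<in>X - X'. s)" by simp
  also have "\<dots> \<le> (\<Sum>x\<in>X - X'. card (nY x))" by (intro sum_mono) (auto simp: X'_def)
  also have "\<dots> = card P" unfolding P_def using fX fn by (simp add: card_SigmaI)
  also have "\<dots> \<le> card {e\<in>E. \<exists>x\<in>X. \<exists>y\<in>Y. e = {x, y}}"
  proof (rule card_inj_on_le[of "\<lambda>(x, y). {x, y}"])
    have "x = x' \<and> y = y'" if "{x, y} = {x', y'}" "x \<in> X" "x' \<in> X" "y \<in> Y" "y' \<in> Y" for x y x' y'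
      using that XY(3) by (auto simp: doubleton_eq_iff)
    then show "inj_on (\<lambda>(x, y). {x, y}) P" 
      by (intro inj_onI) (clarsimp simp: P_def nY_def)
    show "(\<lambda>(x, y). {x, y}) ` P \<subseteq> {e\<in>E. \<exists>x\<in>X. \<exists>y\<in>Y. e = {x, y}}"
    proof
      fix e assume "e \<in> (\<lambda>(x, y). {x, y}) ` P"
      then obtain x y where "x \<in> X" "y \<in> Y" "{x, y} \<in> E" "e = {x, y}" by (auto simp: P_def nY_def)
      then show "e \<in> {e\<in>E. \<exists>x\<in>X. \<exists>y\<in>Y. e = {x, y}}" by blast
    qed
    have "{e\<in>E. \<exists>x\<in>X. \<exists>y\<in>Y. e = {x, y}} \<subseteq> (\<lambda>(x, y). {x, y}) ` (X \<times> Y)" by auto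
    then show "finite {e\<in>E. \<exists>x\<in>X. \<exists>y\<in>Y. e = {x, y}}" 
      by (rule finite_subset) (use fX fY in simp)
  qed
  finally show ?thesis .
qed

text \<open>By Bernoulli's inequality the product of \<open>2 * b\<close> factors
  \<open>1 + 1 / (2 * b)\<close> is at least 2, so every \<open>2 * b\<close> elements of a set
  halve its weight.\<close>

lemma weight_small:
  assumes "1 \<le> b" "2 * b * t \<le> c"
  shows "(1 / (1 + 1 / (2 * real b))) ^ c \<le> (1 / 2) ^ t"
proof -
  define \<beta> where "\<beta> = 1 + 1 / (2 * real b)"
  have b: "0 < real b" using assms(1) by simp
  then have \<beta>: "1 \<le> \<beta>" by (simp add: \<beta>_def)
  have "1 + real (2 * b) * (1 / (2 * real b)) \<le> \<beta> ^ (2 * b)"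
    unfolding \<beta>_def using b by (intro Bernoulli_inequality) (simp add: order.trans[of _ 0])
  then have "2 \<le> \<beta> ^ (2 * b)" using b by simp
  then have "2 ^ t \<le> (\<beta> ^ (2 * b)) ^ t" by (intro power_mono) auto
  also have "\<dots> = \<beta> ^ (2 * b * t)" by (simp add: power_mult)
  also have "\<dots> \<le> \<beta> ^ c" using assms(2) \<beta> by (rule power_increasing)
  finally have "(2::real) ^ t \<le> \<beta> ^ c" .
  then have "1 / \<beta> ^ c \<le> 1 / 2 ^ t" by (intro divide_left_mono) (use \<beta> in auto)
  then show ?thesis by (simp add: \<beta>_def power_one_over)
qed

lemma maker_builds_joined_graph:
  fixes G :: "'v graph"
  assumes G: "simple_graph G" and cV: "card (vset G) = n" and n: "1 \<le> n" "n < 2 ^ L"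
    and b: "1 \<le> b" and k: "1 \<le> k"
    and joined: "\<And>X Y. X \<subseteq> vset G \<Longrightarrow> Y \<subseteq> vset G \<Longrightarrow> X \<inter> Y = {} \<Longrightarrow> card X = k \<Longrightarrow> card Y = k \<Longrightarrow>
        \<exists>x\<in>X. \<exists>y\<in>Y. {x, y} \<in> eset G"
    and deg: "\<And>v. v \<in> vset G \<Longrightarrow> \<delta> * (6 * b * L) \<le> vdegree G v"
  shows "\<exists>\<sigma>. legal_strategy (eset G) 1 \<sigma> \<and>
     (\<forall>\<tau>. legal_strategy (eset G) b \<tau> \<longrightarrow>
        joined_graph (vset G) (maker_claims \<sigma> \<tau>) (k * (6 * b * L + 1)) \<delta>)"
proof -
  define V where "V = vset G"
  define E where "E = eset G"
  have sg: "finite V" "\<And>e. e \<in> E \<Longrightarrow> e \<subseteq> V \<and> card e = 2"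
    using G by (auto simp: simple_graph_def V_def E_def)
  have finE: "finite E" by (rule finite_subset[of _ "Pow V"]) (use sg in auto)
  have L: "1 \<le> L" using n by (cases L) auto
  \<comment> \<open>A block of \<open>6 * b * L\<close> edges weighs at most
    \<open>(1 / 2) ^ (3 * L)\<close>, and there are at most \<open>n * \<delta> \<le> 4 ^ L\<close>
    blocks; they contribute at most 1/2 in total.\<close>
  define s where "s = 6 * b * L"
  define m where "m = k * (s + 1)"
  have s6: "6 \<le> s" "1 \<le> b * L" using b L by (simp_all add: s_def)
  have edge: "u \<in> V \<and> v \<in> V \<and> u \<noteq> v" if "{u, v} \<in> E" for u v
    using sg(2)[OF that] by (auto simp: card_insert_if split: if_splits)
  define star where "star v = {e\<in>E. v \<in> e}" for v
  have fst: "finite (star v)" for v using finE by (simp add: star_def)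
  have star_sub: "{e\<in>M. v \<in> e} \<subseteq> (\<lambda>u. {v, u}) ` nbrs M v" if "M \<subseteq> E" for M v
  proof
    fix e assume e: "e \<in> {e\<in>M. v \<in> e}"
    then have "e \<in> E" "v \<in> e" using that by auto
    then obtain u where "e = {v, u}" using sg(2)[of e] by (auto simp: card_2_iff)
    then show "e \<in> (\<lambda>u. {v, u}) ` nbrs M v" using e by (auto simp: nbrs_def)
  qed
  have fin_nbrs: "finite (nbrs M v)" if "M \<subseteq> E" for M v
    by (rule finite_subset[OF _ sg(1)]) (use edge that in \<open>auto simp: nbrs_def\<close>)
  have star_card: "card {e\<in>M. v \<in> e} \<le> card (nbrs M v)" if "M \<subseteq> E" for M v
    using star_sub[OF that] fin_nbrs[OF that] by (rule surj_card_le[rotated])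
  have dstar: "\<delta> * s \<le> card (star v)" if "v \<in> V" for v
    using deg[of v] that by (simp add: star_def vdegree_def V_def E_def s_def)
  have "\<exists>bl. \<forall>i<\<delta>. bl i \<subseteq> star v \<and> card (bl i) = s \<and> (\<forall>j<\<delta>. i \<noteq> j \<longrightarrow> bl i \<inter> bl j = {})" if "v \<in> V" for v
    using disjoint_blocks[OF fst dstar[OF that]] .
  then obtain bl where bl: "\<And>v. v \<in> V \<Longrightarrow> \<forall>i<\<delta>. bl v i \<subseteq> star v \<and> card (bl v i) = s \<and> (\<forall>j<\<delta>. i \<noteq> j \<longrightarrow> bl v i \<inter> bl v j = {})"
    by metis
  obtain v0 where v0: "v0 \<in> V" using cV n(1) sg(1) unfolding V_def by (metis card.empty ex_in_conv not_one_le_zero)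
  have \<delta>n: "\<delta> \<le> n"
  proof -
    have "nbrs E v0 \<subseteq> V" using edge by (auto simp: nbrs_def)
    then have "card (nbrs E v0) \<le> n" using sg(1) cV by (metis V_def card_mono)
    moreover have "card (star v0) \<le> card (nbrs E v0)" using star_card[of E v0] by (simp add: star_def)
    moreover have "\<delta> \<le> \<delta> * s" using s6 by simp
    ultimately show ?thesis using dstar[OF v0] by linarith
  qed
  define H1 where "H1 = (\<lambda>(v, i). bl v i) ` (V \<times> {..<\<delta>})"
  define EE where "EE X Y = {e\<in>E. \<exists>x\<in>X. \<exists>y\<in>Y. e = {x, y}}" for X Y
  define Sm where "Sm = {X. X \<subseteq> V \<and> card X = m}"
  have finSm: "finite Sm" by (rule finite_subset[of _ "Pow V"]) (use sg(1) in \<open>auto simp: Sm_def\<close>)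
  define Prs where "Prs = {p\<in>Sm \<times> Sm. fst p \<inter> snd p = {}}"
  define H2 where "H2 = (\<lambda>(X, Y). EE X Y) ` Prs"
  have finPrs: "finite Prs" using finSm by (simp add: Prs_def)
  have fin12: "finite H1" "finite H2" using sg(1) finPrs by (simp_all add: H1_def H2_def)
  define w where "w = 1 / (1 + 1 / (2 * real b))"
  have w0: "0 \<le> w" by (simp add: w_def)
  have nL: "real n \<le> 2 ^ L" using n(2) by (metis less_imp_le of_nat_le_iff of_nat_numeral of_nat_power)
  have "(\<Sum>F\<in>H1. w ^ card F) \<le> (\<Sum>F\<in>H1. (1 / 2) ^ (3 * L))"
  proof (rule sum_mono)
    fix F assume "F \<in> H1"
    then have "card F = s" using bl by (auto simp: H1_def)
    then show "w ^ card F \<le> (1 / 2) ^ (3 * L)" unfolding w_def using b by (intro weight_small) (simp_all add: s_def)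
  qed
  also have "\<dots> = real (card H1) * (1 / 2) ^ (3 * L)" by simp
  also have "real (card H1) \<le> 2 ^ L * 2 ^ L"
  proof -
    have "card H1 \<le> card (V \<times> {..<\<delta>})" unfolding H1_def using sg(1) by (intro card_image_le) simp
    also have "\<dots> = n * \<delta>" using cV by (simp add: V_def card_cartesian_product)
    finally have "real (card H1) \<le> real n * real \<delta>" by (metis of_nat_le_iff of_nat_mult)
    also have "\<dots> \<le> 2 ^ L * 2 ^ L" using nL \<delta>n by (intro mult_mono) auto
    finally show ?thesis .
  qed
  also have "(2::real) ^ L * 2 ^ L * (1 / 2) ^ (3 * L) = (1 / 2) ^ L"
    by (simp add: power_mult power_mult_distrib[symmetric] power3_eq_cube)
  also have "(1 / 2) ^ L \<le> (1 / 2 :: real)" using L power_decreasing[of 1 L "1 / 2 :: real"] by simp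
  finally have s1: "(\<Sum>F\<in>H1. w ^ card F) \<le> 1 / 2" by simp
  \<comment> \<open>There are at most \<open>2 ^ (2 * L * m)\<close> pairs of \<open>m\<close>-sets.
    The \<open>k * s * s\<close> edges between two of them outnumber
    \<open>2 * b * (2 * L * m + 2)\<close> because \<open>m\<close> is only linear in
    \<open>s\<close>.\<close>
  have "(\<Sum>F\<in>H2. w ^ card F) \<le> (\<Sum>F\<in>H2. (1 / 2) ^ (2 * L * m + 2))"
  proof (rule sum_mono)
    fix F assume "F \<in> H2"
    then obtain X Y where XY: "X \<subseteq> V" "Y \<subseteq> V" "card X = m" "card Y = m" "X \<inter> Y = {}" "F = EE X Y"
      by (auto simp: H2_def Prs_def Sm_def)
    have "k * s * s \<le> card F"
      unfolding XY(6) EE_def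
      by (rule edges_between_large_sets[OF sg(1)]) (use joined XY in \<open>auto simp: V_def E_def m_def\<close>)
    moreover have "2 * b * (2 * L * m + 2) \<le> k * s * s"
    proof -
      define x where "x = b * L"
      have x: "1 \<le> x" "s = 6 * x" "b \<le> x" using s6 L by (simp_all add: x_def s_def)
      have "2 * b * (2 * L * m + 2) = 4 * x * k * (6 * x + 1) + 4 * b"
        unfolding m_def x(2) by (simp add: x_def algebra_simps)
      also have "\<dots> \<le> 4 * x * k * (7 * x) + 4 * (x * (x * k))"
      proof (rule add_mono)
        show "4 * x * k * (6 * x + 1) \<le> 4 * x * k * (7 * x)" using x(1) by (intro mult_le_mono2) simp
        have "x * 1 \<le> x * (x * k)" using x(1) k by (intro mult_le_mono2) simp
        then show "4 * b \<le> 4 * (x * (x * k))" using x(3) by linarith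
      qed
      also have "\<dots> = 32 * (x * (x * k))" by (simp add: algebra_simps)
      also have "\<dots> \<le> 36 * (x * (x * k))" by simp
      also have "\<dots> = k * s * s" unfolding x(2) by (simp add: algebra_simps)
      finally show ?thesis .
    qed
    ultimately show "w ^ card F \<le> (1 / 2) ^ (2 * L * m + 2)" unfolding w_def using b by (intro weight_small) linarith+
  qed
  also have "\<dots> = real (card H2) * (1 / 2) ^ (2 * L * m + 2)" by simp
  also have "real (card H2) \<le> 2 ^ (L * m) * 2 ^ (L * m)"
  proof -
    have "card Sm = n choose m" unfolding Sm_def using n_subsets[OF sg(1), of m] cV by (simp add: V_def)
    also have "\<dots> \<le> n ^ m"
      using binomial_le_pow[of m n] by (cases "m \<le> n") (simp_all add: binomial_eq_0)
    finally have "real (card Sm) \<le> real n ^ m" by (metis of_nat_le_iff of_nat_power)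
    also have "\<dots> \<le> (2 ^ L) ^ m" using nL by (intro power_mono) auto
    finally have Sm: "real (card Sm) \<le> 2 ^ (L * m)" by (simp add: power_mult)
    have "card H2 \<le> card Prs" unfolding H2_def using finPrs by (intro card_image_le) simp
    also have "\<dots> \<le> card (Sm \<times> Sm)" using finSm by (intro card_mono) (auto simp: Prs_def)
    also have "\<dots> = card Sm * card Sm" by (rule card_cartesian_product)
    finally have "real (card H2) \<le> real (card Sm * card Sm)" by (rule of_nat_mono)
    then have "real (card H2) \<le> real (card Sm) * real (card Sm)" by (simp only: of_nat_mult)
    also have "\<dots> \<le> 2 ^ (L * m) * 2 ^ (L * m)" using Sm by (intro mult_mono) simp_all
    finally show ?thesis .
  qed
  also have "(2::real) ^ (L * m) * 2 ^ (L * m) * (1 / 2) ^ (2 * L * m + 2) = 1 / 4"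
  proof -
    have e: "2 * L * m + 2 = L * m + L * m + 2" by simp
    define x where "x = L * m"
    show ?thesis unfolding e x_def[symmetric] power_add power_one_over by (simp add: field_simps)
  qed
  finally have s2: "(\<Sum>F\<in>H2. w ^ card F) \<le> 1 / 4" by simp
  have "(\<Sum>F\<in>H1 \<union> H2. w ^ card F) \<le> (\<Sum>F\<in>H1. w ^ card F) + (\<Sum>F\<in>H2. w ^ card F)"
    using sum.union_inter[OF fin12, of "\<lambda>F. w ^ card F"] w0 sum_nonneg[of "H1 \<inter> H2" "\<lambda>F. w ^ card F"] by simp
  then have sm: "(\<Sum>F\<in>H1 \<union> H2. w ^ card F) < 1" using s1 s2 by linarith
  have pw: "H1 \<union> H2 \<subseteq> Pow E"
  proof -
    have "bl v i \<subseteq> E" if "v \<in> V" "i < \<delta>" for v i using bl[OF that(1)] that(2) by (auto simp: star_def)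
    then have "H1 \<subseteq> Pow E" by (auto simp: H1_def)
    moreover have "H2 \<subseteq> Pow E" by (auto simp: H2_def EE_def)
    ultimately show ?thesis by simp
  qed
  obtain \<sigma> where \<sigma>1: "legal_strategy E 1 \<sigma>"
    "\<forall>\<tau>. legal_strategy E b \<tau> \<longrightarrow> (\<forall>F\<in>H1 \<union> H2. F \<inter> maker_claims \<sigma> \<tau> \<noteq> {})"
    using maker_hits_family[OF finE pw b sm[unfolded w_def]] by (elim exE conjE) (rule that)
  then have \<sigma>: "legal_strategy E 1 \<sigma>"
    "\<And>\<tau> F. legal_strategy E b \<tau> \<Longrightarrow> F \<in> H1 \<union> H2 \<Longrightarrow> F \<inter> maker_claims \<sigma> \<tau> \<noteq> {}" by simp_all
  have "joined_graph V (maker_claims \<sigma> \<tau>) m \<delta>" if \<tau>: "legal_strategy E b \<tau>" for \<tau>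
  proof
    define M where "M = maker_claims \<sigma> \<tau>"
    have ME: "M \<subseteq> E" using \<sigma>(1) by (auto simp: M_def maker_claims_def legal_strategy_def)
    show "finite V" by (rule sg(1))
    show "1 \<le> m" using k by (simp add: m_def)
    show "u \<in> V \<and> u \<noteq> v" if "{u, v} \<in> maker_claims \<sigma> \<tau>" for u v
      using edge[of u v] ME that by (auto simp: M_def)
    show "\<exists>x\<in>X. \<exists>y\<in>Y. {x, y} \<in> maker_claims \<sigma> \<tau>"
      if "X \<subseteq> V" "Y \<subseteq> V" "X \<inter> Y = {}" "card X = m" "card Y = m" for X Y
    proof -
      have "EE X Y \<in> H2" unfolding H2_def by (rule image_eqI[of _ _ "(X, Y)"]) (use that in \<open>auto simp: Sm_def Prs_def\<close>)
      then have "EE X Y \<inter> M \<noteq> {}" using \<sigma>(2)[OF \<tau>] by (simp add: M_def)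
      then show ?thesis by (auto simp: EE_def M_def)
    qed
    show "\<delta> \<le> card (nbrs (maker_claims \<sigma> \<tau>) v)" if v: "v \<in> V" for v
    proof -
      have "\<exists>e. e \<in> bl v i \<inter> M" if "i < \<delta>" for i
      proof -
        have "bl v i \<in> H1" unfolding H1_def by (rule image_eqI[of _ _ "(v, i)"]) (use v that in auto)
        then show ?thesis using \<sigma>(2)[OF \<tau>, of "bl v i"] by (auto simp: M_def)
      qed
      then obtain g where g: "\<And>i. i < \<delta> \<Longrightarrow> g i \<in> bl v i \<inter> M" by metis
      have "card {..<\<delta>} \<le> card {e\<in>M. v \<in> e}"
      proof (rule card_inj_on_le[of g])
        show "inj_on g {..<\<delta>}"
        proof (rule inj_onI)
          fix i j assume "i \<in> {..<\<delta>}" "j \<in> {..<\<delta>}" "g i = g j"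
          then have "g i \<in> bl v i \<inter> bl v j" "i < \<delta>" "j < \<delta>" using g[of i] g[of j] by auto
          then show "i = j" using bl[OF v] by blast
        qed
        show "g ` {..<\<delta>} \<subseteq> {e\<in>M. v \<in> e}" 
        proof
          fix e assume "e \<in> g ` {..<\<delta>}"
          then obtain i where "i < \<delta>" "e = g i" by blast
          then show "e \<in> {e\<in>M. v \<in> e}" using g[of i] bl[OF v] by (auto simp: star_def)
        qed
        show "finite {e\<in>M. v \<in> e}" by (rule finite_subset[OF _ finE]) (use ME in auto)
      qed
      then show ?thesis using star_card[OF ME, of v] by (simp add: M_def)
    qed
  qed
  then show ?thesis using \<sigma>(1) unfolding V_def E_def m_def s_def by blast
qed

section \<open>From Maker's graph to all trees, and the choice of parameters\<close>

text \<open>Degrees are integers, so \<open>\<Delta>\<close> may be replaced by its floor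
  \<open>D\<close>, which bounds the numbers of children too.\<close>

lemma joined_graph_contains_trees:
  fixes V :: "'v set" and M :: "'v set set"
  assumes jg: "joined_graph V M m \<delta>" and cV: "card V = n" and n: "2 \<le> n" "n < 2 ^ L"
    and D: "D = nat \<lfloor>\<Delta>\<rfloor>"
    and n_large: "1000 * L * (D * m * m) + 30 * L * (D * D * m) \<le> n"
    and \<delta>: "600 * L * (D * m * m) \<le> \<delta>"
    and T: "T \<in> bounded_degree_trees n \<Delta>"
  shows "contains_copy (V, M) T"
proof -
  interpret joined_graph V M m \<delta> by (rule jg)
  have tree: "is_tree T" "card (vset T) = n" "real (max_degree T) \<le> \<Delta>"
    using T by (auto simp: bounded_degree_trees_def)
  have finT: "finite (vset T)" and eT: "\<And>e. e \<in> eset T \<Longrightarrow> e \<subseteq> vset T"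
    using tree(1) by (auto simp: is_tree_def simple_graph_def)
  obtain ord par where op: "bij_betw ord {..<n} (vset T)" "\<forall>j. 0 < j \<and> j < n \<longrightarrow> par j < j"
    "eset T = {{ord j, ord (par j)} | j. 0 < j \<and> j < n}"
    using tree_parent_order[OF tree(1,2)] by (elim exE conjE) (rule that)
  have par: "par j < j" if "0 < j" "j < n" for j using op(2) that by blast
  have inj: "inj_on ord {..<n}" by (rule bij_betw_imp_inj_on[OF op(1)])
  have finE: "finite (eset T)" by (rule finite_subset[of _ "Pow (vset T)"]) (use eT finT in auto)
  have ch: "card (children n par i) \<le> D" for i
  proof (cases "i < n")
    case True
    have "card (children n par i) \<le> vdegree T (ord i)"
      unfolding vdegree_def
    proof (rule card_inj_on_le[of "\<lambda>j. {ord j, ord i}"])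
      show "inj_on (\<lambda>j. {ord j, ord i}) (children n par i)"
      proof (rule inj_onI)
        fix j j' assume j: "j \<in> children n par i" "j' \<in> children n par i" "{ord j, ord i} = {ord j', ord i}"
        then have "ord j = ord j'" by (auto simp: doubleton_eq_iff)
        then show "j = j'" using inj j(1,2) by (auto simp: inj_on_def children_def)
      qed
      show "(\<lambda>j. {ord j, ord i}) ` children n par i \<subseteq> {e \<in> eset T. ord i \<in> e}"
        unfolding op(3) children_def by blast
      show "finite {e \<in> eset T. ord i \<in> e}" using finE by simp
    qed
    also have "vdegree T (ord i) \<le> max_degree T"
      unfolding max_degree_def using finT bij_betwE[OF op(1)] True by (intro Max_ge) auto
    finally have "real (card (children n par i)) \<le> real (max_degree T)" by (rule of_nat_mono)
    then have "real (card (children n par i)) \<le> \<Delta>" using tree(3) by (rule order_trans)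
    then show ?thesis unfolding D by (rule le_nat_floor)
  next
    case False
    have "j \<notin> children n par i" for j using par[of j] False by (auto simp: children_def)
    then have "children n par i = {}" by blast
    then show ?thesis by simp
  qed
  \<comment> \<open>A tree on at least two vertices is at hand, so the root has a child and
    \<open>D\<close> is positive.\<close>
  have "par 1 = 0" using par[of 1] n by simp
  then have "1 \<in> children n par 0" using n by (simp add: children_def)
  then have "0 < card (children n par 0)" by (auto simp: card_gt_0_iff)
  then have D1: "1 \<le> D" using ch[of 0] by linarith
  have "\<exists>F. inj_on F {..<n} \<and> F ` {..<n} \<subseteq> V \<and> (\<forall>j. 0 < j \<and> j < n \<longrightarrow> {F (par j), F j} \<in> M)"
    by (rule embed_spanning_tree[OF cV n D1 par ch n_large \<delta>])
  then obtain F where F: "inj_on F {..<n}" "F ` {..<n} \<subseteq> V" "\<And>j. 0 < j \<Longrightarrow> j < n \<Longrightarrow> {F (par j), F j} \<in> M"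
    by blast
  define g where "g = the_inv_into {..<n} ord"
  have g: "bij_betw g (vset T) {..<n}" unfolding g_def by (rule bij_betw_the_inv_into[OF op(1)])
  have gord: "g (ord j) = j" if "j < n" for j using the_inv_into_f_f[OF inj] that by (simp add: g_def)
  show ?thesis
    unfolding contains_copy_def fst_conv snd_conv
  proof (intro exI[of _ "F \<circ> g"] conjI ballI)
    show "inj_on (F \<circ> g) (vset T)" using F(1) g by (simp add: comp_inj_on bij_betw_def)
    show "(F \<circ> g) ` vset T \<subseteq> V" using F(2) bij_betwE[OF g] by auto
    fix e assume "e \<in> eset T"
    then obtain j where j: "0 < j" "j < n" "e = {ord j, ord (par j)}" unfolding op(3) by blast
    have "par j < n" using par[OF j(1,2)] j by simp
    then have "(F \<circ> g) ` e = {F (par j), F j}" using j gord by (auto simp: insert_commute)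
    then show "(F \<circ> g) ` e \<in> M" using F(3)[OF j(1,2)] by simp
  qed
qed

text \<open>If \<open>exp_size n d > 1\<close>, a single vertex expands and has at least
  \<open>d\<close> neighbours. Otherwise \<open>exp_size n d = 1\<close>, any two vertices are
  joined, and \<open>n - 1 \<ge> n / 2 \<ge> d / 2\<close>; this case costs the factor 2.\<close>

lemma expander_vdegree:
  assumes exp: "expander n d G" and d: "0 < d" "d \<le> real n" and n: "2 \<le> n" and v: "v \<in> vset G"
  shows "d / 2 \<le> real (vdegree G v)"
proof -
  have G: "finite (vset G)" "\<And>e. e \<in> eset G \<Longrightarrow> e \<subseteq> vset G" "card (vset G) = n"
    using exp by (auto simp: expander_def simple_graph_def)
  have finE: "finite (eset G)" by (rule finite_subset[of _ "Pow (vset G)"]) (use G in auto)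
  have deg: "card N \<le> vdegree G v" if N: "\<And>u. u \<in> N \<Longrightarrow> {v, u} \<in> eset G" for N
    unfolding vdegree_def
  proof (rule card_inj_on_le[of "\<lambda>u. {v, u}"])
    show "inj_on (\<lambda>u. {v, u}) N" by (rule inj_onI) (auto simp: doubleton_eq_iff)
    show "(\<lambda>u. {v, u}) ` N \<subseteq> {e \<in> eset G. v \<in> e}" using N by auto
  qed (use finE in simp)
  show ?thesis
  proof (cases "1 < exp_size n d")
    case True
    have "d * real (card {v}) \<le> real (card (nbhd G {v}))"
      using exp v True unfolding expander_def by (metis One_nat_def card.empty card.insert empty_iff
          empty_subsetI finite.emptyI insert_subset le_refl)
    moreover have "card (nbhd G {v}) \<le> vdegree G v" by (rule deg) (auto simp: nbhd_def)
    ultimately show ?thesis using d by simp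
  next
    case False
    have "0 < real n / (2 * d)" using d n by simp
    then have "0 < exp_size n d" by (simp add: exp_size_def)
    then have one: "exp_size n d = 1" using False by simp
    have adj: "{v, u} \<in> eset G" if "u \<in> vset G - {v}" for u
    proof -
      have "{v} \<subseteq> vset G \<and> {u} \<subseteq> vset G \<and> {v} \<inter> {u} = {} \<and> card {v} = exp_size n d \<and> card {u} = exp_size n d"
        using v that one by auto
      then have "0 < edge_count G {v} {u}" using exp unfolding expander_def by blast
      then have "{(x, y). x \<in> {v} \<and> y \<in> {u} \<and> {x, y} \<in> eset G} \<noteq> {}"
        unfolding edge_count_def by (metis card.empty less_irrefl)
      then show ?thesis by auto
    qed
    have "card (vset G - {v}) \<le> vdegree G v" by (rule deg[OF adj])
    then have "n - 1 \<le> vdegree G v" using G v by simp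
    then show ?thesis using d n by linarith
  qed
qed

text \<open>Here \<open>ln n = 0\<close> and the lower bound on \<open>d\<close> says nothing. The
  board is empty, and so is the only move.\<close>

lemma makers_win_single_vertex:
  assumes G: "simple_graph G" "card (vset G) = 1"
  shows "universality_game_makers_win 1 b 1 \<Delta> (G :: 'v graph)"
proof -
  have no_edges: "eset H = {}" if "simple_graph H" "card (vset H) = 1" for H :: "'w graph"
  proof -
    have "card e \<le> 1" if "e \<in> eset H" for e
      using \<open>simple_graph H\<close> \<open>card (vset H) = 1\<close> that card_mono[of "vset H" e] by (auto simp: simple_graph_def)
    then show ?thesis using \<open>simple_graph H\<close> by (fastforce simp: simple_graph_def)
  qed
  obtain x where x: "vset G = {x}" using G(2) by (auto simp: card_1_singleton_iff)
  have "contains_copy (vset G, {}) T" if "T \<in> bounded_degree_trees 1 \<Delta>" for T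
  proof -
    have T: "simple_graph T" "card (vset T) = 1"
      using that by (auto simp: bounded_degree_trees_def is_tree_def)
    then obtain y where "vset T = {y}" by (auto simp: card_1_singleton_iff)
    then show ?thesis using no_edges[OF T] x by (auto simp: contains_copy_def)
  qed
  then have "{} \<in> tree_universal_sets 1 \<Delta> G" by (simp add: tree_universal_sets_def)
  moreover have "legal_strategy (eset G) 1 (\<lambda>_. {})" using no_edges[OF G] by (simp add: legal_strategy_def)
  ultimately show ?thesis unfolding universality_game_makers_win_def makers_win_def by blast
qed

text \<open>In terms of \<open>x = n powr (1/3)\<close> and \<open>t = ln n\<close> the hypothesis
  says \<open>d \<ge> 10000 * b * \<Delta> * t * x\<^sup>2\<close>, and \<open>n = x ^ 3\<close>.
  Then \<open>\<Delta> * m\<close> is at most of order \<open>x\<close>,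
  \<open>L * D * m\<^sup>2\<close> at most of order \<open>x\<^sup>2\<close> and
  \<open>\<delta>\<close> at least of order \<open>x\<^sup>2\<close>; the factor 10000 decides the
  comparison.\<close>

lemma makers_win_expander:
  fixes G :: "'v graph" and \<Delta> d :: real
  assumes n: "2 \<le> n" and b: "1 \<le> b" and \<Delta>: "0 < \<Delta>" "ln (real n) \<le> \<Delta>"
    and d: "0 < d" "d \<le> real n" "10000 * real b * \<Delta> * real n powr (2/3) * ln (real n) \<le> d"
    and exp: "expander n d G"
  shows "universality_game_makers_win 1 b n \<Delta> G"
proof -
  define x where "x = real n powr (1/3)"
  define t where "t = ln (real n)"
  have n0: "0 < real n" using n by simp
  have x2: "real n powr (2/3) = x * x" by (simp add: x_def flip: powr_add)
  have "x * (x * x) = real n powr 1" unfolding x_def powr_add[symmetric] by simp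
  then have x3: "real n = x * (x * x)" using n0 by simp
  have x1: "1 \<le> x" unfolding x_def using n by (intro ge_one_powr_ge_zero) auto
  have "ln 2 \<le> t" unfolding t_def using n by (intro ln_mono) auto
  moreover have ln2: "1 / 2 \<le> ln (2::real)" using exp_half_le2 by (subst ln_ge_iff) (simp, assumption)
  ultimately have t: "1 / 2 \<le> t" by linarith
  have \<Delta>t: "1 / 2 \<le> \<Delta>" "t \<le> \<Delta>" using \<Delta>(2) t unfolding t_def by linarith+
  have b0: "1 \<le> real b" using b by simp
  have dl: "10000 * (real b * \<Delta> * t) * (x * x) \<le> d" using d(3) unfolding x2 t_def by (simp add: algebra_simps)
  have bt: "10000 * (real b * \<Delta> * t) \<le> x"
  proof -
    have "10000 * (real b * \<Delta> * t) * (x * x) \<le> x * (x * x)" using dl d(2) unfolding x3 by linarith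
    then show ?thesis using x1 by simp
  qed

  \<comment> \<open>The number of binary digits of \<open>n\<close>, an integral substitute for
    \<open>ln n\<close>.\<close>
  define L where "L = (LEAST L. n < 2 ^ L)"
  have "n < 2 ^ n" by (rule less_exp)
  then have nL: "n < 2 ^ L" unfolding L_def by (rule LeastI)
  have L1: "1 \<le> L" using nL n by (cases L) auto
  have Lt: "real L \<le> 4 * t"
  proof -
    obtain l where l: "L = Suc l" using L1 by (cases L) auto
    have "\<not> n < 2 ^ l" using not_less_Least[of l "\<lambda>L. n < 2 ^ L"] l unfolding L_def by auto
    then have "2 ^ l \<le> real n" by (metis linorder_not_less of_nat_le_iff of_nat_numeral of_nat_power)
    then have "ln (2 ^ l) \<le> t" unfolding t_def by (intro ln_mono) auto
    then have "real l * ln 2 \<le> t" by (simp add: ln_realpow)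
    moreover have "real l * (1 / 2) \<le> real l * ln 2" using ln2 by (intro mult_left_mono) auto
    ultimately have "real l \<le> 2 * t" by linarith
    then show ?thesis using t l by simp
  qed

  define k where "k = exp_size n d"
  \<comment> \<open>Because of \<open>d \<le> n\<close>, the 1 lost in rounding up is at most
    \<open>n / d\<close>; hence the factor 3/2 in \<open>kd\<close>.\<close>
  have nd: "1 \<le> real n / d" using d by simp
  have "0 < real n / (2 * d)" using d n0 by simp
  then have k1: "1 \<le> k" by (simp add: k_def exp_size_def Suc_le_eq)
  have "real k \<le> real n / (2 * d) + 1"
    using \<open>0 < real n / (2 * d)\<close> of_int_ceiling_le_add_one[of "real n / (2 * d)"] by (simp add: k_def exp_size_def)
  moreover have "real n / (2 * d) = real n / d / 2" by simp
  ultimately have kd: "real k \<le> 3 / 2 * (real n / d)" using nd by linarith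
  define m where "m = k * (6 * b * L + 1)"
  \<comment> \<open>\<open>12 = 2 * 6\<close>: a vertex has at least \<open>d / 2\<close> edges, and
    each unit of minimum degree takes a block of \<open>6 * b * L\<close> of them.\<close>
  define \<delta> where "\<delta> = nat \<lfloor>d / (12 * real b * real L)\<rfloor>"
  define D where "D = nat \<lfloor>\<Delta>\<rfloor>"
  have D\<Delta>: "real D \<le> \<Delta>" unfolding D_def using \<Delta>(1) by (simp add: of_nat_floor)

  have "real m \<le> 7 * (real k * (real b * real L))"
  proof -
    have "1 \<le> b * L" using b L1 by simp
    then have "k * (6 * b * L + 1) \<le> k * (7 * (b * L))" by (intro mult_le_mono2) simp
    then have "real m \<le> real (k * (7 * (b * L)))" unfolding m_def by (rule of_nat_mono)
    then show ?thesis by simp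
  qed
  also have "\<dots> \<le> 7 * ((3 / 2 * (real n / d)) * (real b * (4 * t)))"
    using kd Lt b0 nd by (intro mult_left_mono mult_mono) auto
  also have "\<dots> = 42 * (real n * real b * t) / d" by simp
  finally have m1: "real m \<le> 42 * (real n * real b * t) / d" .
  have \<Delta>m: "\<Delta> * real m \<le> 42 * x / 10000"
  proof -
    have "\<Delta> * real m \<le> \<Delta> * (42 * (real n * real b * t) / d)" using m1 \<Delta>(1) by (intro mult_left_mono) auto
    also have "\<dots> = 42 * x * ((real b * \<Delta> * t) * (x * x)) / d" unfolding x3 by simp
    also have "\<dots> \<le> 42 * x * (d / 10000) / d"
      using dl d(1) x1 by (intro divide_right_mono mult_left_mono) auto
    also have "\<dots> = 42 * x / 10000" using d(1) by simp
    finally show ?thesis .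
  qed
  have Dm: "real D * real m \<le> 42 * x / 10000"
    using \<Delta>m D\<Delta> mult_right_mono[OF D\<Delta>, of "real m"] by simp
  \<comment> \<open>Here \<open>ln n \<le> \<Delta>\<close> enters: \<open>L\<close> is treated like
    \<open>D\<close>, and \<open>L * D * m\<^sup>2\<close> splits into
    \<open>(D * m) * (L * m)\<close>.\<close>
  have Lm: "real L * real m \<le> 168 * x / 10000"
  proof -
    have "real L * real m \<le> (4 * \<Delta>) * real m" using Lt \<Delta>t(2) by (intro mult_right_mono) auto
    then show ?thesis using \<Delta>m by simp
  qed
  have LDmm: "real L * (real D * real m * real m) \<le> (42 * 168) * (x * x) / 10000 ^ 2"
  proof -
    have "(real D * real m) * (real L * real m) \<le> (42 * x / 10000) * (168 * x / 10000)"
      using Dm Lm x1 by (intro mult_mono) auto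
    then show ?thesis by (simp add: power2_eq_square algebra_simps)
  qed
  \<comment> \<open>The factor \<open>L * D\<close> is bounded by a multiple of \<open>x\<close>
    through \<open>bt\<close>, which compares the lower bound on \<open>d\<close> with
    \<open>d \<le> n\<close>.\<close>
  have LDDm: "real L * (real D * real D * real m) \<le> 168 * (x * x) / 10000 ^ 2"
  proof -
    have "real L * real D \<le> (4 * t) * \<Delta>" using Lt D\<Delta> t by (intro mult_mono) auto
    also have "\<dots> \<le> 4 * (real b * \<Delta> * t)" using b0 t \<Delta>(1) mult_right_mono[of 1 "real b" "\<Delta> * t"] by (simp add: algebra_simps)
    also have "\<dots> \<le> 4 * x / 10000" using bt by simp
    finally have "(real L * real D) * (real D * real m) \<le> (4 * x / 10000) * (42 * x / 10000)"
      using Dm x1 by (intro mult_mono) auto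
    then show ?thesis by (simp add: power2_eq_square algebra_simps)
  qed
  have xx: "1 * (x * x) \<le> x * (x * x)" using x1 by (intro mult_right_mono) auto
  have n_large: "1000 * L * (D * m * m) + 30 * L * (D * D * m) \<le> n"
  proof -
    have "real (1000 * L * (D * m * m) + 30 * L * (D * D * m)) =
        1000 * (real L * (real D * real m * real m)) + 30 * (real L * (real D * real D * real m))" by simp
    also have "\<dots> \<le> 1000 * ((42 * 168) * (x * x) / 10000 ^ 2) + 30 * (168 * (x * x) / 10000 ^ 2)"
      using LDmm LDDm by linarith
    also have "\<dots> \<le> real n" unfolding x3 using xx x1 by (simp add: power2_eq_square)
    finally show ?thesis by (simp only: of_nat_le_iff)
  qed
  have \<delta>_large: "600 * L * (D * m * m) \<le> \<delta>"
  proof -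
    have L0: "0 < real L" using L1 by simp
    have "10000 * (1 / 2) * (x * x) / 48 \<le> d / (12 * real b * real L)"
    proof -
      have "(real b * (1 / 2) * t) * (x * x) \<le> (real b * \<Delta> * t) * (x * x)"
        using \<Delta>t b0 t by (intro mult_right_mono mult_left_mono) auto
      then have "10000 * (1 / 2) * (x * x) * (real b * t) \<le> d" using dl by (simp add: algebra_simps)
      moreover have "10000 * (1 / 2) * (x * x) / 48 * (12 * real b * real L) \<le>
          10000 * (1 / 2) * (x * x) / 48 * (12 * real b * (4 * t))"
        using Lt b0 x1 by (intro mult_left_mono) auto
      ultimately have "10000 * (1 / 2) * (x * x) / 48 * (12 * real b * real L) \<le> d" by (simp add: algebra_simps)
      then show ?thesis using b0 L0 by (simp add: pos_le_divide_eq)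
    qed
    moreover have "d / (12 * real b * real L) - 1 \<le> real \<delta>"
      unfolding \<delta>_def by linarith
    moreover have "1 \<le> x * x" using x1 mult_mono[of 1 x 1 x] by simp
    moreover have "real (600 * L * (D * m * m)) = 600 * (real L * (real D * real m * real m))" by simp
    moreover have "600 * (real L * (real D * real m * real m)) \<le> 600 * ((42 * 168) * (x * x) / 10000 ^ 2)"
      using LDmm by linarith
    moreover have "600 * ((42 * 168) * (x * x) / 10000 ^ 2) \<le> x * x" using x1 by (simp add: power2_eq_square)
    ultimately have "real (600 * L * (D * m * m)) \<le> real \<delta>" by linarith
    then show ?thesis by (simp only: of_nat_le_iff)
  qed

  have sg: "simple_graph G" "card (vset G) = n" using exp by (auto simp: expander_def)
  have "\<exists>\<sigma>. legal_strategy (eset G) 1 \<sigma> \<and>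
     (\<forall>\<tau>. legal_strategy (eset G) b \<tau> \<longrightarrow> joined_graph (vset G) (maker_claims \<sigma> \<tau>) m \<delta>)"
    unfolding m_def
  proof (rule maker_builds_joined_graph[OF sg _ nL b k1])
    show "1 \<le> n" using n by simp
    fix X Y assume XY: "X \<subseteq> vset G" "Y \<subseteq> vset G" "X \<inter> Y = {}" "card X = k" "card Y = k"
    then have "0 < edge_count G X Y" using exp unfolding expander_def k_def by blast
    then have "{(x, y). x \<in> X \<and> y \<in> Y \<and> {x, y} \<in> eset G} \<noteq> {}"
      unfolding edge_count_def by (metis card.empty less_irrefl)
    then show "\<exists>x\<in>X. \<exists>y\<in>Y. {x, y} \<in> eset G" by auto
  next
    fix v assume v: "v \<in> vset G"
    have bL: "0 < 12 * real b * real L" using b0 L1 by simp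
    have "real \<delta> \<le> d / (12 * real b * real L)"
      unfolding \<delta>_def using d(1) bL by (intro of_nat_floor) auto
    then have "real \<delta> * (12 * real b * real L) \<le> d" using bL by (simp add: pos_le_divide_eq)
    then have "real (\<delta> * (6 * b * L)) \<le> d / 2" by simp
    also have "\<dots> \<le> real (vdegree G v)" by (rule expander_vdegree[OF exp d(1,2) n v])
    finally show "\<delta> * (6 * b * L) \<le> vdegree G v" by (simp only: of_nat_le_iff)
  qed
  then obtain \<sigma> where \<sigma>: "legal_strategy (eset G) 1 \<sigma>"
    "\<And>\<tau>. legal_strategy (eset G) b \<tau> \<Longrightarrow> joined_graph (vset G) (maker_claims \<sigma> \<tau>) m \<delta>" by blast
  have "maker_claims \<sigma> \<tau> \<in> tree_universal_sets n \<Delta> G" if \<tau>: "legal_strategy (eset G) b \<tau>" for \<tau>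
  proof -
    have "maker_claims \<sigma> \<tau> \<subseteq> eset G" using \<sigma>(1) by (auto simp: maker_claims_def legal_strategy_def)
    then show ?thesis unfolding tree_universal_sets_def
      using joined_graph_contains_trees[OF \<sigma>(2)[OF \<tau>] sg(2) n nL D_def n_large \<delta>_large] by blast
  qed
  then show ?thesis unfolding universality_game_makers_win_def makers_win_def using \<sigma>(1) by blast
qed

theorem theorem2p11:
  shows "\<exists>c::real. c > 0 \<and>
    (\<forall>(n::nat) (b::nat) (\<Delta>::real).
       1 \<le> n \<and> 1 \<le> b \<and> 0 < \<Delta> \<and> ln (real n) \<le> \<Delta> \<longrightarrow>
       (\<forall>(d::real) (G::nat graph).
          0 < d \<and> d \<le> real n \<and>
          c * real b * \<Delta> * real n powr (2/3) * ln (real n) \<le> d \<and>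
          expander n d G \<longrightarrow>
          universality_game_makers_win 1 b n \<Delta> G))"
proof (intro exI[of _ 10000] conjI allI impI)
  fix n b :: nat and \<Delta> d :: real and G :: "nat graph"
  assume n: "1 \<le> n \<and> 1 \<le> b \<and> 0 < \<Delta> \<and> ln (real n) \<le> \<Delta>"
    and d: "0 < d \<and> d \<le> real n \<and> 10000 * real b * \<Delta> * real n powr (2/3) * ln (real n) \<le> d \<and> expander n d G"
  show "universality_game_makers_win 1 b n \<Delta> G"
  proof (cases "n = 1")
    case True
    have "simple_graph G" "card (vset G) = n" using d by (simp_all add: expander_def)
    then show ?thesis using makers_win_single_vertex unfolding True by blast
  next
    case False
    then have "2 \<le> n" using n by simp
    then show ?thesis using n d by (intro makers_win_expander) blast+
  qed
qed simp

end
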